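(* Let $\alpha\in\mathbb{C}$ with $|\alpha|\le 1$. Then the following hold. (i) $\mathcal{M}(\alpha)\subset\mathcal{C}_H^0$. (ii) If $f=h+\overline{g}\in\mathcal{M}(\alpha)$, where $h(z)=z+\sum_{n=2}^{\infty}a_nz^n$ and $g(z)=\sum_{n=1}^{\infty}b_nz^n$, then $b_1=g'(0)=0$ and $$|a_n|\le\frac{n+1}{2},\qquad |b_n|\le\frac{n-1}{2}|\alpha|\qquad (n=2,3,\ldots).$$ Moreover, these bounds are sharp for each $\alpha$ (for every $n\ge 2$ equality is attained in each of them by some function in $\mathcal{M}(\alpha)$). (iii) For every $f\in\mathcal{M}(\alpha)$, $$|f(z)|\le\frac{|z|}{(1-|z|)^2}\left[1-\frac12(1-|\alpha|)|z|\right],\qquad z\in\mathbb{D}.$$ This bound is sharp (for every $r\in(0,1)$ there are $f\in\mathcal{M}(\alpha)$ and $z$ with $|z|=r$ for which equality holds). (iv) The area of the image $f(\mathbb{D})$ of each function $f\in\mathcal{M}(\alpha)$ is greater than or equal to $\pi(1-|\alpha|^2/2)$, and this minimum is attained only for the function $g_\alpha(z)=z+\overline{\alpha}\,\overline{z}^{\,2}/2$.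
   Context: $\mathbb{D}=\{z\in\mathbb{C}:|z|<1\}$. $\mathcal{H}$ is the class of complex-valued harmonic functions $f$ in $\mathbb{D}$ with $f(0)=0$ and $f_z(0)=1$; such $f$ is written $f=h+\overline{g}$ with $h(z)=z+\sum_{n\ge2}a_nz^n$ and $g(z)=\sum_{n\ge1}b_nz^n$ analytic in $\mathbb{D}$. For $\alpha\in\mathbb{C}$, $|\alpha|\le1$, $\mathcal{M}(\alpha)$ is the set of all $f=h+\overline{g}\in\mathcal{H}$ with $$g'(z)=\alpha zh'(z)\quad\text{and}\quad \operatorname{Re}\left(1+\frac{zh''(z)}{h'(z)}\right)>-\frac12\quad\text{for all }z\in\mathbb{D}$$ (in particular $h'$ has no zeros in $\mathbb{D}$). $\mathcal{C}_H^0$ is the class of $f\in\mathcal{H}$ that are univalent and sense-preserving in $\mathbb{D}$, satisfy $f_{\bar z}(0)=0$, and map $\mathbb{D}$ onto a close-to-convex domain, i.e. a domain whose complement in $\mathbb{C}$ can be written as a union of closed half-lines (rays) whose relative interiors are pairwise disjoint. *)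

theory Defs
  imports "HOL-Complex_Analysis.Complex_Analysis"
begin

abbreviation unit_disc :: "complex set" where
  "unit_disc \<equiv> ball 0 1"

subsection \<open>Harmonic functions\<close>

definition partial_x :: "(complex \<Rightarrow> complex) \<Rightarrow> complex \<Rightarrow> complex" where
  "partial_x f z = frechet_derivative f (at z) 1"

definition partial_y :: "(complex \<Rightarrow> complex) \<Rightarrow> complex \<Rightarrow> complex" where
  "partial_y f z = frechet_derivative f (at z) \<i>"

(* Differentiability is over the reals (Frechet); on an open set the first three
   conjuncts together with continuity of the second partials say that f is C^2. *)
definition harmonic_on :: "(complex \<Rightarrow> complex) \<Rightarrow> complex set \<Rightarrow> bool" where
  "harmonic_on f S \<longleftrightarrow> open S \<and>
     f differentiable_on S \<and> partial_x f differentiable_on S \<and> partial_y f differentiable_on S \<and>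
     continuous_on S (partial_x (partial_x f)) \<and> continuous_on S (partial_y (partial_x f)) \<and>
     continuous_on S (partial_x (partial_y f)) \<and> continuous_on S (partial_y (partial_y f)) \<and>
     (\<forall>z\<in>S. partial_x (partial_x f) z + partial_y (partial_y f) z = 0)"

definition wirtinger_z :: "(complex \<Rightarrow> complex) \<Rightarrow> complex \<Rightarrow> complex" where
  "wirtinger_z f z = (partial_x f z - \<i> * partial_y f z) / 2"

definition wirtinger_zbar :: "(complex \<Rightarrow> complex) \<Rightarrow> complex \<Rightarrow> complex" where
  "wirtinger_zbar f z = (partial_x f z + \<i> * partial_y f z) / 2"

(* Positive Jacobian. *)
definition sense_preserving_on :: "(complex \<Rightarrow> complex) \<Rightarrow> complex set \<Rightarrow> bool" where
  "sense_preserving_on f S \<longleftrightarrow>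
     (\<forall>z\<in>S. (cmod (wirtinger_z f z))\<^sup>2 - (cmod (wirtinger_zbar f z))\<^sup>2 > 0)"

(* Functions are total, but only their values on the disc matter in all classes below. *)
definition class_H :: "(complex \<Rightarrow> complex) set" where
  "class_H = {f. harmonic_on f unit_disc \<and> f 0 = 0 \<and> wirtinger_z f 0 = 1}"

(* The decomposition f = h + conj g; the normalisation at 0 makes h and g unique on the disc. *)
definition harmonic_decomposition ::
    "(complex \<Rightarrow> complex) \<Rightarrow> (complex \<Rightarrow> complex) \<Rightarrow> (complex \<Rightarrow> complex) \<Rightarrow> bool" where
  "harmonic_decomposition f h g \<longleftrightarrow>
     h holomorphic_on unit_disc \<and> g holomorphic_on unit_disc \<and> h 0 = 0 \<and> g 0 = 0 \<and>
     (\<forall>z\<in>unit_disc. f z = h z + cnj (g z))"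

definition has_power_series :: "(complex \<Rightarrow> complex) \<Rightarrow> (nat \<Rightarrow> complex) \<Rightarrow> bool" where
  "has_power_series F c \<longleftrightarrow> (\<forall>z\<in>unit_disc. (\<lambda>n. c n * z ^ n) sums F z)"

(* Non-vanishing of deriv h is implicit in the quotient on paper, but x / 0 = 0 here. *)
definition class_M :: "complex \<Rightarrow> (complex \<Rightarrow> complex) set" where
  "class_M \<alpha> = {f \<in> class_H. \<exists>h g. harmonic_decomposition f h g \<and>
     (\<forall>z\<in>unit_disc. deriv g z = \<alpha> * z * deriv h z \<and> deriv h z \<noteq> 0 \<and>
        Re (1 + z * deriv (deriv h) z / deriv h z) > - 1 / 2)}"

subsection \<open>Close-to-convex harmonic mappings\<close>

definition closed_half_line :: "complex set \<Rightarrow> bool" where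
  "closed_half_line R \<longleftrightarrow> (\<exists>a d. d \<noteq> 0 \<and> R = {a + of_real t * d | t. t \<ge> 0})"

definition close_to_convex_domain :: "complex set \<Rightarrow> bool" where
  "close_to_convex_domain S \<longleftrightarrow> open S \<and> connected S \<and> S \<noteq> {} \<and>
     (\<exists>\<R>. (\<forall>R\<in>\<R>. closed_half_line R) \<and> - S = \<Union>\<R> \<and>
          pairwise (\<lambda>R R'. disjnt (rel_interior R) (rel_interior R')) \<R>)"

definition class_CH0 :: "(complex \<Rightarrow> complex) set" where
  "class_CH0 = {f \<in> class_H. inj_on f unit_disc \<and> sense_preserving_on f unit_disc \<and>
     wirtinger_zbar f 0 = 0 \<and> close_to_convex_domain (f ` unit_disc)}"

definition g_extremal :: "complex \<Rightarrow> complex \<Rightarrow> complex" where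
  "g_extremal \<alpha> z = z + cnj \<alpha> * cnj z ^ 2 / 2"

end

theory Submission
  imports Defs
begin

text \<open>
  Write f = h + cnj g with g' = \<alpha> z h' and Re (1 + z h''/h') > -1/2.

  Univalence and close-to-convexity rest on the tangent angle of the image of a circle
  z = r e^{i\<theta>}. With w = z h'(z), the tangent is i w (1 - u), where u = cnj (\<alpha> z) cnj w / w has modulus
  |\<alpha>| r < 1. The argument of w has derivative above -1/2, and the argument of u turns at the
  speed -(1 + 2 (arg w)'); together this gives \<psi>' > -1/2 for the tangent angle \<psi>. Hence
  N = (2 \<psi> + \<theta>) / 3 + const is strictly increasing, it grows by 2 \<pi> in one turn, and \<psi> - N oscillates by
  less than \<pi>. For a suitable constant the half-lines with direction N(\<theta>) starting at f(r e^{i\<theta>}) leave the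
  curve transversally to its outer side. Continuing f from the disc |z| \<le> r along these half-lines
  yields a continuous, proper and locally injective map of the plane (the local injectivity on the
  circle is \<open>glued_locally_injective\<close>). Such a map is a covering of a simply connected space,
  hence a bijection (\<open>proper_locally_injective_bij\<close>). So f is injective on the disc, and the
  half-lines fill the complement of the image of the open disc without meeting each other.

  For r \<rightarrow> 1 a compactness argument selects a limiting half-line at every point outside the image
  of the unit disc, and limits of non-crossing half-lines do not cross
  (\<open>limit_of_noncrossing_half_lines\<close>). Limiting half-lines may be nested; they are merged into maximal
  ones in \<open>noncrossing_half_lines_cover\<close>.

  The coefficients of h' satisfy a recursion whose coefficients are bounded by 3 by Caratheodory's
  inequality, and its solution is majorised by the coefficients of (1 - z)^{-3}. Integration gives the
  bounds for h and g, and summation gives the growth estimate; rotations of the function with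
  h' = (1 - z)^{-3} are extremal.

  The Jacobian of f is (1 - |\<alpha> z|^2) |h'|^2. Expanding |h'|^2 = 1 + 2 Re (h' - 1) + |h' - 1|^2, the middle
  term integrates to zero against the radial weight, and the last one is nonnegative and vanishes
  identically only for h' = 1, that is for \<open>g_extremal\<close>.
\<close>

section \<open>Proper local homeomorphisms of Euclidean space\<close>

text \<open>
  Arguments of a convergent sequence of values stay bounded, so they have a limit point.
\<close>
lemma proper_closed_image:
  fixes \<Phi> :: "'a::euclidean_space \<Rightarrow> 'a"
  assumes cont: "continuous_on UNIV \<Phi>"
    and proper: "\<And>B. bounded B \<Longrightarrow> bounded (\<Phi> -` B)"
    and C: "closed C"
  shows "closed (\<Phi> ` C)"
  unfolding closed_sequential_limits
proof (intro allI impI, elim conjE)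
  fix y l assume y: "\<forall>n. y n \<in> \<Phi> ` C" and lim: "y \<longlonglongrightarrow> l"
  then have "\<forall>n. \<exists>x. x \<in> C \<and> y n = \<Phi> x" by blast
  then obtain x where "\<forall>n. x n \<in> C \<and> y n = \<Phi> (x n)" using choice[of "\<lambda>n x. x \<in> C \<and> y n = \<Phi> x"] by blast
  then have x: "\<And>n. x n \<in> C" "\<And>n. y n = \<Phi> (x n)" by auto
  have "bounded (range y)" using lim convergent_imp_bounded by blast
  then have "bounded (\<Phi> -` range y)" by (rule proper)
  then have "bounded (range x)" by (rule bounded_subset) (use x in auto)
  then obtain a \<sigma> where \<sigma>: "strict_mono (\<sigma> :: nat \<Rightarrow> nat)" "(x \<circ> \<sigma>) \<longlonglongrightarrow> a"
    using bounded_imp_convergent_subsequence by blast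
  have "a \<in> C" using C \<sigma>(2) x(1) unfolding closed_sequential_limits by (metis comp_apply)
  have "(\<lambda>n. \<Phi> ((x \<circ> \<sigma>) n)) \<longlonglongrightarrow> \<Phi> a"
    using cont \<sigma>(2) by (metis UNIV_I continuous_on_eq_continuous_at isCont_tendsto_compose open_UNIV)
  moreover have "(\<lambda>n. \<Phi> ((x \<circ> \<sigma>) n)) = y \<circ> \<sigma>" using x by auto
  ultimately have "(y \<circ> \<sigma>) \<longlonglongrightarrow> \<Phi> a" by simp
  with LIMSEQ_subseq_LIMSEQ[OF lim \<sigma>(1)] have "l = \<Phi> a" using LIMSEQ_unique by blast
  with \<open>a \<in> C\<close> show "l \<in> \<Phi> ` C" by blast
qed

lemma locally_injective_open_map:
  fixes \<Phi> :: "'a::euclidean_space \<Rightarrow> 'a"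
  assumes cont: "continuous_on U \<Phi>" and U: "open U"
    and inj: "\<And>x. x \<in> U \<Longrightarrow> \<exists>e>0. inj_on \<Phi> (ball x e)"
  shows "open (\<Phi> ` U)"
proof -
  have "\<exists>T. open T \<and> \<Phi> x \<in> T \<and> T \<subseteq> \<Phi> ` U" if "x \<in> U" for x
  proof -
    obtain e where e: "e > 0" "inj_on \<Phi> (ball x e)" using inj \<open>x \<in> U\<close> by blast
    have "open (\<Phi> ` (ball x e \<inter> U))"
      by (rule invariance_of_domain)
         (use cont e U in \<open>auto intro: continuous_on_subset inj_on_subset\<close>)
    then show ?thesis using e that by (intro exI[of _ "\<Phi> ` (ball x e \<inter> U)"]) auto
  qed
  then show ?thesis unfolding open_subopen[of "\<Phi> ` U"] by blast
qed

text \<open>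
  Properness makes every fibre finite and keeps the image of the complement of small balls around the fibre
  closed. Removing this image from the common image of the balls leaves an evenly covered neighbourhood.
\<close>
lemma proper_locally_injective_covering_space:
  fixes \<Phi> :: "'a::euclidean_space \<Rightarrow> 'a"
  assumes cont: "continuous_on UNIV \<Phi>"
    and inj: "\<And>x. \<exists>e>0. inj_on \<Phi> (ball x e)"
    and proper: "\<And>B. bounded B \<Longrightarrow> bounded (\<Phi> -` B)"
  shows "covering_space UNIV \<Phi> UNIV"
  unfolding covering_space_def
proof (intro conjI ballI)
  have opn: "open (\<Phi> ` U)" if "open U" for U
    using locally_injective_open_map[of U \<Phi>] cont inj that continuous_on_subset by blast
  have "closed (range \<Phi>)" by (rule proper_closed_image[OF cont proper]) auto
  moreover have "open (range \<Phi>)" by (rule opn) auto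
  ultimately show "range \<Phi> = UNIV" using clopen[of "range \<Phi>"] by simp
  fix y :: 'a
  define K where "K = \<Phi> -` {y}"
  obtain e where e: "\<And>x. e x > 0" "\<And>x. inj_on \<Phi> (ball x (e x))" using inj by metis
  define B where "B = (\<lambda>x. ball x (e x / 2))"
  \<comment> \<open>two fibre points in one ball of injectivity would coincide, so the half-size balls are disjoint\<close>
  have sep: "dist x x' \<ge> e x" if "x \<in> K" "x' \<in> K" "x \<noteq> x'" for x x'
  proof (rule ccontr)
    assume "\<not> ?thesis"
    then have "x \<in> ball x (e x)" "x' \<in> ball x (e x)" using e by auto
    moreover have "\<Phi> x = \<Phi> x'" using that by (simp add: K_def)
    ultimately show False using inj_onD[OF e(2)] \<open>x \<noteq> x'\<close> by blast
  qed
  have Bdisj: "B x \<inter> B x' = {}" if "x \<in> K" "x' \<in> K" "x \<noteq> x'" for x x'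
  proof -
    have "dist x x' \<ge> e x" "dist x x' \<ge> e x'" using sep that by (metis, metis dist_commute)
    then show ?thesis unfolding B_def by (intro disjoint_ballI) auto
  qed
  have "closed K" unfolding K_def using cont by (intro closed_vimage) auto
  moreover have "bounded K" unfolding K_def by (rule proper) auto
  ultimately have "compact K" using compact_eq_bounded_closed by blast
  moreover have "\<not> z islimpt K" if "z \<in> K" for z
    unfolding islimpt_approachable using sep[OF that] e(1)[of z] by (force simp: dist_commute)
  ultimately have "finite K" using finite_not_islimpt_in_compact[of K K] by auto
  define W where "W = (\<Union>x\<in>K. B x)"
  have "open W" unfolding W_def B_def by auto
  have clos: "closed (\<Phi> ` (- W))" by (rule proper_closed_image[OF cont proper]) (use \<open>open W\<close> in auto)
  define T where "T = (\<Inter>x\<in>K. \<Phi> ` B x) - \<Phi> ` (- W)"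
  have "open T" unfolding T_def
    by (intro open_Diff open_INT clos \<open>finite K\<close>) (auto intro!: opn simp: B_def)
  moreover have "y \<in> T"
  proof -
    have "x \<in> B x" for x using e by (auto simp: B_def)
    then show ?thesis unfolding T_def W_def K_def by blast
  qed
  moreover have "\<exists>v. \<Union>v = UNIV \<inter> \<Phi> -` T \<and> (\<forall>u\<in>v. openin (top_of_set UNIV) u) \<and>
      pairwise disjnt v \<and> (\<forall>u\<in>v. \<exists>q. homeomorphism u T \<Phi> q)"
  proof (intro exI[of _ "(\<lambda>x. B x \<inter> \<Phi> -` T) ` K"] conjI ballI)
    show "\<Union> ((\<lambda>x. B x \<inter> \<Phi> -` T) ` K) = UNIV \<inter> \<Phi> -` T"
      unfolding T_def W_def by blast
    have oT: "open (\<Phi> -` T)" using cont \<open>open T\<close> by (simp add: open_vimage)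
    { fix u assume "u \<in> (\<lambda>x. B x \<inter> \<Phi> -` T) ` K"
      then obtain x where x: "x \<in> K" "u = B x \<inter> \<Phi> -` T" by blast
      have ou: "open u" using x oT by (auto simp: B_def)
      then show "openin (top_of_set UNIV) u" by simp
      have "T \<subseteq> \<Phi> ` B x" using x(1) by (auto simp: T_def)
      then have "\<Phi> ` u = T" unfolding x by auto
      moreover have "inj_on \<Phi> u"
        using e(1)[of x] by (intro inj_on_subset[OF e(2)[of x]]) (auto simp: x B_def)
      ultimately show "\<exists>q. homeomorphism u T \<Phi> q"
        using invariance_of_domain_homeomorphism[OF ou continuous_on_subset[OF cont subset_UNIV] order_refl]
        by blast
    }
    show "pairwise disjnt ((\<lambda>x. B x \<inter> \<Phi> -` T) ` K)"
    proof (rule pairwiseI)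
      fix u u' assume "u \<in> (\<lambda>x. B x \<inter> \<Phi> -` T) ` K" "u' \<in> (\<lambda>x. B x \<inter> \<Phi> -` T) ` K" "u \<noteq> u'"
      then obtain x x' where "x \<in> K" "x' \<in> K" "x \<noteq> x'" "u = B x \<inter> \<Phi> -` T" "u' = B x' \<inter> \<Phi> -` T" by blast
      then show "disjnt u u'" using Bdisj[of x x'] by (auto simp: disjnt_def)
    qed
  qed
  ultimately show "\<exists>T. y \<in> T \<and> openin (top_of_set UNIV) T \<and>
       (\<exists>v. \<Union>v = UNIV \<inter> \<Phi> -` T \<and> (\<forall>u\<in>v. openin (top_of_set UNIV) u) \<and>
      pairwise disjnt v \<and> (\<forall>u\<in>v. \<exists>q. homeomorphism u T \<Phi> q))"
    by (intro exI[of _ T] conjI) (simp_all only: openin_open_eq open_UNIV open_openin subtopology_UNIV)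
qed (fact cont)

text \<open>
  The space is simply connected, so the identity lifts to a section s of the covering. Both s o \<Phi> and the
  identity are lifts of \<Phi>, and they agree at one point.
\<close>
lemma proper_locally_injective_bij:
  fixes \<Phi> :: "'a::euclidean_space \<Rightarrow> 'a"
  assumes cont: "continuous_on UNIV \<Phi>"
    and inj: "\<And>x. \<exists>e>0. inj_on \<Phi> (ball x e)"
    and proper: "\<And>B. bounded B \<Longrightarrow> bounded (\<Phi> -` B)"
  shows "bij \<Phi>"
proof (rule bijI)
  have cov: "covering_space UNIV \<Phi> UNIV"
    by (rule proper_locally_injective_covering_space[OF assms])
  then show "surj \<Phi>" by (rule covering_space_imp_surjective)
  show "inj \<Phi>"
  proof (rule injI)
    fix x x' assume eq: "\<Phi> x = \<Phi> x'"
    have sc: "simply_connected (UNIV :: 'a set)" by (rule convex_imp_simply_connected[OF convex_UNIV])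
    note lift = covering_space_lift_strong[OF cov UNIV_I UNIV_I sc locally_path_connected_UNIV continuous_on_id,
        of "\<Phi> x" x]
    show "x = x'"
    proof (rule lift)
      fix s assume s: "continuous_on UNIV s" "s \<in> UNIV \<rightarrow> UNIV" "s (\<Phi> x) = x"
        "\<And>y. y \<in> UNIV \<Longrightarrow> \<Phi> (s y) = y"
      have c1: "continuous_on UNIV (s \<circ> \<Phi>)"
        by (rule continuous_on_compose[OF cont continuous_on_subset[OF s(1)]]) simp
      have "(s \<circ> \<Phi>) x' = id x'"
      proof (rule covering_space_lift_unique[OF cov, where a=x and f=\<Phi> and T=UNIV and ?g1.0="s \<circ> \<Phi>" and ?g2.0=id])
        show "(s \<circ> \<Phi>) x = id x" using s(3) by simp
        show "continuous_on UNIV \<Phi>" by (fact cont)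
        show "continuous_on UNIV (s \<circ> \<Phi>)" by (fact c1)
        show "\<And>y. y \<in> UNIV \<Longrightarrow> \<Phi> y = \<Phi> ((s \<circ> \<Phi>) y)" using s(4) by simp
      qed (simp_all add: continuous_on_id' connected_UNIV)
      then show "x = x'" using s(3) eq by simp
    qed simp_all
  qed
qed

section \<open>Local injectivity of maps glued along a line\<close>

text \<open>
  The real-linear map with columns p and q. If these are the partial derivatives of a map in the directions
  1 and \<i>, the Jacobian determinant is Im (cnj p * q).
\<close>
definition rlin :: "complex \<Rightarrow> complex \<Rightarrow> complex \<Rightarrow> complex" where
  "rlin p q v = of_real (Re v) * p + of_real (Im v) * q"

lemma rlin_bounded_linear [simp]: "bounded_linear (rlin p q)"
  unfolding rlin_def
  by (intro bounded_linear_add bounded_linear_mult_const bounded_linear_compose[OF bounded_linear_of_real]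
        bounded_linear_Re bounded_linear_Im)

text \<open>
  Cramer's rule: the coordinates of v times the determinant are determinants in which the image of v
  replaces a column.
\<close>
lemma rlin_lower_bound:
  "Im (cnj p * q) * cmod v \<le> (cmod p + cmod q) * cmod (rlin p q v)"
proof -
  have 1: "Re v * Im (cnj p * q) = Im (cnj (rlin p q v) * q)"
    unfolding rlin_def by (simp add: algebra_simps)
  have 2: "Im v * Im (cnj p * q) = Im (cnj p * rlin p q v)"
    unfolding rlin_def by (simp add: algebra_simps)
  have "\<bar>Re v\<bar> * \<bar>Im (cnj p * q)\<bar> \<le> cmod (rlin p q v) * cmod q"
    using abs_Im_le_cmod[of "cnj (rlin p q v) * q"] 1 by (simp add: abs_mult[symmetric] norm_mult)
  moreover have "\<bar>Im v\<bar> * \<bar>Im (cnj p * q)\<bar> \<le> cmod p * cmod (rlin p q v)"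
    using abs_Im_le_cmod[of "cnj p * rlin p q v"] 2 by (simp add: abs_mult[symmetric] norm_mult)
  moreover have "cmod v * \<bar>Im (cnj p * q)\<bar> \<le> (\<bar>Re v\<bar> + \<bar>Im v\<bar>) * \<bar>Im (cnj p * q)\<bar>"
    by (intro mult_right_mono cmod_le) auto
  moreover have "Im (cnj p * q) * cmod v \<le> \<bar>Im (cnj p * q)\<bar> * cmod v"
    by (intro mult_right_mono) auto
  ultimately show ?thesis by (simp add: algebra_simps)
qed

text \<open>
  The mean value inequality for the difference of F and its linear part at x0.
\<close>
lemma strict_derivative:
  fixes F :: "complex \<Rightarrow> complex"
  assumes d: "\<And>x. x \<in> ball x0 d \<Longrightarrow> (F has_derivative rlin (p x) (q x)) (at x)" "d > 0"
    and p: "isCont p x0" and q: "isCont q x0" and e: "e > 0"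
  shows "\<exists>\<delta>>0. \<forall>x\<in>ball x0 \<delta>. \<forall>y\<in>ball x0 \<delta>.
     cmod (F x - F y - rlin (p x0) (q x0) (x - y)) \<le> e * cmod (x - y)"
proof -
  obtain d1 where d1: "d1 > 0" "\<And>x. dist x x0 < d1 \<Longrightarrow> dist (p x) (p x0) < e/2"
    using p half_gt_zero[OF e] unfolding continuous_at_eps_delta by blast
  obtain d2 where d2: "d2 > 0" "\<And>x. dist x x0 < d2 \<Longrightarrow> dist (q x) (q x0) < e/2"
    using q half_gt_zero[OF e] unfolding continuous_at_eps_delta by blast
  define \<delta> where "\<delta> = min d (min d1 d2)"
  have \<delta>: "\<delta> > 0" "\<delta> \<le> d" "\<delta> \<le> d1" "\<delta> \<le> d2" using d d1 d2 by (auto simp: \<delta>_def)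
  define G where "G = (\<lambda>x. F x - rlin (p x0) (q x0) x)"
  have Gb: "cmod (G x - G y) \<le> e * cmod (x - y)" if "x \<in> ball x0 \<delta>" "y \<in> ball x0 \<delta>" for x y
  proof (rule differentiable_bound[of "ball x0 \<delta>" G "\<lambda>x v. rlin (p x) (q x) v - rlin (p x0) (q x0) v"])
    fix z assume z: "z \<in> ball x0 \<delta>"
    have "(F has_derivative rlin (p z) (q z)) (at z)" using d(1)[of z] z \<delta> by auto
    then show "(G has_derivative (\<lambda>v. rlin (p z) (q z) v - rlin (p x0) (q x0) v)) (at z within ball x0 \<delta>)"
      unfolding G_def
      by (intro has_derivative_diff bounded_linear_imp_has_derivative[OF rlin_bounded_linear])
         (rule has_derivative_at_withinI)
    show "onorm (\<lambda>v. rlin (p z) (q z) v - rlin (p x0) (q x0) v) \<le> e"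
    proof (rule onorm_bound)
      fix v
      have "rlin (p z) (q z) v - rlin (p x0) (q x0) v = of_real (Re v) * (p z - p x0) + of_real (Im v) * (q z - q x0)"
        by (simp add: rlin_def algebra_simps)
      then have "cmod (rlin (p z) (q z) v - rlin (p x0) (q x0) v) \<le> \<bar>Re v\<bar> * cmod (p z - p x0) + \<bar>Im v\<bar> * cmod (q z - q x0)"
        by (metis norm_triangle_ineq norm_mult norm_of_real)
      also have "\<dots> \<le> cmod v * (e/2) + cmod v * (e/2)"
      proof (intro add_mono mult_mono)
        show "cmod (p z - p x0) \<le> e/2" using d1(2)[of z] z \<delta> by (force simp: dist_norm norm_minus_commute)
        show "cmod (q z - q x0) \<le> e/2" using d2(2)[of z] z \<delta> by (force simp: dist_norm norm_minus_commute)
      qed (auto simp: abs_Re_le_cmod abs_Im_le_cmod)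
      finally show "cmod (rlin (p z) (q z) v - rlin (p x0) (q x0) v) \<le> e * cmod v" by (simp add: algebra_simps)
    qed (use e in auto)
  qed (use that in auto)
  have "cmod (F x - F y - rlin (p x0) (q x0) (x - y)) \<le> e * cmod (x - y)"
    if "x \<in> ball x0 \<delta>" "y \<in> ball x0 \<delta>" for x y
  proof -
    have "G x - G y = F x - F y - rlin (p x0) (q x0) (x - y)"
      by (simp add: G_def rlin_def algebra_simps)
    then show ?thesis using Gb[OF that] by (simp only:)
  qed
  then show ?thesis using \<delta>(1) by blast
qed

lemma segment_cross_Re:
  fixes x y :: complex
  assumes "Re x \<le> a" "a \<le> Re y"
  obtains l where "0 \<le> l" "l \<le> 1" "Re (x + of_real l * (y - x)) = a"
proof (cases "Re x = Re y")
  case True then show ?thesis using assms that[of 0] by auto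
next
  case False
  define l where "l = (a - Re x) / (Re y - Re x)"
  have "Re x < Re y" using False assms by linarith
  then have "0 \<le> l" "l \<le> 1" "l * (Re y - Re x) = a - Re x"
    using assms by (auto simp: l_def divide_simps)
  then show ?thesis using that[of l] by simp
qed

text \<open>
  The derivatives on the two sides share the column along the line, so the determinant is affine on the
  segment that joins them and all convex combinations are uniformly invertible. Cutting a segment where it
  crosses the line shows that the increment of F is such a combination, applied to the increment of
  the argument, up to a small relative error. The case F1 = F2 is local injectivity at a regular point.
\<close>
lemma glued_locally_injective:
  fixes F F1 F2 :: "complex \<Rightarrow> complex"
  assumes d: "d > 0"
    and d1: "\<And>x. x \<in> ball x0 d \<Longrightarrow> (F1 has_derivative rlin (p1 x) (q1 x)) (at x)"
    and c1: "isCont p1 x0" "isCont q1 x0"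
    and d2: "\<And>x. x \<in> ball x0 d \<Longrightarrow> (F2 has_derivative rlin (p2 x) (q2 x)) (at x)"
    and c2: "isCont p2 x0" "isCont q2 x0"
    and q: "q1 x0 = q2 x0"
    and pos: "Im (cnj (p1 x0) * q1 x0) > 0" "Im (cnj (p2 x0) * q2 x0) > 0"
    and F1: "\<And>x. x \<in> ball x0 d \<Longrightarrow> Re x \<le> a \<Longrightarrow> F x = F1 x"
    and F2: "\<And>x. x \<in> ball x0 d \<Longrightarrow> Re x \<ge> a \<Longrightarrow> F x = F2 x"
  shows "\<exists>\<delta>>0. inj_on F (ball x0 \<delta>)"
proof -
  define P where "P = (\<lambda>l. of_real l * p1 x0 + of_real (1 - l) * p2 x0)"
  define D where "D = min (Im (cnj (p1 x0) * q1 x0)) (Im (cnj (p2 x0) * q2 x0))"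
  define C where "C = cmod (p1 x0) + cmod (p2 x0) + cmod (q1 x0) + 1"
  have D: "D > 0" using pos by (auto simp: D_def)
  have C: "C > 0" by (auto simp: C_def intro: add_nonneg_pos)
  have low: "D * cmod v \<le> C * cmod (rlin (P l) (q1 x0) v)" if l: "0 \<le> l" "l \<le> 1" for l v
  proof -
    have "Im (cnj (P l) * q1 x0) = l * Im (cnj (p1 x0) * q1 x0) + (1 - l) * Im (cnj (p2 x0) * q1 x0)"
      by (simp add: P_def algebra_simps)
    also have "\<dots> \<ge> l * D + (1 - l) * D"
      using l q by (intro add_mono mult_left_mono) (auto simp: D_def)
    finally have 1: "D \<le> Im (cnj (P l) * q1 x0)" by (simp add: algebra_simps)
    have "cmod (P l) \<le> l * cmod (p1 x0) + (1 - l) * cmod (p2 x0)"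
      unfolding P_def using l norm_triangle_ineq[of "of_real l * p1 x0" "of_real (1 - l) * p2 x0"]
      by (simp add: norm_mult del: of_real_diff)
    also have "\<dots> \<le> 1 * cmod (p1 x0) + 1 * cmod (p2 x0)"
      using l by (intro add_mono mult_right_mono) auto
    finally have 2: "cmod (P l) + cmod (q1 x0) \<le> C" by (simp add: C_def)
    have "D * cmod v \<le> Im (cnj (P l) * q1 x0) * cmod v" by (intro mult_right_mono 1) auto
    also have "\<dots> \<le> (cmod (P l) + cmod (q1 x0)) * cmod (rlin (P l) (q1 x0) v)" by (rule rlin_lower_bound)
    also have "\<dots> \<le> C * cmod (rlin (P l) (q1 x0) v)" by (intro mult_right_mono 2) auto
    finally show ?thesis .
  qed
  define e where "e = D / (2 * C)"
  have e: "e > 0" using D C by (simp add: e_def)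
  obtain e1 where e1: "e1 > 0" "\<And>x y. x \<in> ball x0 e1 \<Longrightarrow> y \<in> ball x0 e1 \<Longrightarrow>
     cmod (F1 x - F1 y - rlin (p1 x0) (q1 x0) (x - y)) \<le> e * cmod (x - y)"
    using strict_derivative[OF d1 d c1 e] by blast
  obtain e2 where e2: "e2 > 0" "\<And>x y. x \<in> ball x0 e2 \<Longrightarrow> y \<in> ball x0 e2 \<Longrightarrow>
     cmod (F2 x - F2 y - rlin (p2 x0) (q2 x0) (x - y)) \<le> e * cmod (x - y)"
    using strict_derivative[OF d2 d c2 e] by blast
  define \<delta> where "\<delta> = min d (min e1 e2)"
  have \<delta>: "\<delta> > 0" using d e1 e2 by (simp add: \<delta>_def)
  have key: "x = y" if x: "x \<in> ball x0 \<delta>" and y: "y \<in> ball x0 \<delta>" and eq: "F x = F y" and le: "Re x \<le> Re y" for x y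
  proof -
    have in1: "z \<in> ball x0 d" "z \<in> ball x0 e1" "z \<in> ball x0 e2" if "z \<in> ball x0 \<delta>" for z
      using that by (auto simp: \<delta>_def)
    have "\<exists>l. 0 \<le> l \<and> l \<le> 1 \<and> cmod (F x - F y - rlin (P l) (q1 x0) (x - y)) \<le> e * cmod (x - y)"
    proof -
      consider "Re y \<le> a" | "Re x \<ge> a" | "Re x \<le> a" "a \<le> Re y" by linarith
      then show ?thesis
      proof cases
        case 1
        then show ?thesis using e1(2)[OF in1(2)[OF x] in1(2)[OF y]] F1[OF in1(1)[OF x]] F1[OF in1(1)[OF y]] le
          by (intro exI[of _ 1]) (auto simp: P_def)
      next
        case 2
        then show ?thesis using e2(2)[OF in1(3)[OF x] in1(3)[OF y]] F2[OF in1(1)[OF x]] F2[OF in1(1)[OF y]] le q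
          by (intro exI[of _ 0]) (auto simp: P_def)
      next
        case 3
        obtain l where l: "0 \<le> l" "l \<le> 1" "Re (x + of_real l * (y - x)) = a" using segment_cross_Re[OF 3] by blast
        define m where "m = x + of_real l * (y - x)"
        have m: "m \<in> ball x0 \<delta>"
        proof -
          have "m = (1 - l) *\<^sub>R x + l *\<^sub>R y" by (simp add: m_def scaleR_conv_of_real algebra_simps)
          then show ?thesis using convexD_alt[OF convex_ball x y, of l] l by simp
        qed
        have xm: "x - m = of_real l * (x - y)" by (simp add: m_def algebra_simps)
        have my: "m - y = of_real (1 - l) * (x - y)" by (simp add: m_def algebra_simps)
        have Fm: "F m = F1 m" "F m = F2 m" using F1[OF in1(1)[OF m]] F2[OF in1(1)[OF m]] l(3) by (auto simp: m_def)
        have a1: "cmod (F x - F m - rlin (p1 x0) (q1 x0) (x - m)) \<le> e * cmod (x - m)"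
          using e1(2)[OF in1(2)[OF x] in1(2)[OF m]] F1[OF in1(1)[OF x]] 3 Fm by auto
        have a2: "cmod (F m - F y - rlin (p2 x0) (q2 x0) (m - y)) \<le> e * cmod (m - y)"
          using e2(2)[OF in1(3)[OF m] in1(3)[OF y]] F2[OF in1(1)[OF y]] 3 Fm by auto
        have "F x - F y - rlin (P l) (q1 x0) (x - y) =
           (F x - F m - rlin (p1 x0) (q1 x0) (x - m)) + (F m - F y - rlin (p2 x0) (q2 x0) (m - y))"
          unfolding xm my using q by (simp add: P_def rlin_def algebra_simps)
        then have "cmod (F x - F y - rlin (P l) (q1 x0) (x - y)) \<le> e * cmod (x - m) + e * cmod (m - y)"
          using norm_triangle_mono[OF a1 a2] by (simp only:)
        also have "\<dots> = e * (l * cmod (x - y)) + e * ((1 - l) * cmod (x - y))"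
          unfolding xm my using l by (simp add: norm_mult del: of_real_diff)
        also have "\<dots> = e * cmod (x - y)" by (simp add: algebra_simps)
        finally show ?thesis using l(1,2) by blast
      qed
    qed
    then obtain l where l: "0 \<le> l" "l \<le> 1"
        "cmod (F x - F y - rlin (P l) (q1 x0) (x - y)) \<le> e * cmod (x - y)" by blast
    then have l3: "cmod (rlin (P l) (q1 x0) (x - y)) \<le> e * cmod (x - y)" by (simp add: eq)
    then have "C * cmod (rlin (P l) (q1 x0) (x - y)) \<le> C * (e * cmod (x - y))"
      using C by (intro mult_left_mono) auto
    with low[OF l(1,2), of "x - y"] have "D * cmod (x - y) \<le> C * (e * cmod (x - y))" by (rule order_trans)
    moreover have "C * (e * cmod (x - y)) = D * (cmod (x - y) / 2)" using C by (simp add: e_def)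
    ultimately have "cmod (x - y) \<le> cmod (x - y) / 2" using D by (simp only: mult_le_cancel_left_pos)
    then show "x = y" by simp
  qed
  show ?thesis
  proof (intro exI[of _ \<delta>] conjI \<delta> inj_onI)
    fix x y assume "x \<in> ball x0 \<delta>" "y \<in> ball x0 \<delta>" "F x = F y"
    then show "x = y"
      by (cases "Re x \<le> Re y") (use key[of x y] in blast, use key[of y x] in \<open>simp add: eq_commute\<close>)
  qed
qed

section \<open>Complements covered by non-crossing half-lines\<close>

definition half_line :: "complex \<Rightarrow> complex \<Rightarrow> complex set" where
  "half_line a v = {a + of_real t * v | t. t \<ge> 0}"

lemma half_lineI: "t \<ge> 0 \<Longrightarrow> a + of_real t * v \<in> half_line a v"
  unfolding half_line_def by blast

lemma convex_half_line: "convex (half_line a v)"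
proof (rule convexI)
  fix x y u w assume "x \<in> half_line a v" "y \<in> half_line a v" and uw: "0 \<le> (u::real)" "0 \<le> w" "u + w = 1"
  then obtain s t where "s \<ge> 0" "x = a + of_real s * v" "t \<ge> 0" "y = a + of_real t * v"
    unfolding half_line_def by blast
  moreover from this have "u *\<^sub>R x + w *\<^sub>R y = of_real (u + w) * a + of_real (u * s + w * t) * v"
    by (simp add: scaleR_conv_of_real algebra_simps)
  ultimately show "u *\<^sub>R x + w *\<^sub>R y \<in> half_line a v"
    using uw half_lineI[of "u * s + w * t" a v] by simp
qed

text \<open>
  A relatively interior point can be moved a little beyond itself, which the end point of a half-line cannot.
\<close>
lemma rel_interior_half_line:
  assumes x: "x \<in> rel_interior (half_line a v)" and v: "v \<noteq> 0"
  obtains t where "t > 0" "x = a + of_real t * v"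
proof -
  have "x \<in> half_line a v" using x rel_interior_subset by blast
  then obtain t where t: "t \<ge> 0" "x = a + of_real t * v" unfolding half_line_def by blast
  have "t \<noteq> 0"
  proof
    assume "t = 0"
    then have xa: "x = a" using t by simp
    have "a + v \<in> half_line a v" using half_lineI[of 1 a v] by simp
    then have "a + v \<in> affine hull (half_line a v)" by (rule hull_inc)
    then obtain m where m: "m > 1" "(1 - m) *\<^sub>R (a + v) + m *\<^sub>R x \<in> half_line a v"
      using convex_rel_interior_if2[OF convex_half_line x] by blast
    note m(2)
    moreover have "(1 - m) *\<^sub>R (a + v) + m *\<^sub>R x = a + of_real (1 - m) * v"
      unfolding xa by (simp add: scaleR_conv_of_real algebra_simps)
    ultimately obtain s where s: "s \<ge> 0" "a + of_real (1 - m) * v = a + of_real s * v"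
      unfolding half_line_def by auto
    then have "of_real (1 - m) = (of_real s :: complex)" using v by simp
    then have "1 - m = s" by (simp only: of_real_eq_iff)
    then show False using s m by simp
  qed
  then show ?thesis using t that[of t] by simp
qed

text \<open>
  The half-lines attached to the points of S may be nested, but the members of the family must have disjoint
  relative interiors. Call x covered in direction v if it is interior to an attached half-line of
  direction v; then v is determined by x. On each line the points covered in a fixed direction form
  an open half-line or the whole line. In the first case its closure is taken, in the second case the
  line is cut into two half-lines at its point nearest to the origin.
\<close>
lemma noncrossing_half_lines_cover:
  fixes S :: "complex set" and d :: "complex \<Rightarrow> complex"
  assumes S: "closed S"
    and unit: "\<And>p. p \<in> S \<Longrightarrow> cmod (d p) = 1"
    and ray: "\<And>p t. p \<in> S \<Longrightarrow> t \<ge> 0 \<Longrightarrow> p + of_real t * d p \<in> S"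
    and same: "\<And>p q s t. p \<in> S \<Longrightarrow> q \<in> S \<Longrightarrow> s > 0 \<Longrightarrow> t > 0 \<Longrightarrow>
                 p + of_real s * d p = q + of_real t * d q \<Longrightarrow> d p = d q"
  shows "\<exists>\<R>. (\<forall>R\<in>\<R>. closed_half_line R) \<and> S = \<Union>\<R> \<and>
          pairwise (\<lambda>R R'. disjnt (rel_interior R) (rel_interior R')) \<R>"
proof -
  define cov where "cov = (\<lambda>v x. \<exists>p\<in>S. d p = v \<and> (\<exists>t>0. x = p + of_real t * v))"
  have cov_mono: "cov v (a + of_real t * v)" if "cov v (a + of_real s * v)" "s \<le> t" for v a s t
  proof -
    obtain p u where p: "p \<in> S" "d p = v" "u > 0" "a + of_real s * v = p + of_real u * v"
      using \<open>cov v (a + of_real s * v)\<close> unfolding cov_def by blast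
    have "a + of_real t * v = (a + of_real s * v) + of_real (t - s) * v" by (simp add: algebra_simps)
    also have "\<dots> = p + of_real (u + (t - s)) * v" unfolding p(4) by (simp add: algebra_simps)
    finally show ?thesis unfolding cov_def using p that(2)
      by (intro bexI[of _ p] conjI exI[of _ "u + (t - s)"]) auto
  qed
  have cov_S: "x \<in> S" if "cov v x" for v x using that ray unfolding cov_def by force
  have cov_unit: "cmod v = 1" if "cov v x" for v x using that unit unfolding cov_def by blast
  have cov_unique: "v = w" if "cov v x" "cov w x" for v w x
    using that same unfolding cov_def by metis
  define M1 where "M1 = (\<lambda>a v. (\<forall>t>0. cov v (a + of_real t * v)) \<and> (\<forall>t<0. \<not> cov v (a + of_real t * v)))"
  define M2 where "M2 = (\<lambda>a v. (\<forall>t. cov v (a + of_real t * v)) \<and> Re (a * cnj v) = 0)"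
  define \<R> where "\<R> = {R. \<exists>a v. (M1 a v \<and> R = half_line a v) \<or> (M2 a v \<and> (R = half_line a v \<or> R = half_line a (- v)))}"
  have M1_unit: "cmod v = 1" if "M1 a v" for a v
    using that cov_unit[of v "a + of_real 1 * v"] zero_less_one unfolding M1_def by blast
  have M2_unit: "cmod v = 1" if "M2 a v" for a v
    using that cov_unit[of v "a + of_real 1 * v"] unfolding M2_def by blast
  have half: "closed_half_line R" if "R \<in> \<R>" for R
  proof -
    obtain a v where "v \<noteq> 0" "R = half_line a v"
    proof -
      obtain a v where c: "(M1 a v \<and> R = half_line a v) \<or> (M2 a v \<and> (R = half_line a v \<or> R = half_line a (- v)))"
        using \<open>R \<in> \<R>\<close> unfolding \<R>_def by blast
      then have "cmod v = 1" using M1_unit M2_unit by blast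
      then have "v \<noteq> 0" "- v \<noteq> 0" by auto
      then show thesis using c that by blast
    qed
    then show ?thesis unfolding closed_half_line_def half_line_def by blast
  qed
  have sub: "R \<subseteq> S" if "R \<in> \<R>" for R
  proof -
    have 1: "half_line a v \<subseteq> S" if "M1 a v" for a v
    proof
      have pos: "a + of_real t * v \<in> S" if "t > 0" for t using \<open>M1 a v\<close> that cov_S unfolding M1_def by blast
      have "(\<lambda>n. a + of_real (inverse (real (Suc n))) * v) \<longlonglongrightarrow> a + of_real 0 * v"
        by (intro tendsto_intros LIMSEQ_inverse_real_of_nat)
      moreover have "a + of_real (inverse (real (Suc n))) * v \<in> S" for n by (rule pos) simp
      ultimately have "a + of_real 0 * v \<in> S" by (rule closed_sequentially[OF S, rotated])
      then have a: "a \<in> S" by simp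
      fix x assume "x \<in> half_line a v"
      then obtain t where "t \<ge> 0" "x = a + of_real t * v" unfolding half_line_def by blast
      then show "x \<in> S" using pos[of t] a by (cases "t = 0") auto
    qed
    have 2: "half_line a v \<subseteq> S" "half_line a (- v) \<subseteq> S" if "M2 a v" for a v
    proof -
      have all: "a + of_real t * v \<in> S" for t using that cov_S unfolding M2_def by blast
      show "half_line a v \<subseteq> S" using all unfolding half_line_def by blast
      show "half_line a (- v) \<subseteq> S" using all[of "- t" for t] unfolding half_line_def by auto
    qed
    show ?thesis using \<open>R \<in> \<R>\<close> 1 2 unfolding \<R>_def by blast
  qed
  have cover: "\<exists>R\<in>\<R>. p \<in> R" if p: "p \<in> S" for p
  proof -
    define v where "v = d p"
    have v1: "cmod v = 1" using unit p by (simp add: v_def)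
    have cp: "cov v (p + of_real t * v)" if "t > 0" for t
      unfolding cov_def v_def using p that by blast
    define T where "T = {t. \<not> cov v (p + of_real t * v)}"
    have Tb: "t \<le> 0" if "t \<in> T" for t using that cp[of t] unfolding T_def by force
    show ?thesis
    proof (cases "T = {}")
      case True
      define c where "c = Re (p * cnj v)"
      define a where "a = p - of_real c * v"
      have "M2 a v" unfolding M2_def
      proof (intro conjI allI)
        fix t
        have "a + of_real t * v = p + of_real (t - c) * v" by (simp add: a_def algebra_simps)
        moreover have "cov v (p + of_real (t - c) * v)" using True unfolding T_def by blast
        ultimately show "cov v (a + of_real t * v)" by (simp only:)
        have "v * cnj v = 1" using v1 complex_norm_square[of v] by simp
        then have "a * cnj v = p * cnj v - of_real c" by (simp add: a_def left_diff_distrib mult.assoc)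
        then show "Re (a * cnj v) = 0" by (simp add: c_def)
      qed
      then have "half_line a v \<in> \<R>" "half_line a (- v) \<in> \<R>" unfolding \<R>_def by blast+
      moreover have "p = a + of_real c * v" "p = a + of_real (- c) * (- v)" by (simp_all add: a_def)
      ultimately show ?thesis using half_lineI[of c a v] half_lineI[of "- c" a "- v"]
        by (metis linear neg_0_le_iff_le)
    next
      case False
      define s where "s = Sup T"
      have bd: "bdd_above T" using Tb by (intro bdd_aboveI) auto
      have s0: "s \<le> 0" unfolding s_def using False Tb by (intro cSup_least) auto
      define a where "a = p + of_real s * v"
      have at: "a + of_real t * v = p + of_real (s + t) * v" for t by (simp add: a_def algebra_simps)
      have "M1 a v" unfolding M1_def
      proof (intro conjI allI impI)
        fix t :: real assume "t > 0"
        then have "s + t \<notin> T" using cSup_upper[of "s + t" T] bd unfolding s_def by auto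
        then show "cov v (a + of_real t * v)" unfolding at T_def by simp
      next
        fix t :: real assume "t < 0"
        then obtain t' where "t' \<in> T" "s + t < t'" using less_cSupE[of "s + t" T] False unfolding s_def by auto
        then show "\<not> cov v (a + of_real t * v)" unfolding at T_def
          using cov_mono[of v p "s + t" t'] by auto
      qed
      then have "half_line a v \<in> \<R>" unfolding \<R>_def by blast
      moreover have "p = a + of_real (- s) * v" by (simp add: a_def)
      ultimately show ?thesis using half_lineI[of "- s" a v] s0 by (metis neg_0_le_iff_le)
    qed
  qed
  have disj: "R = R'" if R: "R \<in> \<R>" "R' \<in> \<R>" and x: "x \<in> rel_interior R" "x \<in> rel_interior R'" for R R' x
  proof -
    have lt: False if M: "M1 a v" "M1 a' v" and "t < t'"
      and e: "a + of_real t * v = a' + of_real t' * v" for a v a' t t'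
    proof -
      define s where "s = (t' - t) / 2"
      have "of_real t' = (of_real t + 2 * of_real s :: complex)" by (simp add: s_def field_simps)
      then have eq: "a + of_real (- s) * v = a' + of_real s * v" using e by (simp add: algebra_simps)
      have "s > 0" using \<open>t < t'\<close> by (simp add: s_def)
      then have "cov v (a' + of_real s * v)" "\<not> cov v (a + of_real (- s) * v)"
        using M neg_less_0_iff_less[of s] unfolding M1_def by blast+
      then show False unfolding eq by blast
    qed
    have M11: "a = a' \<and> v = v'" if M: "M1 a v" "M1 a' v'" and t: "t > 0" "t' > 0"
      and e: "a + of_real t * v = a' + of_real t' * v'" for a v a' v' t t'
    proof -
      have "cov v (a + of_real t * v)" "cov v' (a' + of_real t' * v')" using M t unfolding M1_def by blast+
      then have v: "v = v'" using e cov_unique by metis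
      have "t = t'" using lt[of a v a' t t'] lt[of a' v a t' t] M e v by (metis linorder_neqE)
      then show ?thesis using e v by simp
    qed
    have M12: False if M: "M1 a v" "M2 a' v'" and t: "t > 0" and e: "a + of_real t * v = a' + of_real t' * v'" for a v a' v' t t'
    proof -
      have "cov v (a + of_real t * v)" "cov v' (a' + of_real t' * v')" using M t unfolding M1_def M2_def by blast+
      then have v: "v = v'" using e cov_unique by metis
      have "a + of_real (-1) * v = a' + of_real (t' - t - 1) * v'" using e v by (simp add: algebra_simps)
      then show False using M v unfolding M1_def M2_def by (metis neg_less_0_iff_less zero_less_one)
    qed
    have M22: "a = a' \<and> v = v' \<and> t = t'" if M: "M2 a v" "M2 a' v'" and e: "a + of_real t * v = a' + of_real t' * v'" for a v a' v' t t'
    proof -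
      have "cov v (a + of_real t * v)" "cov v' (a' + of_real t' * v')" using M unfolding M2_def by blast+
      then have v: "v = v'" using e cov_unique by metis
      have vv: "v * cnj v = 1" using M2_unit[OF M(1)] complex_norm_square[of v] by simp
      have "(a + of_real t * v) * cnj v = a * cnj v + of_real t" using vv by (simp add: distrib_right mult.assoc)
      moreover have "(a' + of_real t' * v') * cnj v = a' * cnj v + of_real t'" using vv v by (simp add: distrib_right mult.assoc)
      ultimately have "Re (a * cnj v) + t = Re (a' * cnj v) + t'" using e by (metis Re_complex_of_real plus_complex.sel(1))
      then have "t = t'" using M v unfolding M2_def by simp
      then show ?thesis using e v by simp
    qed
    from R(1) obtain a v where av: "M1 a v \<and> R = half_line a v \<or> M2 a v \<and> (R = half_line a v \<or> R = half_line a (- v))"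
      unfolding \<R>_def by blast
    from R(2) obtain a' v' where av': "M1 a' v' \<and> R' = half_line a' v' \<or> M2 a' v' \<and> (R' = half_line a' v' \<or> R' = half_line a' (- v'))"
      unfolding \<R>_def by blast
    have "v \<noteq> 0" "v' \<noteq> 0" using av av' M1_unit M2_unit by (metis norm_zero zero_neq_one)+
    have pt: "\<exists>\<sigma> t. (\<sigma> = 1 \<or> (M2 b w \<and> \<sigma> = -1)) \<and> t > 0 \<and> x = b + of_real (\<sigma> * t) * w \<and> Q = half_line b (of_real \<sigma> * w)"
      if Q: "M1 b w \<and> Q = half_line b w \<or> M2 b w \<and> (Q = half_line b w \<or> Q = half_line b (- w))"
        and xQ: "x \<in> rel_interior Q" and w: "w \<noteq> 0" for b w Q
    proof -
      consider "Q = half_line b w" | "M2 b w" "Q = half_line b (- w)" using Q by blast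
      then show ?thesis
      proof cases
        case 1
        then obtain t where "t > 0" "x = b + of_real t * w" using rel_interior_half_line[of x b w] xQ w by blast
        then show ?thesis using 1 by (intro exI[of _ 1] exI[of _ t]) auto
      next
        case 2
        then obtain t where "t > 0" "x = b + of_real t * (- w)" using rel_interior_half_line[of x b "- w"] xQ w
          by (auto simp del: mult_minus_right)
        then show ?thesis using 2 by (intro exI[of _ "-1"] exI[of _ t]) auto
      qed
    qed
    obtain \<sigma> t where st: "\<sigma> = 1 \<or> (M2 a v \<and> \<sigma> = -1)" "t > 0" "x = a + of_real (\<sigma> * t) * v" "R = half_line a (of_real \<sigma> * v)"
      using pt[OF av x(1) \<open>v \<noteq> 0\<close>] by blast
    obtain \<sigma>' t' where st': "\<sigma>' = 1 \<or> (M2 a' v' \<and> \<sigma>' = -1)" "t' > 0" "x = a' + of_real (\<sigma>' * t') * v'" "R' = half_line a' (of_real \<sigma>' * v')"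
      using pt[OF av' x(2) \<open>v' \<noteq> 0\<close>] by blast
    have e: "a + of_real (\<sigma> * t) * v = a' + of_real (\<sigma>' * t') * v'" using st(3) st'(3) by simp
    have not12: False if "M1 b w" "M2 b w" for b w
      using that unfolding M1_def M2_def by (metis neg_less_0_iff_less zero_less_one)
    consider "M1 a v" "M1 a' v'" | "M1 a v" "M2 a' v'" | "M2 a v" "M1 a' v'" | "M2 a v" "M2 a' v'"
      using av av' by blast
    then show ?thesis
    proof cases
      case 1
      then have "\<sigma> = 1" "\<sigma>' = 1" using st(1) st'(1) not12 by blast+
      then show ?thesis using M11[OF 1 st(2) st'(2)] e st(4) st'(4) by simp
    next
      case 2
      then have "\<sigma> = 1" using st(1) not12 by blast
      then show ?thesis using M12[OF 2 st(2), of "\<sigma>' * t'"] e by simp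
    next
      case 3
      then have "\<sigma>' = 1" using st'(1) not12 by blast
      then show ?thesis using M12[OF 3(2,1) st'(2), of "\<sigma> * t"] e by simp
    next
      case 4
      have eq: "a = a'" "v = v'" "\<sigma> * t = \<sigma>' * t'" using M22[OF 4 e] by blast+
      have "\<sigma> = \<sigma>'"
      proof (rule ccontr)
        assume "\<sigma> \<noteq> \<sigma>'"
        then have "\<sigma>' = - \<sigma>" "\<sigma> \<noteq> 0" using st(1) st'(1) by auto
        then have "t + t' = 0" using eq(3) by (metis add.inverse_inverse add_eq_0_iff minus_mult_left minus_mult_right mult_cancel_left)
        then show False using st(2) st'(2) by simp
      qed
      then show ?thesis using eq st(4) st'(4) by simp
    qed
  qed
  show ?thesis
  proof (intro exI[of _ \<R>] conjI ballI)
    show "S = \<Union>\<R>" using sub cover by blast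
    show "pairwise (\<lambda>R R'. disjnt (rel_interior R) (rel_interior R')) \<R>"
      unfolding pairwise_def disjnt_def using disj by blast
  qed (fact half)
qed

text \<open>
  Tychonoff's theorem for a product of circles. The approximation is simultaneous at any two points, which is
  what a statement about pairs of half-lines needs.
\<close>
lemma cluster_point_of_direction_fields:
  fixes d :: "nat \<Rightarrow> 'a \<Rightarrow> complex"
  assumes unit: "\<And>n p. cmod (d n p) = 1"
  obtains D where "\<And>p. cmod (D p) = 1"
    "\<And>p q e N. e > 0 \<Longrightarrow> \<exists>n\<ge>N. cmod (d n p - D p) < e \<and> cmod (d n q - D q) < e"
proof -
  define K where "K = (PiE UNIV (\<lambda>_::'a. sphere (0::complex) 1))"
  have "compactin (product_topology (\<lambda>_::'a. euclidean) UNIV) K"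
    unfolding K_def by (subst compactin_PiE) (simp add: compactin_euclidean_iff)
  then have "compact K" by (simp add: euclidean_product_topology compactin_euclidean_iff)
  define F where "F = filtermap d sequentially"
  have "F \<noteq> bot" by (simp add: F_def filtermap_bot_iff)
  moreover have "eventually (\<lambda>g. g \<in> K) F"
    unfolding F_def eventually_filtermap K_def using unit by (intro always_eventually) auto
  ultimately obtain D where D: "D \<in> K" "inf (nhds D) F \<noteq> bot"
    using \<open>compact K\<close> unfolding compact_filter by blast
  show thesis
  proof (rule that)
    show "cmod (D p) = 1" for p using D(1) unfolding K_def by auto
    fix p q :: 'a and e :: real and N :: nat assume e: "e > 0"
    define U where "U = {g. cmod (g p - D p) < e \<and> cmod (g q - D q) < e}"
    have "U = (\<lambda>g. g p) -` ball (D p) e \<inter> (\<lambda>g. g q) -` ball (D q) e"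
      unfolding U_def by (auto simp: dist_norm norm_minus_commute)
    moreover have "open ((\<lambda>g. g r) -` ball c e)" for r :: 'a and c :: complex
      by (intro open_vimage) (auto intro: continuous_on_product_coordinates)
    ultimately have "open U" by (simp add: open_Int)
    moreover have "D \<in> U" using e unfolding U_def by simp
    ultimately have ev: "eventually (\<lambda>g. g \<in> U) (nhds D)" by (rule eventually_nhds_in_open)
    show "\<exists>n\<ge>N. cmod (d n p - D p) < e \<and> cmod (d n q - D q) < e"
    proof (rule ccontr)
      assume no: "\<not> ?thesis"
      have "eventually (\<lambda>g. g \<notin> U) F"
        unfolding F_def eventually_filtermap eventually_sequentially U_def using no by auto
      then have "eventually (\<lambda>g. False) (inf (nhds D) F)"
        unfolding eventually_inf using ev by blast
      then show False using D(2) by (simp add: trivial_limit_def[symmetric] eventually_False)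
    qed
  qed
qed

text \<open>
  Cramer's rule for the parameters at which two lines meet.
\<close>
lemma rays_cross:
  fixes a b w :: complex
  assumes "Im (cnj b * a) \<noteq> 0"
  shows "of_real (Im (cnj b * w) / Im (cnj b * a)) * a = w + of_real (Im (cnj a * w) / Im (cnj b * a)) * b"
proof -
  have "of_real (Im (cnj b * w)) * a = of_real (Im (cnj b * a)) * w + of_real (Im (cnj a * w)) * b"
    by (auto simp: complex_eq_iff algebra_simps)
  moreover have "of_real (Im (cnj b * a)) \<noteq> (0::complex)" using assms by (simp only: of_real_eq_0_iff not_False_eq_True)
  moreover have "l / k * a = w + m / k * b" if "k \<noteq> 0" "l * a = k * w + m * b" for k l m :: complex
    using that by (simp add: field_simps)
  ultimately show ?thesis unfolding of_real_divide by blast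
qed

text \<open>
  A transversal crossing of two limiting half-lines is an open condition, so it would occur already for some
  n. If two limiting half-lines overlap with opposite directions, they fill a line outside the domain,
  and the connected domain lies on one side of it. The approximating half-lines start on that side,
  pass through two points of the line in nearly opposite directions towards each other, and therefore meet on
  the other side. Hence overlapping limiting half-lines have the same direction.
\<close>
lemma limit_of_noncrossing_half_lines:
  fixes \<Omega> :: "complex set" and E :: "nat \<Rightarrow> complex set" and d :: "nat \<Rightarrow> complex \<Rightarrow> complex"
  assumes \<Omega>: "open \<Omega>" "connected \<Omega>" "\<Omega> \<noteq> {}"
    and E: "\<And>n. open (E n)" "\<And>m n. m \<le> n \<Longrightarrow> E m \<subseteq> E n" "(\<Union>n. E n) = \<Omega>"
    and unit: "\<And>n p. p \<notin> \<Omega> \<Longrightarrow> cmod (d n p) = 1"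
    and out: "\<And>n p t. p \<notin> \<Omega> \<Longrightarrow> t \<ge> 0 \<Longrightarrow> p + of_real t * d n p \<notin> E n"
    and base: "\<And>n p. p \<notin> \<Omega> \<Longrightarrow> \<exists>s\<ge>0. p - of_real s * d n p \<in> \<Omega>"
    and same: "\<And>n p q s t. p \<notin> \<Omega> \<Longrightarrow> q \<notin> \<Omega> \<Longrightarrow> s \<ge> 0 \<Longrightarrow> t \<ge> 0 \<Longrightarrow>
       p + of_real s * d n p = q + of_real t * d n q \<Longrightarrow> d n p = d n q"
  shows "close_to_convex_domain \<Omega>"
proof -
  have u: "cmod (if p \<notin> \<Omega> then d n p else 1) = 1" for n p using unit by auto
  obtain D where D1: "\<And>p. cmod (D p) = 1"
    and Dlim0: "\<And>p q e N. e > 0 \<Longrightarrow>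
      \<exists>n\<ge>N. cmod ((if p \<notin> \<Omega> then d n p else 1) - D p) < e \<and> cmod ((if q \<notin> \<Omega> then d n q else 1) - D q) < e"
    by (rule cluster_point_of_direction_fields[OF u]) (rule that)
  have Imr: "Im (of_real r * x) = r * Im x" for r x by simp
  have Dlim: "\<exists>n\<ge>N. cmod (d n p - D p) < e \<and> cmod (d n q - D q) < e" if "e > 0" "p \<notin> \<Omega>" "q \<notin> \<Omega>" for p q e N
    using Dlim0[OF that(1), of N p q] that by simp
  have Dray: "p + of_real t * D p \<notin> \<Omega>" if p: "p \<notin> \<Omega>" and t: "t \<ge> 0" for p t
  proof
    assume "p + of_real t * D p \<in> \<Omega>"
    then obtain N where N: "p + of_real t * D p \<in> E N" using E(3) by blast
    then obtain e where e: "e > 0" "ball (p + of_real t * D p) e \<subseteq> E N" using E(1) open_contains_ball by blast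
    \<comment> \<open>directions closer than e / (t + 1) move the point with parameter t by less than e\<close>
    have "e / (t + 1) > 0" using e t by simp
    then obtain n where n: "n \<ge> N" "cmod (d n p - D p) < e / (t + 1)" using Dlim p by blast
    have "cmod ((p + of_real t * D p) - (p + of_real t * d n p)) = cmod (of_real t * (d n p - D p))"
      by (simp add: algebra_simps norm_minus_commute)
    also have "\<dots> = t * cmod (d n p - D p)" using t by (simp add: norm_mult)
    also have "\<dots> \<le> t * (e / (t + 1))" using n t by (intro mult_left_mono) auto
    also have "\<dots> < e" using t e by (simp add: divide_simps)
    finally have "p + of_real t * d n p \<in> E N" using e(2) by (auto simp: dist_norm)
    then have "p + of_real t * d n p \<in> E n" using E(2) n by blast
    then show False using out p t by blast
  qed
  have Dsame: "D p = D q" if p: "p \<notin> \<Omega>" and q: "q \<notin> \<Omega>" and st: "s > 0" "t > 0"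
    and eq: "p + of_real s * D p = q + of_real t * D q" for p q s t
  proof (rule ccontr)
    assume ne: "D p \<noteq> D q"
    define w where "w = q - p"
    have meet: False if n: "Im (cnj (d n q) * d n p) \<noteq> 0" "Im (cnj (d n q) * w) / Im (cnj (d n q) * d n p) \<ge> 0"
      "Im (cnj (d n p) * w) / Im (cnj (d n q) * d n p) \<ge> 0" for n
    proof -
      have "p + of_real (Im (cnj (d n q) * w) / Im (cnj (d n q) * d n p)) * d n p
          = q + of_real (Im (cnj (d n p) * w) / Im (cnj (d n q) * d n p)) * d n q"
        unfolding rays_cross[OF n(1)] by (simp add: w_def)
      then have "d n p = d n q" by (rule same[OF p q n(2,3)])
      then show False using n(1) by (simp add: algebra_simps)
    qed
    have eqw: "of_real s * D p = w + of_real t * D q" using eq by (simp add: w_def algebra_simps)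
    show False
    proof (cases "Im (cnj (D q) * D p) = 0")
      case False
      have "cnj (D q) * (of_real s * D p) = cnj (D q) * w + of_real t * (D q * cnj (D q))"
        unfolding eqw by (simp add: algebra_simps)
      then have "cnj (D q) * w = of_real s * (cnj (D q) * D p) - of_real t"
        by (simp add: complex_norm_square[symmetric] D1 algebra_simps)
      then have "Im (cnj (D q) * w) = s * Im (cnj (D q) * D p)"
        by (simp only: minus_complex.sel Imr Im_complex_of_real diff_0_right)
      then have sT: "Im (cnj (D q) * w) / Im (cnj (D q) * D p) = s" using False by simp
      have "of_real s * (D p * cnj (D p)) = cnj (D p) * w + of_real t * (cnj (D p) * D q)"
        using arg_cong[OF eqw, of "\<lambda>z. cnj (D p) * z"] by (simp add: algebra_simps)
      then have "cnj (D p) * w = of_real s - of_real t * (cnj (D p) * D q)"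
        by (simp add: complex_norm_square[symmetric] D1 algebra_simps)
      then have "Im (cnj (D p) * w) = t * Im (cnj (D q) * D p)"
        by (simp only: minus_complex.sel Imr Im_complex_of_real) (simp add: algebra_simps)
      then have tT: "Im (cnj (D p) * w) / Im (cnj (D q) * D p) = t" using False by simp
      define Q where "Q = (\<lambda>(a, b). Im (cnj b * a))"
      define A where "A = (\<lambda>(a, b). Im (cnj b * w) / Im (cnj b * a))"
      define B where "B = (\<lambda>(a, b). Im (cnj a * w) / Im (cnj b * a))"
      have cQ: "isCont Q (D p, D q)" unfolding Q_def case_prod_beta by (auto intro!: continuous_intros)
      have "isCont A (D p, D q)" unfolding A_def case_prod_beta using False by (intro continuous_intros) auto
      moreover have "isCont B (D p, D q)" unfolding B_def case_prod_beta using False by (intro continuous_intros) auto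
      moreover have "A (D p, D q) > 0" "B (D p, D q) > 0" using sT tT st by (auto simp: A_def B_def)
      moreover have "Q (D p, D q) \<noteq> 0" using False by (simp add: Q_def)
      ultimately have "eventually (\<lambda>x. A x > 0 \<and> B x > 0 \<and> Q x \<noteq> 0) (nhds (D p, D q))"
        using cQ unfolding isCont_def tendsto_at_iff_tendsto_nhds
        by (intro eventually_conj order_tendstoD(1) tendsto_imp_eventually_ne)
      then obtain e where e: "e > 0" "\<And>x. dist x (D p, D q) < e \<Longrightarrow> A x > 0 \<and> B x > 0 \<and> Q x \<noteq> 0"
        unfolding eventually_nhds_metric by blast
      obtain n where n: "cmod (d n p - D p) < e / 2" "cmod (d n q - D q) < e / 2"
        using Dlim[of "e / 2" p q] e(1) p q by auto
      have "dist (d n p, d n q) (D p, D q) \<le> dist (d n p) (D p) + dist (d n q) (D q)"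
        unfolding dist_Pair_Pair by (rule sqrt_sum_squares_le_sum) auto
      also have "\<dots> < e" using n by (simp add: dist_norm)
      finally have "A (d n p, d n q) > 0" "B (d n p, d n q) > 0" "Q (d n p, d n q) \<noteq> 0" using e(2) by blast+
      then show False using meet[of n] by (simp add: A_def B_def Q_def)
    next
      case True
      \<comment> \<open>opposite directions: the two half-lines fill a whole line outside the domain\<close>
      define r where "r = Re (cnj (D q) * D p)"
      have r: "D p = of_real r * D q"
      proof -
        have "cnj (D q) * D p = of_real r" using True by (simp add: complex_eq_iff r_def)
        then have "(D q * cnj (D q)) * D p = of_real r * D q" by (simp add: mult.assoc mult.commute)
        then show ?thesis by (simp add: complex_norm_square[symmetric] D1)
      qed
      then have "\<bar>r\<bar> = 1" by (metis D1 mult.right_neutral norm_mult norm_of_real)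
      then have "D p = D q \<or> D p = - D q" using r by (auto simp: abs_if split: if_splits)
      then have anti: "D q = - D p" using ne by auto
      define v where "v = D p"
      have vv: "v * cnj v = 1" using complex_norm_square[of v] D1[of p] by (simp add: v_def)
      have w: "w = of_real (s + t) * v" using eqw anti by (simp add: v_def algebra_simps)
      have line: "p + of_real x * v \<notin> \<Omega>" for x
      proof (cases "x \<ge> 0")
        case True then show ?thesis using Dray[OF p] by (simp add: v_def)
      next
        case False
        have "p + of_real x * v = q + of_real (s + t - x) * D q"
          using w anti by (simp add: w_def v_def algebra_simps)
        then show ?thesis using Dray[OF q, of "s + t - x"] False st by simp
      qed
      \<comment> \<open>the signed distance from the line\<close>
      define \<phi> where "\<phi> = (\<lambda>z. Im (cnj v * (z - p)))"
      have nz: "\<phi> z \<noteq> 0" if "z \<in> \<Omega>" for z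
      proof
        assume "\<phi> z = 0"
        then have "cnj v * (z - p) = of_real (Re (cnj v * (z - p)))" unfolding \<phi>_def by (simp add: complex_eq_iff)
        then have "(v * cnj v) * (z - p) = of_real (Re (cnj v * (z - p))) * v" by (simp add: mult.assoc mult.commute)
        then have "z = p + of_real (Re (cnj v * (z - p))) * v" using vv by (simp add: algebra_simps)
        then show False using line that by metis
      qed
      have "connected (\<phi> ` \<Omega>)" unfolding \<phi>_def using \<Omega>(2) by (intro connected_continuous_image continuous_intros)
      then have sgn: "\<phi> z * \<phi> z' > 0" if "z \<in> \<Omega>" "z' \<in> \<Omega>" for z z'
      proof (rule_tac ccontr)
        assume "\<not> ?thesis"
        moreover have "\<phi> z * \<phi> z' \<noteq> 0" using nz that by simp
        ultimately have "\<phi> z * \<phi> z' < 0" by linarith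
        then have "(\<phi> z < 0 \<and> 0 < \<phi> z') \<or> (\<phi> z' < 0 \<and> 0 < \<phi> z)" by (auto simp: mult_less_0_iff)
        then have "0 \<in> \<phi> ` \<Omega>"
          using connectedD_interval[OF \<open>connected (\<phi> ` \<Omega>)\<close>, of "\<phi> z" "\<phi> z'" 0]
                connectedD_interval[OF \<open>connected (\<phi> ` \<Omega>)\<close>, of "\<phi> z'" "\<phi> z" 0] that by auto
        then show False using nz by force
      qed
      obtain n where n: "cmod (d n p - v) < 1" "cmod (d n q - D q) < 1" using Dlim[of 1 p q 0] p q by (auto simp: v_def)
      \<comment> \<open>a and b are the approximating directions in coordinates in which the line is the real axis\<close>
      define a where "a = cnj v * d n p"
      define b where "b = cnj v * d n q"
      have cv: "cmod (cnj v) = 1" using D1 by (simp add: v_def)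
      have "cmod (a - 1) < 1"
      proof -
        have "a - 1 = cnj v * (d n p - v)" using vv by (simp add: a_def algebra_simps)
        then show ?thesis using n(1) cv by (simp add: norm_mult)
      qed
      then have ra: "Re a > 0" using abs_Re_le_cmod[of "a - 1"] by simp
      have "cmod (b + 1) < 1"
      proof -
        have "b + 1 = cnj v * (d n q - D q)" using vv anti by (simp add: b_def v_def algebra_simps)
        then show ?thesis using n(2) cv by (simp add: norm_mult)
      qed
      then have rb: "Re b < 0" using abs_Re_le_cmod[of "b + 1"] by simp
      obtain s1 where s1: "s1 \<ge> 0" "p - of_real s1 * d n p \<in> \<Omega>" using base[OF p] by blast
      obtain s2 where s2: "s2 \<ge> 0" "q - of_real s2 * d n q \<in> \<Omega>" using base[OF q] by blast
      have f1: "\<phi> (p - of_real s1 * d n p) = - s1 * Im a" by (simp add: \<phi>_def a_def algebra_simps)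
      have "cnj v * (q - of_real s2 * d n q - p) = of_real (s + t) * (v * cnj v) - of_real s2 * b"
        using w by (simp add: w_def b_def algebra_simps)
      then have f2: "\<phi> (q - of_real s2 * d n q) = - s2 * Im b" unfolding \<phi>_def vv by simp
      have "s1 * s2 * (Im a * Im b) > 0" using sgn[OF s1(2) s2(2)] unfolding f1 f2 by (simp add: algebra_simps)
      then have ab: "Im a * Im b > 0" using s1 s2 by (metis mult_nonneg_nonneg mult_nonneg_nonpos not_less)
      have cross: "cnj (d n q) * d n p = cnj b * a"
      proof -
        have "cnj b * a = (v * cnj v) * (cnj (d n q) * d n p)" by (simp add: a_def b_def algebra_simps)
        then show ?thesis using vv by simp
      qed
      have w1: "cnj (d n q) * w = of_real (s + t) * cnj b" "cnj (d n p) * w = of_real (s + t) * cnj a"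
        by (simp_all add: w a_def b_def algebra_simps)
      have Q: "Im (cnj b * a) = Re b * Im a - Im b * Re a" by simp
      have "(Im (cnj b * a) < 0 \<and> Im a > 0 \<and> Im b > 0) \<or> (Im (cnj b * a) > 0 \<and> Im a < 0 \<and> Im b < 0)"
      proof (cases "Im a > 0")
        case True
        then have "Im b > 0" using ab by (simp add: zero_less_mult_iff)
        moreover have "Re b * Im a < 0" "Im b * Re a > 0" using True \<open>Im b > 0\<close> ra rb by (auto simp: mult_neg_pos)
        ultimately show ?thesis using True unfolding Q by linarith
      next
        case False
        then have "Im a < 0" "Im b < 0" using ab by (auto simp: zero_less_mult_iff)
        moreover from this have "Re b * Im a > 0" "Im b * Re a < 0" using ra rb by (auto simp: mult_neg_neg mult_neg_pos)
        ultimately show ?thesis unfolding Q by linarith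
      qed
      then have "Im (cnj (d n q) * w) / Im (cnj (d n q) * d n p) \<ge> 0 \<and>
          Im (cnj (d n p) * w) / Im (cnj (d n q) * d n p) \<ge> 0 \<and> Im (cnj (d n q) * d n p) \<noteq> 0"
        unfolding cross w1 Imr using st 
          by (auto simp: zero_le_divide_iff divide_le_0_iff mult_le_0_iff zero_le_mult_iff simp del: times_complex.sel)
      then show False using meet by blast
    qed
  qed
  have "\<exists>\<R>. (\<forall>R\<in>\<R>. closed_half_line R) \<and> - \<Omega> = \<Union>\<R> \<and>
          pairwise (\<lambda>R R'. disjnt (rel_interior R) (rel_interior R')) \<R>"
    by (rule noncrossing_half_lines_cover[of "- \<Omega>" D]) (use \<Omega>(1) D1 Dray Dsame in auto)
  then show ?thesis unfolding close_to_convex_domain_def using \<Omega> by blast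
qed

section \<open>Harmonic functions with a holomorphic decomposition\<close>

text \<open>
  The quotient is -1/2 plus half of (1 + v) / (1 - v), which has positive real part.
\<close>
lemma Re_div_one_minus:
  assumes "cmod v < 1" shows "Re (v / (1 - v)) > - 1 / 2"
proof -
  have v: "1 - v \<noteq> 0" using assms by auto
  have "v / (1 - v) = of_real (- (1 / 2)) + of_real (1 / 2) * ((1 + v) / (1 - v))" using v by (simp add: field_simps)
  moreover have "Re (of_real a + of_real c * x) = a + c * Re x" for a c x by simp
  ultimately have "Re (v / (1 - v)) = - (1 / 2) + 1 / 2 * Re ((1 + v) / (1 - v))" by (simp only:)
  moreover have "Re ((1 + v) / (1 - v)) > 0"
  proof -
    have "(cmod v)\<^sup>2 < 1" using assms by (simp add: abs_square_less_1)
    then have "Re ((1 + v) * cnj (1 - v)) > 0"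
      unfolding cmod_power2 by (simp add: algebra_simps power2_eq_square)
    then show ?thesis using v by (simp only: complex_div_cnj[of "1 + v"] Re_divide_of_real) simp
  qed
  ultimately show ?thesis by linarith
qed

text \<open>
  For x = 1, A = h' and B = g' this is the Jacobian of h + cnj g.
\<close>
lemma jacobian_identity:
  "Im (cnj (A + cnj B) * (\<i> * of_real x * (A - cnj B))) = x * ((cmod A)\<^sup>2 - (cmod B)\<^sup>2)"
  unfolding cmod_power2 by (simp add: power2_eq_square algebra_simps)

lemma has_derivative_add_cnj:
  assumes S: "open S" "h holomorphic_on S" "g holomorphic_on S" "z \<in> S"
    and f: "\<And>w. w \<in> S \<Longrightarrow> f w = h w + cnj (g w)"
  shows "(f has_derivative (\<lambda>v. deriv h z * v + cnj (deriv g z * v))) (at z)"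
proof -
  have "(h has_derivative (\<lambda>v. deriv h z * v)) (at z)" "(g has_derivative (\<lambda>v. deriv g z * v)) (at z)"
    using S by (auto simp: holomorphic_derivI has_field_derivative_def[symmetric])
  then have "((\<lambda>w. h w + cnj (g w)) has_derivative (\<lambda>v. deriv h z * v + cnj (deriv g z * v))) (at z)"
    by (intro has_derivative_add bounded_linear.has_derivative[OF bounded_linear_cnj])
  then show ?thesis
    by (rule has_derivative_transform_within_open[OF _ S(1,4)]) (simp add: f)
qed

lemma has_derivative_rlin_add_cnj:
  assumes S: "open S" "h holomorphic_on S" "g holomorphic_on S" "z \<in> S"
    and f: "\<And>w. w \<in> S \<Longrightarrow> f w = h w + cnj (g w)"
  shows "(f has_derivative rlin (deriv h z + cnj (deriv g z)) (\<i> * (deriv h z - cnj (deriv g z)))) (at z)"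
proof -
  have "rlin (deriv h z + cnj (deriv g z)) (\<i> * (deriv h z - cnj (deriv g z)))
      = (\<lambda>v. deriv h z * v + cnj (deriv g z * v))"
    by (auto simp: rlin_def complex_eq_iff algebra_simps)
  then show ?thesis using has_derivative_add_cnj[OF assms] by simp
qed

context
  fixes S and f h g :: "complex \<Rightarrow> complex"
  assumes S: "open S" "h holomorphic_on S" "g holomorphic_on S"
    and f: "\<And>w. w \<in> S \<Longrightarrow> f w = h w + cnj (g w)"
begin

lemma partial_add_cnj:
  assumes "z \<in> S"
  shows "partial_x f z = deriv h z + cnj (deriv g z)"
    "partial_y f z = \<i> * deriv h z + cnj (\<i> * deriv g z)"
  using has_derivative_add_cnj[OF S assms f] unfolding partial_x_def partial_y_def
  by (simp_all add: frechet_derivative_at[symmetric] mult.commute)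

lemma wirtinger_add_cnj:
  assumes "z \<in> S"
  shows "wirtinger_z f z = deriv h z" "wirtinger_zbar f z = cnj (deriv g z)"
  unfolding wirtinger_z_def wirtinger_zbar_def partial_add_cnj[OF assms]
  by (simp_all add: algebra_simps)

lemma continuous_on_add_cnj: "continuous_on S f"
proof -
  have "continuous_on S (\<lambda>w. h w + cnj (g w))"
    using S by (intro continuous_intros holomorphic_on_imp_continuous_on) 
  then show ?thesis using f by (simp cong: continuous_on_cong)
qed

lemma differentiable_on_add_cnj: "f differentiable_on S"
proof (rule differentiable_at_imp_differentiable_on)
  fix x assume "x \<in> S"
  then show "f differentiable at x" using has_derivative_add_cnj[OF S _ f] differentiableI by blast
qed

end

text \<open>
  The partial derivatives of h + cnj g are of the same form, with (h', g') and (\<i> h', \<i> g') in place of (h, g).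
\<close>
lemma harmonic_on_add_cnj:
  assumes S: "open S" "h holomorphic_on S" "g holomorphic_on S"
    and f: "\<And>w. w \<in> S \<Longrightarrow> f w = h w + cnj (g w)"
  shows "harmonic_on f S"
proof -
  define h1 where "h1 = deriv h"
  define g1 where "g1 = deriv g"
  have hol1: "h1 holomorphic_on S" "g1 holomorphic_on S"
    unfolding h1_def g1_def using S by (auto intro: holomorphic_deriv)
  have hol2: "(\<lambda>z. \<i> * h1 z) holomorphic_on S" "(\<lambda>z. \<i> * g1 z) holomorphic_on S"
    using hol1 by (auto intro!: holomorphic_intros)
  have hol3: "deriv h1 holomorphic_on S" "deriv g1 holomorphic_on S"
    using S hol1 by (auto intro: holomorphic_deriv)
  have fx: "partial_x f z = h1 z + cnj (g1 z)" and fy: "partial_y f z = \<i> * h1 z + cnj (\<i> * g1 z)" if "z \<in> S" for z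
    unfolding h1_def g1_def using partial_add_cnj[OF S f that] by auto
  have di: "deriv (\<lambda>z. \<i> * h1 z) z = \<i> * deriv h1 z" "deriv (\<lambda>z. \<i> * g1 z) z = \<i> * deriv g1 z" if "z \<in> S" for z
  proof -
    have "h1 field_differentiable at z" "g1 field_differentiable at z"
      using hol1 S(1) that holomorphic_on_imp_differentiable_at by blast+
    then show "deriv (\<lambda>z. \<i> * h1 z) z = \<i> * deriv h1 z" "deriv (\<lambda>z. \<i> * g1 z) z = \<i> * deriv g1 z"
      by (simp_all add: deriv_cmult)
  qed
  have xx: "partial_x (partial_x f) z = deriv h1 z + cnj (deriv g1 z)"
    "partial_y (partial_x f) z = \<i> * deriv h1 z + cnj (\<i> * deriv g1 z)" if "z \<in> S" for z
    using partial_add_cnj[OF S(1) hol1, of "partial_x f" z] fx that by auto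
  have yy: "partial_x (partial_y f) z = deriv (\<lambda>z. \<i> * h1 z) z + cnj (deriv (\<lambda>z. \<i> * g1 z) z)"
    "partial_y (partial_y f) z = \<i> * deriv (\<lambda>z. \<i> * h1 z) z + cnj (\<i> * deriv (\<lambda>z. \<i> * g1 z) z)" if "z \<in> S" for z
    using partial_add_cnj[OF S(1) hol2, of "partial_y f" z] fy that by auto
  have c: "continuous_on S (deriv h1)" "continuous_on S (deriv g1)"
    using hol3 holomorphic_on_imp_continuous_on by blast+
  have c': "continuous_on S (deriv (\<lambda>z. \<i> * h1 z))" "continuous_on S (deriv (\<lambda>z. \<i> * g1 z))"
    using hol2 S(1) holomorphic_deriv holomorphic_on_imp_continuous_on by blast+
  have "continuous_on S (partial_x (partial_x f))" "continuous_on S (partial_y (partial_x f))"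
    using c by (auto simp: xx cong: continuous_on_cong intro!: continuous_intros)
  moreover have "continuous_on S (partial_x (partial_y f))" "continuous_on S (partial_y (partial_y f))"
    using c' by (auto simp: yy cong: continuous_on_cong intro!: continuous_intros)
  moreover have "partial_x (partial_x f) z + partial_y (partial_y f) z = 0" if "z \<in> S" for z
    unfolding xx[OF that] yy[OF that] di[OF that] by (simp add: mult.assoc[symmetric])
  ultimately show ?thesis unfolding harmonic_on_def
    using S(1) differentiable_on_add_cnj[OF S f] differentiable_on_add_cnj[OF S(1) hol1 fx]
      differentiable_on_add_cnj[OF S(1) hol2 fy] by blast
qed

text \<open>
  The conditions that the class M imposes on the holomorphic parts; the value of h' at 0 comes from the
  normalisation of the class H.
\<close>
definition M_pair :: "complex \<Rightarrow> (complex \<Rightarrow> complex) \<Rightarrow> (complex \<Rightarrow> complex) \<Rightarrow> bool" where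
  "M_pair \<alpha> h g \<longleftrightarrow> h holomorphic_on unit_disc \<and> g holomorphic_on unit_disc \<and> h 0 = 0 \<and> g 0 = 0 \<and> deriv h 0 = 1 \<and>
     (\<forall>z\<in>unit_disc. deriv g z = \<alpha> * z * deriv h z \<and> deriv h z \<noteq> 0 \<and>
        Re (1 + z * deriv (deriv h) z / deriv h z) > - 1 / 2)"

lemma class_M_imp_M_pair:
  assumes "f \<in> class_M \<alpha>"
  obtains h g where "M_pair \<alpha> h g" "\<And>z. z \<in> unit_disc \<Longrightarrow> f z = h z + cnj (g z)"
proof -
  from assms obtain h g where hd: "harmonic_decomposition f h g" and
     *: "\<forall>z\<in>unit_disc. deriv g z = \<alpha> * z * deriv h z \<and> deriv h z \<noteq> 0 \<and>
        Re (1 + z * deriv (deriv h) z / deriv h z) > - 1 / 2" and w: "wirtinger_z f 0 = 1"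
    unfolding class_M_def class_H_def by blast
  have f: "f z = h z + cnj (g z)" if "z \<in> unit_disc" for z
    using hd that unfolding harmonic_decomposition_def by blast
  have "deriv h 0 = 1"
    using wirtinger_add_cnj(1)[of unit_disc h g f 0] hd w f unfolding harmonic_decomposition_def by auto
  then have "M_pair \<alpha> h g" using hd * unfolding M_pair_def harmonic_decomposition_def by blast
  then show thesis using f by (rule that)
qed

lemma M_pair_imp_class_M:
  assumes M: "M_pair \<alpha> h g" and f: "\<And>z. z \<in> unit_disc \<Longrightarrow> f z = h z + cnj (g z)"
  shows "f \<in> class_M \<alpha>" "harmonic_decomposition f h g"
proof -
  have hol: "open unit_disc" "h holomorphic_on unit_disc" "g holomorphic_on unit_disc"
    using M unfolding M_pair_def by auto
  show hd: "harmonic_decomposition f h g"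
    using M f unfolding M_pair_def harmonic_decomposition_def by blast
  have "f \<in> class_H"
    unfolding class_H_def using harmonic_on_add_cnj[OF hol f] wirtinger_add_cnj(1)[OF hol f, of 0] M f[of 0]
    unfolding M_pair_def by simp
  then show "f \<in> class_M \<alpha>" using hd M unfolding class_M_def M_pair_def by blast
qed

section \<open>The tangent angle of the image of a circle\<close>

text \<open>
  L is a logarithm of h'. On the circle, u is the quotient for which the tangent of the image curve equals
  \<i> w (1 - u), w = z h'(z), and \<nu> is the angle from the tangent of the circle to the tangent of its
  image. The argument of u has the angular speed -q, and d\<nu>, df are the derivatives of \<nu> and f along
  the circle.
\<close>
locale M_circle =
  fixes \<alpha> :: complex and h g L :: "complex \<Rightarrow> complex" and r :: real
  assumes M: "M_pair \<alpha> h g" and \<alpha>: "cmod \<alpha> \<le> 1" and r: "0 < r" "r < 1"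
    and L: "L holomorphic_on unit_disc" "\<And>z. z \<in> unit_disc \<Longrightarrow> deriv h z = exp (L z)"
begin

definition "f z = h z + cnj (g z)"
definition "b \<theta> = of_real r * cis \<theta>"
definition "q \<theta> = 3 + 2 * Re (b \<theta> * deriv L (b \<theta>))"
definition "u z = cnj (\<alpha> * z) * cnj (z * deriv h z) / (z * deriv h z)"
definition "\<nu> z = Im (L z) + Im (Ln (1 - u z))"
definition "d\<nu> \<theta> = (q \<theta> - 3) / 2 + q \<theta> * Re (u (b \<theta>) / (1 - u (b \<theta>)))"
definition "df \<theta> = \<i> * b \<theta> * deriv h (b \<theta>) + cnj (\<i> * b \<theta> * deriv g (b \<theta>))"

lemma hol: "open unit_disc" "h holomorphic_on unit_disc" "g holomorphic_on unit_disc"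
  and g': "z \<in> unit_disc \<Longrightarrow> deriv g z = \<alpha> * z * deriv h z"
  and h'_nz: "z \<in> unit_disc \<Longrightarrow> deriv h z \<noteq> 0"
  using M unfolding M_pair_def by auto

lemma r_bounds [simp]: "0 < r" "r < 1" "r \<noteq> 0" "0 \<le> r" "\<not> r \<le> 0"
  using r by auto

lemma b_disc [simp]: "b \<theta> \<in> unit_disc" "cmod (b \<theta>) = r" "b \<theta> \<noteq> 0"
  using r by (auto simp: b_def norm_mult)

lemma L_deriv: "z \<in> unit_disc \<Longrightarrow> (L has_field_derivative deriv L z) (at z)"
  using L(1) hol(1) holomorphic_derivI by blast

lemma Re_logderiv_gt: assumes z: "z \<in> unit_disc" shows "Re (z * deriv L z) > - 3 / 2"
proof -
  have "deriv (deriv h) z = deriv L z * exp (L z)"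
  proof (rule DERIV_imp_deriv)
    have "((\<lambda>w. exp (L w)) has_field_derivative exp (L z) * deriv L z) (at z)"
      by (rule DERIV_chain2[OF DERIV_exp L_deriv[OF z]])
    then show "(deriv h has_field_derivative deriv L z * exp (L z)) (at z)"
      using has_field_derivative_transform_within_open[OF _ hol(1) z, of "\<lambda>w. exp (L w)" _ "deriv h"] L(2)
      by (simp add: mult.commute)
  qed
  then have "z * deriv (deriv h) z / deriv h z = z * deriv L z" using L(2)[OF z] by simp
  moreover have "Re (1 + z * deriv (deriv h) z / deriv h z) > - 1 / 2" using M z unfolding M_pair_def by blast
  ultimately show ?thesis by simp
qed

lemma q_pos: "q \<theta> > 0"
  using Re_logderiv_gt[OF b_disc(1), of \<theta>] by (simp add: q_def)

lemma u_small:
  assumes "z \<in> unit_disc" "z \<noteq> 0" shows "cmod (u z) < 1" "Re (1 - u z) > 0" "1 - u z \<notin> \<real>\<^sub>\<le>\<^sub>0" "1 - u z \<noteq> 0"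
proof -
  have "cmod (u z) = cmod \<alpha> * cmod z" using h'_nz[OF assms(1)] assms(2) by (simp add: u_def norm_mult norm_divide)
  also have "\<dots> \<le> 1 * cmod z" by (intro mult_right_mono \<alpha>) auto
  also have "\<dots> < 1" using assms by simp
  finally show 1: "cmod (u z) < 1" .
  then show 2: "Re (1 - u z) > 0" using abs_Re_le_cmod[of "u z"] by simp
  show "1 - u z \<notin> \<real>\<^sub>\<le>\<^sub>0" using 2 by (auto simp: complex_nonpos_Reals_iff)
  show "1 - u z \<noteq> 0" using 2 by auto
qed

lemma b_vd: "(b has_vector_derivative \<i> * b \<theta>) (at \<theta>)"
  unfolding b_def[abs_def] has_vector_derivative_def
  by (auto intro!: derivative_eq_intros simp: scaleR_conv_of_real algebra_simps)

lemma ImL_d: "((\<lambda>\<theta>. Im (L (b \<theta>))) has_real_derivative Re (b \<theta> * deriv L (b \<theta>))) (at \<theta>)"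
proof -
  have "((L \<circ> b) has_vector_derivative (\<i> * b \<theta>) * deriv L (b \<theta>)) (at \<theta>)"
    by (rule field_vector_diff_chain_at[OF b_vd L_deriv]) simp
  then have "((\<lambda>\<theta>. Im ((L \<circ> b) \<theta>)) has_vector_derivative Im ((\<i> * b \<theta>) * deriv L (b \<theta>))) (at \<theta>)"
    by (rule bounded_linear.has_vector_derivative[OF bounded_linear_Im])
  then show ?thesis by (simp add: has_real_derivative_iff_has_vector_derivative mult.assoc)
qed

lemma u_b: "u (b \<theta>) = cnj \<alpha> * of_real r * cis (- (3 * \<theta> + 2 * Im (L (b \<theta>))))"
proof -
  define l where "l = Im (L (b \<theta>))"
  have "deriv h (b \<theta>) = of_real (exp (Re (L (b \<theta>)))) * cis l"
    using L(2)[OF b_disc(1)] by (simp add: l_def exp_eq_polar)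
  then have w: "b \<theta> * deriv h (b \<theta>) = of_real (r * exp (Re (L (b \<theta>)))) * cis (\<theta> + l)"
    by (simp add: b_def cis_mult[symmetric])
  have cw: "cnj (b \<theta> * deriv h (b \<theta>)) = of_real (r * exp (Re (L (b \<theta>)))) * cis (- (\<theta> + l))"
    unfolding w by (simp add: cis_cnj)
  have nz: "of_real (r * exp (Re (L (b \<theta>)))) \<noteq> (0::complex)" using r by simp
  have "cnj (b \<theta> * deriv h (b \<theta>)) / (b \<theta> * deriv h (b \<theta>)) = cis (- (\<theta> + l)) / cis (\<theta> + l)"
    unfolding cw unfolding w using nz by (rule mult_divide_mult_cancel_left)
  then have "u (b \<theta>) = cnj \<alpha> * cnj (b \<theta>) * cis (- (\<theta> + l) - (\<theta> + l))"
    unfolding u_def by (simp only: complex_cnj_mult times_divide_eq_right[symmetric] cis_divide)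
  also have "\<dots> = cnj \<alpha> * of_real r * cis (- (3 * \<theta> + 2 * l))"
    by (simp add: b_def cis_cnj cis_mult algebra_simps)
  finally show ?thesis by (simp add: l_def)
qed

lemma u_vd: "((\<lambda>\<theta>. u (b \<theta>)) has_vector_derivative - \<i> * of_real (q \<theta>) * u (b \<theta>)) (at \<theta>)"
proof -
  define m where "m = (\<lambda>\<theta>. - (3 * \<theta> + 2 * Im (L (b \<theta>))))"
  have "(m has_real_derivative - (3 * 1 + 2 * Re (b \<theta> * deriv L (b \<theta>)))) (at \<theta>)"
    unfolding m_def by (rule DERIV_minus[OF DERIV_add[OF DERIV_cmult[OF DERIV_ident] DERIV_cmult[OF ImL_d]]])
  then have "(m has_real_derivative - q \<theta>) (at \<theta>)" by (simp only: q_def mult_1_right)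
  then have "(m has_derivative (\<lambda>x. - q \<theta> * x)) (at \<theta>)" by (simp only: has_field_derivative_def)
  from has_derivative_cis[OF this]
  have "((\<lambda>\<theta>. cnj \<alpha> * of_real r * cis (m \<theta>)) has_derivative (\<lambda>x. cnj \<alpha> * of_real r * ((- q \<theta> * x) *\<^sub>R (\<i> * cis (m \<theta>))))) (at \<theta>)"
    by (rule has_derivative_mult_right)
  then show ?thesis
    unfolding has_vector_derivative_def u_b m_def
    by (rule has_derivative_eq_rhs) (auto simp: scaleR_conv_of_real algebra_simps)
qed

lemma \<nu>_d: "((\<lambda>\<theta>. \<nu> (b \<theta>)) has_real_derivative d\<nu> \<theta>) (at \<theta>)"
proof -
  have v: "((\<lambda>\<theta>. 1 - u (b \<theta>)) has_vector_derivative \<i> * of_real (q \<theta>) * u (b \<theta>)) (at \<theta>)"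
    by (rule has_vector_derivative_eq_rhs[OF has_vector_derivative_diff[OF has_vector_derivative_const u_vd]]) simp
  have l: "(Ln has_field_derivative inverse (1 - u (b \<theta>))) (at (1 - u (b \<theta>)))"
    by (rule has_field_derivative_Ln) (rule u_small; simp)
  have "((\<lambda>\<theta>. Im ((Ln \<circ> (\<lambda>\<theta>. 1 - u (b \<theta>))) \<theta>)) has_vector_derivative
      Im ((\<i> * of_real (q \<theta>) * u (b \<theta>)) * inverse (1 - u (b \<theta>)))) (at \<theta>)"
    by (rule bounded_linear.has_vector_derivative[OF bounded_linear_Im field_vector_diff_chain_at[OF v l]])
  moreover have "(\<i> * of_real (q \<theta>) * u (b \<theta>)) * inverse (1 - u (b \<theta>)) = \<i> * (of_real (q \<theta>) * (u (b \<theta>) / (1 - u (b \<theta>))))"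
    by (simp add: field_simps)
  moreover have "Im (\<i> * (of_real (q \<theta>) * x)) = q \<theta> * Re x" for x by simp
  ultimately have "((\<lambda>\<theta>. Im (Ln (1 - u (b \<theta>)))) has_real_derivative q \<theta> * Re (u (b \<theta>) / (1 - u (b \<theta>)))) (at \<theta>)"
    by (simp only: has_real_derivative_iff_has_vector_derivative o_def)
  from DERIV_add[OF ImL_d this] show ?thesis
    unfolding \<nu>_def d\<nu>_def
    by (rule DERIV_cong) (simp add: q_def del: times_complex.sel)
qed

text \<open>
  Since Re (u / (1 - u)) > -1/2 and q > 0, the derivative exceeds (q - 3) / 2 - q / 2.
\<close>
lemma d\<nu>_gt: "d\<nu> \<theta> > - 3 / 2"
proof -
  have "Re (u (b \<theta>) / (1 - u (b \<theta>))) > - 1 / 2"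
    by (rule Re_div_one_minus) (rule u_small(1); simp)
  then have "q \<theta> * Re (u (b \<theta>) / (1 - u (b \<theta>))) > q \<theta> * (- 1 / 2)"
    using q_pos mult_less_cancel_left_pos by blast
  then show ?thesis unfolding d\<nu>_def by (simp add: field_simps)
qed

lemma \<nu>_periodic: "\<nu> (b (\<theta> + 2 * pi)) = \<nu> (b \<theta>)"
  by (simp add: b_def cis_mult[symmetric])

lemma \<nu>_increment:
  assumes "\<theta> \<le> \<theta>'" "\<theta>' \<le> \<theta> + 2 * pi"
  shows "\<nu> (b \<theta>') - \<nu> (b \<theta>) > - 3 * pi"
proof (cases "\<theta> = \<theta>'")
  case False
  have "\<exists>y. ((\<lambda>\<theta>. \<nu> (b \<theta>) + 3 / 2 * \<theta>) has_real_derivative y) (at x) \<and> 0 < y" for x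
    using d\<nu>_gt[of x] by (intro exI[of _ "d\<nu> x + 3 / 2"] conjI) (auto intro!: derivative_eq_intros \<nu>_d)
  then have "\<nu> (b \<theta>) + 3 / 2 * \<theta> < \<nu> (b \<theta>') + 3 / 2 * \<theta>'"
    using DERIV_pos_imp_increasing[of \<theta> \<theta>' "\<lambda>\<theta>. \<nu> (b \<theta>) + 3 / 2 * \<theta>"] False assms by auto
  then show ?thesis using assms by simp
qed auto

lemma u_continuous: "continuous_on (unit_disc - {0}) u"
  unfolding u_def
  by (intro continuous_intros continuous_on_subset[OF holomorphic_on_imp_continuous_on[OF holomorphic_deriv[OF hol(2,1)]]])
     (use h'_nz in auto)

lemma \<nu>_continuous: "continuous_on (unit_disc - {0}) \<nu>"
proof -
  have "continuous_on (unit_disc - {0}) (\<lambda>z. Ln (1 - u z))"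
    by (intro continuous_intros u_continuous) (use u_small(3) in auto)
  moreover have "continuous_on (unit_disc - {0}) L"
    by (rule continuous_on_subset[OF holomorphic_on_imp_continuous_on[OF L(1)]]) auto
  ultimately show ?thesis unfolding \<nu>_def[abs_def]
    by (intro continuous_on_add continuous_on_Im)
qed

text \<open>
  Going from a maximum of \<nu> to a minimum in the positive direction takes at most one turn, and \<nu> decreases
  at a rate below 3/2. So its oscillation is below 3 \<pi>.
\<close>
lemma ex_centre: "\<exists>c. \<forall>\<theta>. \<bar>\<nu> (b \<theta>) / 3 - c\<bar> < pi / 2"
proof -
  have cb: "continuous_on {0..2*pi} (\<lambda>\<theta>. \<nu> (b \<theta>))"
    using \<nu>_d DERIV_isCont continuous_at_imp_continuous_on by blast
  obtain M where M: "M \<in> {0..2*pi}" "\<And>\<theta>. \<theta> \<in> {0..2*pi} \<Longrightarrow> \<nu> (b \<theta>) \<le> \<nu> (b M)"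
    using continuous_attains_sup[OF compact_Icc _ cb] by auto
  obtain m where m: "m \<in> {0..2*pi}" "\<And>\<theta>. \<theta> \<in> {0..2*pi} \<Longrightarrow> \<nu> (b m) \<le> \<nu> (b \<theta>)"
    using continuous_attains_inf[OF compact_Icc _ cb] by auto
  have osc: "\<nu> (b M) - \<nu> (b m) < 3 * pi"
  proof (cases "M \<le> m")
    case True then show ?thesis using \<nu>_increment[of M m] M m by auto
  next
    case False then show ?thesis using \<nu>_increment[of M "m + 2 * pi"] M m by (auto simp: \<nu>_periodic)
  qed
  have "\<bar>\<nu> (b \<theta>) / 3 - (\<nu> (b M) + \<nu> (b m)) / 6\<bar> < pi / 2" for \<theta>
  proof -
    obtain t where t: "0 \<le> t" "t < 2 * pi" "cis \<theta> = cis t"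
    proof -
      obtain t where "0 \<le> t" "t < 2 * pi" "sin \<theta> = sin t" "cos \<theta> = cos t"
        using sincos_total_2pi[of "cos \<theta>" "sin \<theta>"] by (metis sin_cos_squared_add2)
      then show thesis by (intro that[of t]) (auto simp: complex_eq_iff)
    qed
    then have "\<nu> (b \<theta>) = \<nu> (b t)" by (simp add: b_def)
    then show ?thesis using M(2)[of t] m(2)[of t] t osc by (auto simp: abs_less_iff field_simps)
  qed
  then show ?thesis by blast
qed

lemma f_vd: "((\<lambda>\<theta>. f (b \<theta>)) has_vector_derivative df \<theta>) (at \<theta>)"
proof -
  have "(f has_derivative (\<lambda>v. deriv h (b \<theta>) * v + cnj (deriv g (b \<theta>) * v))) (at (b \<theta>))"
    by (rule has_derivative_add_cnj[OF hol]) (auto simp: f_def)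
  from diff_chain_at[OF b_vd[unfolded has_vector_derivative_def] this]
  show ?thesis unfolding has_vector_derivative_def o_def df_def
    by (rule has_derivative_eq_rhs) (auto simp: scaleR_conv_of_real algebra_simps)
qed

text \<open>
  The tangent is \<i> w (1 - u), and 1 - u has positive real part, so the principal logarithm gives a continuous
  argument.
\<close>
lemma df_polar: obtains R where "R > 0" "df \<theta> = \<i> * of_real R * cis (\<theta> + \<nu> (b \<theta>))"
proof -
  define w where "w = b \<theta> * deriv h (b \<theta>)"
  define v where "v = u (b \<theta>)"
  have w0: "w \<noteq> 0" using h'_nz[OF b_disc(1)] by (simp add: w_def)
  have wv: "cnj (\<alpha> * b \<theta>) * cnj w = w * v" using w0 by (simp add: v_def u_def w_def[symmetric])
  have "df \<theta> = \<i> * w - \<i> * (cnj (\<alpha> * b \<theta>) * cnj w)"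
    unfolding df_def g'[OF b_disc(1)] w_def by simp
  then have 1: "df \<theta> = \<i> * (w * (1 - v))" unfolding wv by (simp add: algebra_simps)
  have v1: "1 - v \<noteq> 0" using u_small(4)[of "b \<theta>"] by (simp add: v_def)
  have 2: "1 - v = of_real (cmod (1 - v)) * cis (Im (Ln (1 - v)))"
    using v1 exp_Ln[of "1 - v"] exp_eq_polar[of "Ln (1 - v)"] by simp
  have 3: "w = of_real (r * exp (Re (L (b \<theta>)))) * cis (\<theta> + Im (L (b \<theta>)))"
    unfolding w_def L(2)[OF b_disc(1)] by (simp add: b_def exp_eq_polar[of "L _"] cis_mult[symmetric])
  have "w * (1 - v) = of_real (r * exp (Re (L (b \<theta>)))) * cis (\<theta> + Im (L (b \<theta>))) * (of_real (cmod (1 - v)) * cis (Im (Ln (1 - v))))"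
    using 2 3 by simp
  also have "\<dots> = of_real (r * exp (Re (L (b \<theta>))) * cmod (1 - v)) * cis (\<theta> + \<nu> (b \<theta>))"
    unfolding \<nu>_def v_def[symmetric] by (simp add: cis_mult[symmetric] mult_ac)
  finally have 4: "w * (1 - v) = \<dots>" .
  show thesis
    by (rule that[of "r * exp (Re (L (b \<theta>))) * cmod (1 - v)"]) (use v1 r in \<open>simp_all add: 1 4\<close>)
qed

end

section \<open>The plane swept out by the image of a disc and half-lines\<close>

text \<open>
  A and B are meant to be the images of an open disc and of its boundary circle. By the last clause
  two half-lines that meet are nested.
\<close>
definition exterior_half_lines :: "complex set \<Rightarrow> complex set \<Rightarrow> (complex \<Rightarrow> complex) \<Rightarrow> bool" where
  "exterior_half_lines A B d \<longleftrightarrow>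
     (\<forall>p. p \<notin> A \<longrightarrow> cmod (d p) = 1 \<and> (\<forall>t\<ge>0. p + of_real t * d p \<notin> A) \<and> (\<exists>s\<ge>0. p - of_real s * d p \<in> B)) \<and>
     (\<forall>p q s t. p \<notin> A \<longrightarrow> q \<notin> A \<longrightarrow> s \<ge> 0 \<longrightarrow> t \<ge> 0 \<longrightarrow>
        p + of_real s * d p = q + of_real t * d q \<longrightarrow> d p = d q)"

text \<open>
  The half-line at b \<theta> has direction N \<theta> = \<theta> + 2 \<nu> / 3 + c. In terms of the tangent angle
  \<psi> = \<theta> + \<nu> + \<pi> / 2 this is (2 \<psi> + \<theta>) / 3 + const: the weight 2/3 makes N increasing, because \<nu> decreases at a
  rate below 3/2, and the choice of c keeps the half-line on the outer side of the tangent. The map \<Phi>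
  continues f along the half-lines.
\<close>
locale M_rays = M_circle +
  fixes c :: real
  assumes c: "\<And>\<theta>. \<bar>\<nu> (b \<theta>) / 3 - c\<bar> < pi / 2"
begin

definition "N \<theta> = \<theta> + (2 / 3 * \<nu> (b \<theta>) + c)"
definition "dN \<theta> = 1 + 2 / 3 * d\<nu> \<theta>"
definition "dir z = sgn z * cis (2 / 3 * \<nu> (of_real r * sgn z) + c)"
definition "outer z = f (of_real r * sgn z) + of_real (cmod z - r) * dir z"
definition "\<Phi> z = (if cmod z \<le> r then f z else outer z)"

lemma dN_pos: "dN \<theta> > 0"
  using d\<nu>_gt[of \<theta>] by (simp add: dN_def)

lemma cisN_vd: "((\<lambda>\<theta>. cis (N \<theta>)) has_vector_derivative of_real (dN \<theta>) * (\<i> * cis (N \<theta>))) (at \<theta>)"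
proof -
  have "(N has_real_derivative 1 + (2 / 3 * d\<nu> \<theta> + 0)) (at \<theta>)"
    unfolding N_def[abs_def] by (intro DERIV_add DERIV_ident DERIV_cmult \<nu>_d DERIV_const)
  then have "(N has_derivative (\<lambda>x. dN \<theta> * x)) (at \<theta>)" by (simp only: has_field_derivative_def dN_def add_0_right)
  from has_derivative_cis[OF this] show ?thesis
    unfolding has_vector_derivative_def
    by (rule has_derivative_eq_rhs) (auto simp: scaleR_conv_of_real algebra_simps)
qed

text \<open>
  The angle from the half-line to the tangent is \<pi> / 2 + \<nu> / 3 - c, which lies between 0 and \<pi>.
\<close>
lemma transversal: "Im (cnj (cis (N \<theta>)) * df \<theta>) > 0"
proof -
  obtain R where R: "R > 0" "df \<theta> = \<i> * of_real R * cis (\<theta> + \<nu> (b \<theta>))" using df_polar by blast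
  have "cnj (cis (N \<theta>)) * df \<theta> = \<i> * of_real R * (cis (- N \<theta>) * cis (\<theta> + \<nu> (b \<theta>)))"
    using R by (simp add: cis_cnj)
  also have "cis (- N \<theta>) * cis (\<theta> + \<nu> (b \<theta>)) = cis (\<nu> (b \<theta>) / 3 - c)"
    unfolding cis_mult by (simp add: N_def algebra_simps)
  finally have "Im (cnj (cis (N \<theta>)) * df \<theta>) = R * cos (\<nu> (b \<theta>) / 3 - c)" by simp
  moreover have "- (pi / 2) < \<nu> (b \<theta>) / 3 - c \<and> \<nu> (b \<theta>) / 3 - c < pi / 2"
    using c[of \<theta>] unfolding abs_less_iff by linarith
  then have "cos (\<nu> (b \<theta>) / 3 - c) > 0" by (intro cos_gt_zero_pi) auto
  ultimately show ?thesis using R by simp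
qed

text \<open>
  The continuation in the coordinates x = t + \<i> \<theta>, with t the signed distance from the circle; p2 and q2 are
  its partial derivatives.
\<close>
definition "F2 x = f (b (Im x)) + of_real (Re x) * cis (N (Im x))"
definition "p2 x = cis (N (Im x))"
definition "q2 x = df (Im x) + of_real (Re x) * (of_real (dN (Im x)) * (\<i> * cis (N (Im x))))"

lemma has_derivative_of_Im:
  assumes "(A has_vector_derivative A') (at (Im x))"
  shows "((\<lambda>x. A (Im x)) has_derivative (\<lambda>v. of_real (Im v) * A')) (at x)"
proof -
  have "(Im has_derivative Im) (at x)" by (rule bounded_linear_imp_has_derivative[OF bounded_linear_Im])
  from diff_chain_at[OF this assms[unfolded has_vector_derivative_def]]
  show ?thesis by (simp add: o_def scaleR_conv_of_real)
qed

lemma F2_deriv: "(F2 has_derivative rlin (p2 x) (q2 x)) (at x)"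
proof -
  have 1: "((\<lambda>x. f (b (Im x))) has_derivative (\<lambda>v. of_real (Im v) * df (Im x))) (at x)"
    by (rule has_derivative_of_Im[OF f_vd])
  have 2: "((\<lambda>x. cis (N (Im x))) has_derivative (\<lambda>v. of_real (Im v) * (of_real (dN (Im x)) * (\<i> * cis (N (Im x)))))) (at x)"
    by (rule has_derivative_of_Im[OF cisN_vd])
  have 3: "((\<lambda>x. of_real (Re x) :: complex) has_derivative (\<lambda>v. of_real (Re v))) (at x)"
    by (rule bounded_linear_imp_has_derivative[OF bounded_linear_compose[OF bounded_linear_of_real bounded_linear_Re]])
  show ?thesis unfolding F2_def[abs_def]
    by (rule has_derivative_eq_rhs[OF has_derivative_add[OF 1 has_derivative_mult[OF 3 2]]])
       (auto simp: rlin_def p2_def q2_def algebra_simps)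
qed

lemma deriv_continuous: "continuous_on unit_disc (deriv h)" "continuous_on unit_disc (deriv g)" "continuous_on unit_disc (deriv L)"
  using hol L(1) by (auto intro!: holomorphic_on_imp_continuous_on holomorphic_deriv)

lemma isCont_b_comp: "isCont (\<lambda>\<theta>. A (b \<theta>)) \<theta>" if "continuous_on unit_disc A" for A :: "complex \<Rightarrow> complex"
proof -
  have "isCont b \<theta>" using b_vd has_vector_derivative_continuous by blast
  moreover have "isCont A (b \<theta>)" using that hol(1) b_disc(1) continuous_on_eq_continuous_at by blast
  ultimately show ?thesis by (rule isCont_o2)
qed

lemma isCont_df: "isCont df \<theta>"
proof -
  have "isCont b \<theta>" using b_vd has_vector_derivative_continuous by blast
  then show ?thesis unfolding df_def[abs_def]
    by (intro continuous_intros isCont_b_comp deriv_continuous)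
qed

lemma isCont_dN: "isCont dN \<theta>"
proof -
  have "isCont b \<theta>" using b_vd has_vector_derivative_continuous by blast
  then have q: "isCont q \<theta>" unfolding q_def[abs_def]
    by (intro continuous_intros isCont_Re isCont_b_comp deriv_continuous)
  have u: "isCont (\<lambda>\<theta>. u (b \<theta>)) \<theta>" using u_vd has_vector_derivative_continuous by blast
  have nz: "1 - u (b \<theta>) \<noteq> 0" using u_small(4)[of "b \<theta>"] by simp
  show ?thesis unfolding dN_def[abs_def] d\<nu>_def
    by (intro continuous_intros isCont_Re q u nz) auto
qed

lemma isCont_Im_comp: "isCont A (Im x) \<Longrightarrow> isCont (\<lambda>x. A (Im x)) x" for A :: "real \<Rightarrow> 'b::topological_space"
  by (rule isCont_o2[of x Im A]) auto

lemma F2_cont: "isCont p2 x" "isCont q2 x"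
proof -
  have cN: "isCont (\<lambda>\<theta>. cis (N \<theta>)) \<theta>" for \<theta> using cisN_vd has_vector_derivative_continuous by blast
  show "isCont p2 x" unfolding p2_def[abs_def] by (rule isCont_Im_comp[OF cN])
  show "isCont q2 x" unfolding q2_def[abs_def]
    by (intro continuous_intros isCont_Im_comp[OF cN] isCont_Im_comp[OF isCont_df] isCont_Im_comp[OF isCont_dN]) auto
qed

text \<open>
  Because N increases, moving outwards along the half-lines only enlarges the Jacobian.
\<close>
lemma F2_pos: assumes "Re x \<ge> 0" shows "Im (cnj (p2 x) * q2 x) > 0"
proof -
  have "cnj (p2 x) * q2 x = cnj (cis (N (Im x))) * df (Im x) + \<i> * of_real (Re x * dN (Im x)) * (cis (N (Im x)) * cnj (cis (N (Im x))))"
    by (simp add: p2_def q2_def algebra_simps)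
  also have "cis (N (Im x)) * cnj (cis (N (Im x))) = 1" by (simp add: cis_cnj cis_mult)
  finally have "Im (cnj (p2 x) * q2 x) = Im (cnj (cis (N (Im x))) * df (Im x)) + Re x * dN (Im x)"
    by (simp del: times_complex.sel(2) add: times_complex.sel(2)[of \<i>])
  then show ?thesis using transversal[of "Im x"] dN_pos[of "Im x"] assms by (simp add: add_pos_nonneg)
qed

text \<open>
  F1 is f itself in the coordinates used for F2, with partial derivatives p1 and q1.
\<close>
definition "P x = of_real (r + Re x) * cis (Im x)"
definition "F1 x = f (P x)"
definition "p1 x = deriv h (P x) * cis (Im x) + cnj (deriv g (P x) * cis (Im x))"
definition "q1 x = \<i> * P x * deriv h (P x) + cnj (\<i> * P x * deriv g (P x))"

lemma P_disc: "\<bar>Re x\<bar> < min r (1 - r) \<Longrightarrow> P x \<in> unit_disc"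
  by (auto simp: P_def norm_mult simp del: of_real_add)

lemma P_deriv: "(P has_derivative rlin (cis (Im x)) (\<i> * P x)) (at x)"
proof -
  have "((\<lambda>\<theta>. cis \<theta>) has_vector_derivative \<i> * cis (Im x)) (at (Im x))"
    using has_derivative_cis[OF has_derivative_ident] unfolding has_vector_derivative_def by simp
  from has_derivative_of_Im[OF this]
  have 2: "((\<lambda>x. cis (Im x)) has_derivative (\<lambda>v. of_real (Im v) * (\<i> * cis (Im x)))) (at x)" .
  have 3: "((\<lambda>x. of_real (r + Re x) :: complex) has_derivative (\<lambda>v. of_real (Re v))) (at x)"
    using has_derivative_add[OF has_derivative_const[of r] bounded_linear_imp_has_derivative[OF bounded_linear_Re], of "at x"]
    by (auto dest: has_derivative_of_real)
  show ?thesis unfolding P_def[abs_def]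
    by (rule has_derivative_eq_rhs[OF has_derivative_mult[OF 3 2]]) (auto simp: rlin_def algebra_simps)
qed

lemma F1_deriv: assumes "\<bar>Re x\<bar> < min r (1 - r)" shows "(F1 has_derivative rlin (p1 x) (q1 x)) (at x)"
proof -
  have "(f has_derivative (\<lambda>v. deriv h (P x) * v + cnj (deriv g (P x) * v))) (at (P x))"
    by (rule has_derivative_add_cnj[OF hol P_disc[OF assms]]) (auto simp: f_def)
  from diff_chain_at[OF P_deriv this]
  show ?thesis unfolding F1_def[abs_def] o_def
    by (rule has_derivative_eq_rhs) (auto simp: rlin_def p1_def q1_def algebra_simps)
qed

lemma F1_cont: assumes "\<bar>Re x\<bar> < min r (1 - r)" shows "isCont p1 x" "isCont q1 x"
proof -
  have P: "isCont P x" using P_deriv has_derivative_continuous by blast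
  have "isCont (deriv h) (P x)" "isCont (deriv g) (P x)"
    using deriv_continuous(1,2) hol(1) P_disc[OF assms] continuous_on_eq_continuous_at by blast+
  then have c: "isCont (\<lambda>x. deriv h (P x)) x" "isCont (\<lambda>x. deriv g (P x)) x"
    using isCont_o2[OF P] by blast+
  have ci: "isCont (\<lambda>x. cis (Im x)) x"
    by (rule isCont_Im_comp[OF has_derivative_continuous[OF has_derivative_cis[OF has_derivative_ident]]])
  show "isCont p1 x" "isCont q1 x" unfolding p1_def[abs_def] q1_def[abs_def]
    by (intro continuous_intros c P ci)+
qed

lemma g'_lt_h': assumes z: "z \<in> unit_disc" shows "cmod (deriv g z) < cmod (deriv h z)"
proof -
  have "cmod (deriv g z) = (cmod \<alpha> * cmod z) * cmod (deriv h z)" using g'[OF z] by (simp add: norm_mult)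
  also have "\<dots> < 1 * cmod (deriv h z)"
  proof (rule mult_strict_right_mono)
    have "cmod \<alpha> * cmod z \<le> 1 * cmod z" by (intro mult_right_mono \<alpha>) auto
    then show "cmod \<alpha> * cmod z < 1" using z by simp
  qed (use h'_nz[OF z] in simp)
  finally show ?thesis by simp
qed

lemma F1_pos: assumes "Re x = 0" shows "Im (cnj (p1 x) * q1 x) > 0"
proof -
  have Pb: "P x = of_real r * cis (Im x)" using assms by (simp add: P_def)
  then have disc: "P x \<in> unit_disc" by (simp add: norm_mult)
  define A where "A = deriv h (P x) * cis (Im x)"
  define B where "B = deriv g (P x) * cis (Im x)"
  have "cmod B < cmod A" using g'_lt_h'[OF disc] by (simp add: A_def B_def norm_mult)
  then have "(cmod B)\<^sup>2 < (cmod A)\<^sup>2" by (intro power_strict_mono) auto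
  moreover have "q1 x = \<i> * of_real r * (A - cnj B)" "p1 x = A + cnj B"
    unfolding q1_def p1_def A_def B_def by (simp_all add: Pb algebra_simps)
  then have "Im (cnj (p1 x) * q1 x) = r * ((cmod A)\<^sup>2 - (cmod B)\<^sup>2)"
    using jacobian_identity[of A B r] by simp
  ultimately show ?thesis by simp
qed

lemma F1_F2_agree: assumes "Re x = 0" shows "F1 x = F2 x" "q1 x = q2 x"
proof -
  have "P x = b (Im x)" using assms by (simp add: P_def b_def)
  then show "F1 x = F2 x" "q1 x = q2 x" using assms by (simp_all add: F1_def F2_def q1_def q2_def df_def)
qed

text \<open>
  On the circle itself both formulas are needed, outside it only F2.
\<close>
lemma glued_inj:
  assumes "Re x0 \<ge> 0"
  shows "\<exists>\<delta>>0. inj_on (\<lambda>x. if Re x \<le> 0 then F1 x else F2 x) (ball x0 \<delta>)"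
proof (cases "Re x0 = 0")
  case True
  show ?thesis
  proof (rule glued_locally_injective[where a=0 and d="min r (1 - r)" and ?F1.0=F1 and ?F2.0=F2])
    fix x assume "x \<in> ball x0 (min r (1 - r))"
    then have "\<bar>Re x\<bar> < min r (1 - r)" using abs_Re_le_cmod[of "x0 - x"] True by (auto simp: dist_norm)
    then show "(F1 has_derivative rlin (p1 x) (q1 x)) (at x)" by (rule F1_deriv)
    show "(F2 has_derivative rlin (p2 x) (q2 x)) (at x)" by (rule F2_deriv)
    show "(if Re x \<le> 0 then F1 x else F2 x) = F1 x" if "Re x \<le> 0" using that by simp
    show "(if Re x \<le> 0 then F1 x else F2 x) = F2 x" if "0 \<le> Re x" using that F1_F2_agree(1)[of x] by auto
  qed (use True r F1_cont[of x0] F2_cont[of x0] F1_F2_agree(2) F1_pos F2_pos in auto)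
next
  case False
  show ?thesis
  proof (rule glued_locally_injective[where a=0 and d="Re x0" and ?F1.0=F2 and ?F2.0=F2])
    fix x assume "x \<in> ball x0 (Re x0)"
    then have pos: "Re x > 0" using abs_Re_le_cmod[of "x0 - x"] by (auto simp: dist_norm)
    show "(F2 has_derivative rlin (p2 x) (q2 x)) (at x)" by (rule F2_deriv)
    then show "(F2 has_derivative rlin (p2 x) (q2 x)) (at x)" .
    show "(if Re x \<le> 0 then F1 x else F2 x) = F2 x" if "Re x \<le> 0" using that pos by simp
    show "(if Re x \<le> 0 then F1 x else F2 x) = F2 x" if "0 \<le> Re x" using pos by simp
  qed (use False assms F2_cont F2_pos in auto)
qed

lemma outer_polar: "s > 0 \<Longrightarrow> outer (of_real s * cis \<theta>) = f (b \<theta>) + of_real (s - r) * cis (N \<theta>)"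
proof -
  assume s: "s > 0"
  then have "sgn (of_real s * cis \<theta>) = cis \<theta>" by (simp add: sgn_eq norm_mult)
  then show ?thesis using s
    by (simp add: outer_def dir_def b_def N_def norm_mult cis_mult[symmetric] add.assoc)
qed

lemma outer_on_circle: "cmod z = r \<Longrightarrow> outer z = f z"
  by (auto simp: outer_def sgn_eq)

text \<open>
  Polar coordinates \<sigma> with a branch of the argument near z0 turn \<Phi> into the glued map.
\<close>
lemma \<Phi>_inj_outer:
  assumes z0: "cmod z0 \<ge> r"
  shows "\<exists>e>0. inj_on \<Phi> (ball z0 e)"
proof -
  have z0nz: "z0 \<noteq> 0" using less_le_trans[OF r_bounds(1) z0] by auto
  define \<sigma> where "\<sigma> = (\<lambda>z. Complex (cmod z - r) (Arg z0 + Im (Ln (z / z0))))"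
  have \<sigma>z0: "Re (\<sigma> z0) \<ge> 0" using z0 by (simp add: \<sigma>_def)
  obtain \<delta> where \<delta>: "\<delta> > 0" "inj_on (\<lambda>x. if Re x \<le> 0 then F1 x else F2 x) (ball (\<sigma> z0) \<delta>)"
    using glued_inj[OF \<sigma>z0] by blast
  have cont: "isCont \<sigma> z0"
  proof -
    have "isCont (\<lambda>z. Ln (z / z0)) z0" using z0nz by (intro continuous_intros z0nz) auto
    then have "isCont (\<lambda>z. Im (Ln (z / z0))) z0" by (rule isCont_Im)
    then show ?thesis unfolding \<sigma>_def Complex_eq
      by (intro isCont_add isCont_mult isCont_of_real isCont_diff continuous_const isCont_norm continuous_ident)
  qed
  then obtain e where e: "e > 0" "\<And>z. dist z z0 < e \<Longrightarrow> dist (\<sigma> z) (\<sigma> z0) < \<delta>"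
    using \<delta>(1) unfolding continuous_at_eps_delta by blast
  define e' where "e' = min e (cmod z0)"
  have P\<sigma>: "P (\<sigma> z) = z" if "z \<noteq> 0" for z
  proof -
    have "z / z0 = of_real (cmod (z / z0)) * cis (Im (Ln (z / z0)))"
      using exp_Ln[of "z / z0"] exp_eq_polar[of "Ln (z / z0)"] that z0nz by simp
    moreover have "z0 = of_real (cmod z0) * cis (Arg z0)"
      using z0nz by (simp add: Arg_eq cis_conv_exp)
    ultimately have "z / z0 * z0 = of_real (cmod (z / z0) * cmod z0) * (cis (Arg z0) * cis (Im (Ln (z / z0))))"
      by (metis (no_types, lifting) mult.assoc mult.commute of_real_mult)
    then show ?thesis using z0nz by (simp add: P_def \<sigma>_def cis_mult norm_divide)
  qed
  have \<Phi>: "\<Phi> z = (if Re (\<sigma> z) \<le> 0 then F1 (\<sigma> z) else F2 (\<sigma> z))" if "z \<noteq> 0" for z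
  proof (cases "cmod z \<le> r")
    case True
    then show ?thesis using P\<sigma>[OF that] by (simp add: \<Phi>_def F1_def \<sigma>_def)
  next
    case False
    have "outer z = outer (of_real (r + Re (\<sigma> z)) * cis (Im (\<sigma> z)))"
      using P\<sigma>[OF that] by (simp add: P_def)
    also have "\<dots> = F2 (\<sigma> z)"
      using outer_polar[of "r + Re (\<sigma> z)" "Im (\<sigma> z)"] that by (simp add: \<sigma>_def F2_def)
    finally show ?thesis using False by (simp add: \<Phi>_def \<sigma>_def)
  qed
  show ?thesis
  proof (intro exI[of _ e'] conjI inj_onI)
    show "e' > 0" using e(1) z0nz by (simp add: e'_def)
    fix z w assume z: "z \<in> ball z0 e'" and w: "w \<in> ball z0 e'" and eq: "\<Phi> z = \<Phi> w"
    have nz: "z \<noteq> 0" "w \<noteq> 0" using z w by (auto simp: e'_def dist_norm)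
    have "\<sigma> z \<in> ball (\<sigma> z0) \<delta>" "\<sigma> w \<in> ball (\<sigma> z0) \<delta>"
      using e(2)[of z] e(2)[of w] z w by (auto simp: e'_def dist_commute)
    then have "\<sigma> z = \<sigma> w" using inj_onD[OF \<delta>(2)] eq unfolding \<Phi>[OF nz(1)] \<Phi>[OF nz(2)] by blast
    then show "z = w" using P\<sigma> nz by metis
  qed
qed

lemma \<Phi>_inj_inner:
  assumes z0: "cmod z0 < r"
  shows "\<exists>e>0. inj_on \<Phi> (ball z0 e)"
proof (rule glued_locally_injective[where a=0 and d="r - cmod z0" and ?F1.0=f and ?F2.0=f
    and ?p1.0="\<lambda>z. deriv h z + cnj (deriv g z)" and ?q1.0="\<lambda>z. \<i> * (deriv h z - cnj (deriv g z))"
    and ?p2.0="\<lambda>z. deriv h z + cnj (deriv g z)" and ?q2.0="\<lambda>z. \<i> * (deriv h z - cnj (deriv g z))"])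
  have z0d: "z0 \<in> unit_disc" using less_trans[OF z0 r_bounds(2)] by simp
  have "isCont (deriv h) z0" "isCont (deriv g) z0"
    using deriv_continuous(1,2) hol(1) z0d continuous_on_eq_continuous_at by blast+
  then have cp: "isCont (\<lambda>z. deriv h z + cnj (deriv g z)) z0"
    and cq: "isCont (\<lambda>z. \<i> * (deriv h z - cnj (deriv g z))) z0"
    unfolding isCont_def
    by (auto intro!: tendsto_add tendsto_mult tendsto_diff tendsto_const tendsto_cnj)
  show "isCont (\<lambda>z. deriv h z + cnj (deriv g z)) z0" "isCont (\<lambda>z. \<i> * (deriv h z - cnj (deriv g z))) z0"
    by (fact cp, fact cq)
  show "isCont (\<lambda>z. deriv h z + cnj (deriv g z)) z0" "isCont (\<lambda>z. \<i> * (deriv h z - cnj (deriv g z))) z0"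
    by (fact cp, fact cq)
  have "(cmod (deriv g z0))\<^sup>2 < (cmod (deriv h z0))\<^sup>2" using g'_lt_h'[OF z0d] by (intro power_strict_mono) auto
  moreover have "Im (cnj (deriv h z0 + cnj (deriv g z0)) * (\<i> * (deriv h z0 - cnj (deriv g z0))))
     = (cmod (deriv h z0))\<^sup>2 - (cmod (deriv g z0))\<^sup>2"
    using jacobian_identity[of "deriv h z0" "deriv g z0" 1] by simp
  ultimately show "Im (cnj (deriv h z0 + cnj (deriv g z0)) * (\<i> * (deriv h z0 - cnj (deriv g z0)))) > 0" by simp
  then show "Im (cnj (deriv h z0 + cnj (deriv g z0)) * (\<i> * (deriv h z0 - cnj (deriv g z0)))) > 0" .
  fix x assume "x \<in> ball z0 (r - cmod z0)"
  then have x: "cmod x < r" using norm_triangle_ineq2[of x z0] by (auto simp: dist_norm norm_minus_commute)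
  then have "x \<in> unit_disc" using less_trans[OF x r_bounds(2)] by simp
  then show "(f has_derivative rlin (deriv h x + cnj (deriv g x)) (\<i> * (deriv h x - cnj (deriv g x)))) (at x)"
    by (rule has_derivative_rlin_add_cnj[OF hol]) (auto simp: f_def)
  then show "(f has_derivative rlin (deriv h x + cnj (deriv g x)) (\<i> * (deriv h x - cnj (deriv g x)))) (at x)" .
  show "\<Phi> x = f x" using x by (simp add: \<Phi>_def)
  then show "\<Phi> x = f x" .
qed (use z0 in auto)

lemma f_continuous: "continuous_on unit_disc f"
  by (rule continuous_on_add_cnj[OF hol]) (simp add: f_def)

lemma sgn_in: "z \<noteq> 0 \<Longrightarrow> of_real r * sgn z \<in> unit_disc - {0}" "z \<noteq> 0 \<Longrightarrow> of_real r * sgn z \<in> sphere 0 r" for z :: complex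
  by (auto simp: norm_mult norm_sgn sgn_zero_iff)

lemma \<Phi>_continuous: "continuous_on UNIV \<Phi>"
proof -
  have s: "continuous_on (- {0}) (\<lambda>z::complex. of_real r * sgn z)"
    by (intro continuous_on_mult continuous_on_const continuous_on_sgn continuous_on_id) auto
  have o: "continuous_on (- {0}) outer"
  proof -
    have img: "(\<lambda>z::complex. of_real r * sgn z) ` (- {0}) \<subseteq> unit_disc - {0}"
      by (rule image_subsetI) (rule sgn_in(1), simp)
    then have img': "(\<lambda>z::complex. of_real r * sgn z) ` (- {0}) \<subseteq> unit_disc" by (rule order_trans) (rule Diff_subset)
    have 1: "continuous_on (- {0}) (\<lambda>z. f (of_real r * sgn z))"
      by (rule continuous_on_compose2[OF f_continuous s img'])
    have 2: "continuous_on (- {0}) (\<lambda>z. \<nu> (of_real r * sgn z))"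
      by (rule continuous_on_compose2[OF \<nu>_continuous s img])
    have 3: "continuous_on (- {0}) (\<lambda>z::complex. sgn z)" by (intro continuous_on_sgn continuous_on_id) auto
    have 4: "continuous_on (- {0}) (\<lambda>z. 2 / 3 * \<nu> (of_real r * sgn z) + c)"
      by (rule continuous_on_add[OF continuous_on_mult[OF continuous_on_const 2] continuous_on_const])
    have 5: "continuous_on (- {0}) (\<lambda>z. cis (2 / 3 * \<nu> (of_real r * sgn z) + c))"
      by (rule continuous_on_cis[OF 4])
    have 6: "continuous_on (- {0}) (\<lambda>z::complex. of_real (cmod z - r) :: complex)"
      by (intro continuous_on_of_real continuous_on_diff continuous_on_norm_id continuous_on_const)
    show ?thesis
      unfolding outer_def[abs_def] dir_def
      by (rule continuous_on_add[OF 1 continuous_on_mult[OF 6 continuous_on_mult[OF 3 5]]])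
  qed
  have "continuous_on ({z. cmod z \<le> r} \<union> {z. r \<le> cmod z}) (\<lambda>z. if cmod z \<le> r then f z else outer z)"
  proof (rule continuous_on_cases)
    show "closed {z::complex. cmod z \<le> r}" "closed {z::complex. r \<le> cmod z}"
      by (simp_all add: closed_Collect_le continuous_on_norm_id)
    show "continuous_on {z. cmod z \<le> r} f" by (rule continuous_on_subset[OF f_continuous]) (auto intro: le_less_trans[OF _ r_bounds(2)])
    show "continuous_on {z. r \<le> cmod z} outer" by (rule continuous_on_subset[OF o]) (use r in auto)
    show "\<forall>z. z \<in> {z. cmod z \<le> r} \<and> \<not> cmod z \<le> r \<or> z \<in> {z. r \<le> cmod z} \<and> cmod z \<le> r \<longrightarrow> f z = outer z"
      using outer_on_circle by auto
  qed
  moreover have "{z. cmod z \<le> r} \<union> {z. r \<le> cmod z} = UNIV" by auto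
  ultimately show ?thesis unfolding \<Phi>_def[abs_def] by simp
qed

lemma cmod_dir: "z \<noteq> 0 \<Longrightarrow> cmod (dir z) = 1"
  by (simp add: dir_def norm_mult norm_sgn)

text \<open>
  The half-lines leave the compact image of the circle at unit speed.
\<close>
lemma \<Phi>_proper: assumes "bounded B" shows "bounded (\<Phi> -` B)"
proof -
  obtain K where K: "\<And>z. z \<in> f ` sphere 0 r \<Longrightarrow> cmod z \<le> K"
  proof -
    have "compact (f ` sphere 0 r)"
      by (intro compact_continuous_image continuous_on_subset[OF f_continuous]) (use r in auto)
    then have "bounded (f ` sphere 0 r)" by (rule compact_imp_bounded)
    then show thesis unfolding bounded_iff using that by blast
  qed
  obtain C where C: "\<And>z. z \<in> B \<Longrightarrow> cmod z \<le> C" using assms unfolding bounded_iff by blast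
  have "cmod z \<le> max r (C + K + r)" if "\<Phi> z \<in> B" for z
  proof (cases "cmod z \<le> r")
    case False
    then have nz: "z \<noteq> 0" and "outer z \<in> B" using that r by (auto simp: \<Phi>_def)
    then have "cmod (outer z) \<le> C" using C by blast
    moreover have "cmod (of_real (cmod z - r) * dir z) = cmod z - r"
      using cmod_dir[OF nz] False by (simp add: norm_mult del: of_real_diff)
    moreover have "cmod (f (of_real r * sgn z)) \<le> K" using K sgn_in(2)[OF nz] by blast
    moreover have "of_real (cmod z - r) * dir z = outer z - f (of_real r * sgn z)" by (simp add: outer_def)
    ultimately show ?thesis using norm_triangle_ineq4[of "outer z" "f (of_real r * sgn z)"] by simp
  qed simp
  then show ?thesis unfolding bounded_iff by blast
qed

lemma \<Phi>_bij: "bij \<Phi>"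
proof (rule proper_locally_injective_bij[OF \<Phi>_continuous])
  show "\<exists>e>0. inj_on \<Phi> (ball x e)" for x
    using \<Phi>_inj_inner[of x] \<Phi>_inj_outer[of x] by (cases "cmod x < r") auto
qed (rule \<Phi>_proper)

lemma f_inj: "inj_on f (cball 0 r)"
proof (rule inj_onI)
  fix x y assume "x \<in> cball 0 r" "y \<in> cball 0 r" "f x = f y"
  then have "\<Phi> x = \<Phi> y" by (simp add: \<Phi>_def)
  then show "x = y" using \<Phi>_bij by (simp add: bij_def inj_eq)
qed

text \<open>
  As \<Phi> is a bijection, a point outside the image of the disc lies on exactly one of the half-lines, and it takes
  its direction from there.
\<close>
lemma ex_exterior_half_lines: "\<exists>d. exterior_half_lines (f ` ball 0 r) (f ` sphere 0 r) d"
  unfolding exterior_half_lines_def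
proof (intro exI[of _ "\<lambda>p. dir (inv \<Phi> p)"] conjI allI impI)
  have inv: "\<Phi> (inv \<Phi> p) = p" for p using \<Phi>_bij by (simp add: bij_def surj_f_inv_f)
  have big: "cmod (inv \<Phi> p) \<ge> r" "inv \<Phi> p \<noteq> 0" "p = outer (inv \<Phi> p)" if "p \<notin> f ` ball 0 r" for p
  proof -
    show 1: "cmod (inv \<Phi> p) \<ge> r"
    proof (rule ccontr)
      assume "\<not> ?thesis"
      then have "p = f (inv \<Phi> p)" "inv \<Phi> p \<in> ball 0 r" using inv[of p] by (auto simp: \<Phi>_def)
      then show False using that by blast
    qed
    show "inv \<Phi> p \<noteq> 0" using 1 r by auto
    show "p = outer (inv \<Phi> p)" using inv[of p] 1 outer_on_circle[of "inv \<Phi> p"] by (auto simp: \<Phi>_def split: if_splits)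
  qed
  have shift: "p + of_real t * dir (inv \<Phi> p) = \<Phi> (of_real (cmod (inv \<Phi> p) + t) * sgn (inv \<Phi> p))
      \<and> cmod (of_real (cmod (inv \<Phi> p) + t) * sgn (inv \<Phi> p)) \<ge> r
      \<and> sgn (of_real (cmod (inv \<Phi> p) + t) * sgn (inv \<Phi> p)) = sgn (inv \<Phi> p)"
    if p: "p \<notin> f ` ball 0 r" and t: "t \<ge> 0" for p t
  proof -
    define z where "z = inv \<Phi> p"
    define w where "w = of_real (cmod z + t) * sgn z"
    have z: "cmod z \<ge> r" "z \<noteq> 0" "p = outer z" using big[OF p] by (auto simp: z_def)
    have cw: "cmod w = cmod z + t" using z(2) t by (simp add: w_def norm_mult norm_sgn del: of_real_add)
    have pos: "cmod z + t > 0" using z(2) t by (simp add: add_pos_nonneg)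
    have sw: "sgn w = sgn z"
      using pos by (simp only: sgn_mult w_def sgn_sgn sgn_of_real) simp
    have "outer w = p + of_real t * dir z" unfolding z(3) outer_def cw dir_def sw by (simp add: algebra_simps)
    moreover have "\<Phi> w = outer w" using cw z(1) t outer_on_circle[of w] by (auto simp: \<Phi>_def)
    ultimately show ?thesis using cw z(1) t sw unfolding w_def z_def by auto
  qed
  { fix p assume p: "p \<notin> f ` ball 0 r"
    show "cmod (dir (inv \<Phi> p)) = 1" using cmod_dir big(2)[OF p] by blast
    { fix t :: real assume t: "t \<ge> 0"
      define w where "w = of_real (cmod (inv \<Phi> p) + t) * sgn (inv \<Phi> p)"
      have w: "p + of_real t * dir (inv \<Phi> p) = \<Phi> w" "cmod w \<ge> r" using shift[OF p t] by (auto simp: w_def)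
      show "p + of_real t * dir (inv \<Phi> p) \<notin> f ` ball 0 r"
      proof
        assume "p + of_real t * dir (inv \<Phi> p) \<in> f ` ball 0 r"
        then obtain x where x: "x \<in> ball 0 r" "\<Phi> w = f x" unfolding w by blast
        then have "\<Phi> w = \<Phi> x" by (simp add: \<Phi>_def)
        then have "w = x" using \<Phi>_bij by (simp add: bij_def inj_eq)
        then show False using x w(2) by simp
      qed
    }
    show "\<exists>s\<ge>0. p - of_real s * dir (inv \<Phi> p) \<in> f ` sphere 0 r"
    proof (intro exI[of _ "cmod (inv \<Phi> p) - r"] conjI)
      show "cmod (inv \<Phi> p) - r \<ge> 0" using big(1)[OF p] by simp
      have "p - of_real (cmod (inv \<Phi> p) - r) * dir (inv \<Phi> p) = f (of_real r * sgn (inv \<Phi> p))"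
        using big(3)[OF p] unfolding outer_def by (metis add_diff_cancel_right')
      then show "p - of_real (cmod (inv \<Phi> p) - r) * dir (inv \<Phi> p) \<in> f ` sphere 0 r"
        using sgn_in(2)[OF big(2)[OF p]] by auto
    qed
  }
  fix p q :: complex and s t :: real
  assume a: "p \<notin> f ` ball 0 r" "q \<notin> f ` ball 0 r" "s \<ge> 0" "t \<ge> 0"
    "p + of_real s * dir (inv \<Phi> p) = q + of_real t * dir (inv \<Phi> q)"
  note sp = shift[OF a(1,3)] and sq = shift[OF a(2,4)]
  have "\<Phi> (of_real (cmod (inv \<Phi> p) + s) * sgn (inv \<Phi> p)) = \<Phi> (of_real (cmod (inv \<Phi> q) + t) * sgn (inv \<Phi> q))"
    unfolding conjunct1[OF sp, symmetric] conjunct1[OF sq, symmetric] by (rule a(5))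
  then have "of_real (cmod (inv \<Phi> p) + s) * sgn (inv \<Phi> p) = of_real (cmod (inv \<Phi> q) + t) * sgn (inv \<Phi> q)"
    by (rule injD[OF bij_is_inj[OF \<Phi>_bij]])
  from arg_cong[OF this, of sgn] have "sgn (inv \<Phi> p) = sgn (inv \<Phi> q)"
    unfolding conjunct2[OF conjunct2[OF sp]] conjunct2[OF conjunct2[OF sq]] .
  then show "dir (inv \<Phi> p) = dir (inv \<Phi> q)"
    unfolding dir_def by (rule arg_cong[where f="\<lambda>s. s * cis (2 / 3 * \<nu> (of_real r * s) + c)"])
qed

end

section \<open>Univalence and close-to-convexity\<close>

lemma M_pair_exterior_half_lines:
  assumes M: "M_pair \<alpha> h g" and \<alpha>: "cmod \<alpha> \<le> 1" and r: "0 < r" "r < 1"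
    and f: "\<And>z. z \<in> unit_disc \<Longrightarrow> f z = h z + cnj (g z)"
  shows "inj_on f (cball 0 r)"
    "\<exists>d. exterior_half_lines (f ` ball 0 r) (f ` sphere 0 r) d"
proof -
  have "deriv h holomorphic_on unit_disc" "\<And>z. z \<in> unit_disc \<Longrightarrow> deriv h z \<noteq> 0"
    using M unfolding M_pair_def by (auto intro: holomorphic_deriv)
  then obtain L where L: "L holomorphic_on unit_disc" "\<And>z. z \<in> unit_disc \<Longrightarrow> deriv h z = exp (L z)"
    using contractible_imp_holomorphic_log[OF _ convex_imp_contractible[OF convex_ball]] by metis
  interpret C: M_circle \<alpha> h g L r
    by unfold_locales (use M \<alpha> r L in auto)
  obtain c where c: "\<And>\<theta>. \<bar>C.\<nu> (C.b \<theta>) / 3 - c\<bar> < pi / 2" using C.ex_centre by blast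
  interpret R: M_rays \<alpha> h g L r c by unfold_locales (rule c)
  have eq: "f z = C.f z" if "z \<in> cball 0 r" for z
    using that by (simp add: C.f_def f le_less_trans[OF _ r(2)])
  have im: "f ` ball 0 r = C.f ` ball 0 r" "f ` sphere 0 r = C.f ` sphere 0 r"
    using eq by (auto intro!: image_cong)
  show "inj_on f (cball 0 r)" using R.f_inj inj_on_cong[of "cball 0 r" f C.f] eq by blast
  show "\<exists>d. exterior_half_lines (f ` ball 0 r) (f ` sphere 0 r) d"
    unfolding im by (rule R.ex_exterior_half_lines)
qed

lemma M_pair_inj:
  assumes M: "M_pair \<alpha> h g" and \<alpha>: "cmod \<alpha> \<le> 1"
    and f: "\<And>z. z \<in> unit_disc \<Longrightarrow> f z = h z + cnj (g z)"
  shows "inj_on f unit_disc"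
proof (rule inj_onI)
  fix x y assume xy: "x \<in> unit_disc" "y \<in> unit_disc" "f x = f y"
  then have "max (cmod x) (cmod y) < 1" by simp
  then obtain r where r: "max (cmod x) (cmod y) < r" "r < 1" using dense by blast
  then have "0 < r" using norm_ge_zero[of x] by linarith
  then have "inj_on f (cball 0 r)" using M_pair_exterior_half_lines(1)[OF M \<alpha> _ _ f] r by blast
  then show "x = y" using xy r by (auto dest: inj_onD)
qed

lemma M_pair_sense_preserving:
  assumes M: "M_pair \<alpha> h g" and \<alpha>: "cmod \<alpha> \<le> 1" and z: "z \<in> unit_disc"
  shows "(cmod (deriv h z))\<^sup>2 - (cmod (deriv g z))\<^sup>2 > 0"
proof -
  have h: "deriv h z \<noteq> 0" and g: "deriv g z = \<alpha> * z * deriv h z" using M z unfolding M_pair_def by auto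
  have "cmod \<alpha> * cmod z \<le> 1 * cmod z" by (intro mult_right_mono \<alpha>) auto
  then have "cmod (\<alpha> * z) < 1" using z by (simp add: norm_mult)
  then have "cmod (deriv g z) < cmod (deriv h z)" unfolding g norm_mult[of "\<alpha> * z"] using h by simp
  then have "(cmod (deriv g z))\<^sup>2 < (cmod (deriv h z))\<^sup>2" by (intro power_strict_mono) auto
  then show ?thesis by simp
qed

lemma disc_exhaustion:
  defines "\<rho> \<equiv> \<lambda>n. 1 - 1 / (real n + 2)"
  shows "0 < \<rho> n" "\<rho> n < 1" "m \<le> n \<Longrightarrow> \<rho> m \<le> \<rho> n" "(\<Union>n. ball 0 (\<rho> n)) = unit_disc" "\<rho> \<longlonglongrightarrow> 1"
proof -
  show \<rho>: "0 < \<rho> n" "\<rho> n < 1" for n by (auto simp: \<rho>_def field_simps)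
  show "m \<le> n \<Longrightarrow> \<rho> m \<le> \<rho> n" by (auto simp: \<rho>_def field_simps)
  have "(\<lambda>n. inverse (real (Suc (Suc n)))) \<longlonglongrightarrow> 0" by (rule LIMSEQ_Suc[OF LIMSEQ_inverse_real_of_nat])
  moreover have "inverse (real (Suc (Suc n))) = 1 / (real n + 2)" for n by (simp add: inverse_eq_divide)
  ultimately have "(\<lambda>n. 1 / (real n + 2)) \<longlonglongrightarrow> 0" by (simp only:)
  then have lim: "\<rho> \<longlonglongrightarrow> 1 - 0" unfolding \<rho>_def by (intro tendsto_diff tendsto_const)
  then show "\<rho> \<longlonglongrightarrow> 1" by simp
  show "(\<Union>n. ball 0 (\<rho> n)) = unit_disc"
  proof (intro equalityI subsetI)
    fix x :: complex assume "x \<in> unit_disc"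
    then have "eventually (\<lambda>n. cmod x < \<rho> n) sequentially" using lim by (intro order_tendstoD(1)) auto
    then show "x \<in> (\<Union>n. ball 0 (\<rho> n))" by (auto simp: eventually_sequentially)
  qed (use \<rho>(2) in \<open>auto intro: less_trans\<close>)
qed

text \<open>
  The limit of the half-lines outside the images of the discs of radius \<rho> n.
\<close>
lemma M_pair_close_to_convex:
  assumes M: "M_pair \<alpha> h g" and \<alpha>: "cmod \<alpha> \<le> 1"
    and f: "\<And>z. z \<in> unit_disc \<Longrightarrow> f z = h z + cnj (g z)"
  shows "close_to_convex_domain (f ` unit_disc)"
proof -
  have hol: "open unit_disc" "h holomorphic_on unit_disc" "g holomorphic_on unit_disc"
    using M unfolding M_pair_def by auto
  have cont: "continuous_on unit_disc f" by (rule continuous_on_add_cnj[OF hol f])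
  have inj: "inj_on f unit_disc" by (rule M_pair_inj[OF M \<alpha> f])
  define \<rho> where "\<rho> = (\<lambda>n. 1 - 1 / (real n + 2))"
  have \<rho>: "0 < \<rho> n" "\<rho> n < 1" for n using disc_exhaustion(1,2) by (simp_all add: \<rho>_def)
  have mono: "\<rho> m \<le> \<rho> n" if "m \<le> n" for m n using disc_exhaustion(3)[OF that] by (simp add: \<rho>_def)
  have sub: "ball 0 (\<rho> n) \<subseteq> unit_disc" "sphere 0 (\<rho> n) \<subseteq> unit_disc" for n using \<rho>[of n] by auto
  have "\<forall>n. \<exists>d. exterior_half_lines (f ` ball 0 (\<rho> n)) (f ` sphere 0 (\<rho> n)) d"
    using M_pair_exterior_half_lines(2)[OF M \<alpha> \<rho> f] by blast
  from choice[OF this] obtain d where D: "\<And>n. exterior_half_lines (f ` ball 0 (\<rho> n)) (f ` sphere 0 (\<rho> n)) (d n)"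
    by blast
  have d: "p \<notin> f ` ball 0 (\<rho> n) \<Longrightarrow> cmod (d n p) = 1"
      "p \<notin> f ` ball 0 (\<rho> n) \<Longrightarrow> t \<ge> 0 \<Longrightarrow> p + of_real t * d n p \<notin> f ` ball 0 (\<rho> n)"
      "p \<notin> f ` ball 0 (\<rho> n) \<Longrightarrow> \<exists>s\<ge>0. p - of_real s * d n p \<in> f ` sphere 0 (\<rho> n)"
      "p \<notin> f ` ball 0 (\<rho> n) \<Longrightarrow> q \<notin> f ` ball 0 (\<rho> n) \<Longrightarrow> s \<ge> 0 \<Longrightarrow> t \<ge> 0 \<Longrightarrow>
        p + of_real s * d n p = q + of_real t * d n q \<Longrightarrow> d n p = d n q" for n p q s t
    using D[of n] unfolding exterior_half_lines_def by simp_all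
  have out: "p \<notin> f ` ball 0 (\<rho> n)" if "p \<notin> f ` unit_disc" for p n using that sub(1)[of n] by blast
  show ?thesis
  proof (rule limit_of_noncrossing_half_lines[where E="\<lambda>n. f ` ball 0 (\<rho> n)" and d=d])
    show "open (f ` unit_disc)" by (rule invariance_of_domain[OF cont hol(1) inj])
    show "connected (f ` unit_disc)" using cont by (intro connected_continuous_image) auto
    show "f ` unit_disc \<noteq> {}" by auto
    show "open (f ` ball 0 (\<rho> n))" for n
      by (rule invariance_of_domain[OF continuous_on_subset[OF cont sub(1)] open_ball inj_on_subset[OF inj sub(1)]])
    show "f ` ball 0 (\<rho> m) \<subseteq> f ` ball 0 (\<rho> n)" if "m \<le> n" for m n
      by (intro image_mono subset_ball mono that)
    show "(\<Union>n. f ` ball 0 (\<rho> n)) = f ` unit_disc"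
      unfolding image_UN[symmetric] \<rho>_def disc_exhaustion(4) ..
    fix n p assume p: "p \<notin> f ` unit_disc"
    show "cmod (d n p) = 1" using d(1) out[OF p] by blast
    show "p + of_real t * d n p \<notin> f ` ball 0 (\<rho> n)" if "t \<ge> 0" for t using d(2) out[OF p] that by blast
    show "\<exists>s\<ge>0. p - of_real s * d n p \<in> f ` unit_disc" using d(3)[OF out[OF p]] sub(2)[of n] by blast
    show "d n p = d n q" if "q \<notin> f ` unit_disc" "s \<ge> 0" "t \<ge> 0"
       "p + of_real s * d n p = q + of_real t * d n q" for q s t
      using d(4)[OF out[OF p] out[OF that(1)] that(2-4)] .
  qed
qed

lemma class_M_subset_class_CH0:
  assumes \<alpha>: "cmod \<alpha> \<le> 1"
  shows "class_M \<alpha> \<subseteq> class_CH0"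
proof
  fix f assume f: "f \<in> class_M \<alpha>"
  then obtain h g where hg: "M_pair \<alpha> h g" "\<And>z. z \<in> unit_disc \<Longrightarrow> f z = h z + cnj (g z)"
    using class_M_imp_M_pair by blast
  have hol: "open unit_disc" "h holomorphic_on unit_disc" "g holomorphic_on unit_disc" "deriv g 0 = 0"
    using hg(1) unfolding M_pair_def by auto
  have "f \<in> class_H" using f unfolding class_M_def by blast
  moreover have "inj_on f unit_disc" by (rule M_pair_inj[OF hg(1) \<alpha> hg(2)])
  moreover have "sense_preserving_on f unit_disc"
    unfolding sense_preserving_on_def
    using M_pair_sense_preserving[OF hg(1) \<alpha>] wirtinger_add_cnj[OF hol(1-3) hg(2)] by simp
  moreover have "wirtinger_zbar f 0 = 0"
    using wirtinger_add_cnj(2)[OF hol(1-3) hg(2), of 0] hol(4) by simp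
  moreover have "close_to_convex_domain (f ` unit_disc)" by (rule M_pair_close_to_convex[OF hg(1) \<alpha> hg(2)])
  ultimately show "f \<in> class_CH0" unfolding class_CH0_def by blast
qed

section \<open>Coefficient bounds\<close>

lemma power_series_coeff:
  assumes "has_power_series f a"
  shows "a n = (deriv ^^ n) f 0 / fact n"
proof -
  have s: "(\<lambda>n. a n * z ^ n) sums f z" if "z \<in> unit_disc" for z
    using assms that unfolding has_power_series_def by blast
  have "summable (\<lambda>n. a n * (1/2) ^ n)" using s[of "1/2"] by (simp add: sums_iff)
  then have "conv_radius a \<ge> norm (1/2 :: complex)" by (rule conv_radius_geI)
  moreover have "ereal (norm (1/2 :: complex)) > 0" by simp
  ultimately have "conv_radius a > 0" by (rule less_le_trans[rotated])
  then have "fps_conv_radius (Abs_fps a) > 0"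
    unfolding fps_conv_radius_def by simp
  moreover have "eventually (\<lambda>z. eval_fps (Abs_fps a) z = f z) (nhds 0)"
  proof (rule eventually_mono[OF eventually_nhds_in_open[of unit_disc]])
    show "eval_fps (Abs_fps a) z = f z" if "z \<in> unit_disc" for z
      using s[OF that] by (simp add: eval_fps_def sums_iff)
  qed auto
  ultimately have "f has_fps_expansion Abs_fps a" unfolding has_fps_expansion_def by blast
  from fps_nth_fps_expansion[OF this, of n] show ?thesis by simp
qed

lemma circle_integral:
  assumes "(F has_contour_integral I) (circlepath 0 r)"
  shows "((\<lambda>x. F (of_real r * cis (2 * pi * x)) * (2 * of_real pi * \<i> * (of_real r * cis (2 * pi * x)))) has_integral I) {0..1}"
proof -
  have "((\<lambda>x. F (circlepath 0 r x) * vector_derivative (circlepath 0 r) (at x within {0..1})) has_integral I) {0..1}"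
    using assms unfolding has_contour_integral_def .
  then show ?thesis
  proof (rule has_integral_eq[rotated])
    fix x :: real assume x: "x \<in> {0..1}"
    have e: "cis (2 * pi * x) = exp (2 * of_real pi * \<i> * of_real x)"
      by (simp add: cis_conv_exp mult_ac)
    have v: "vector_derivative (circlepath 0 r) (at x within {0..1}) = 2 * pi * \<i> * r * exp (2 * of_real pi * \<i> * x)"
      using x by (intro vector_derivative_circlepath01) auto
    show "F (circlepath 0 r x) * vector_derivative (circlepath 0 r) (at x within {0..1})
      = F (of_real r * cis (2 * pi * x)) * (2 * of_real pi * \<i> * (of_real r * cis (2 * pi * x)))"
      unfolding e v by (simp add: circlepath)
  qed
qed

text \<open>
  Let P = 1 + z K and m = n + 1, so that k = (deriv ^^ n) K 0 / n! is the coefficient of z^m in P. On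
  |z| = r the mean of P z^m is zero, and so is the mean of its conjugate. Hence k r^(2m) is the mean of
  2 Re P cnj z^m, whose modulus is at most r^m times the mean of 2 Re P, that is 2 r^m.
\<close>
lemma Caratheodory_coeff_bound:
  fixes K :: "complex \<Rightarrow> complex"
  assumes K: "K holomorphic_on unit_disc" and pos: "\<And>z. z \<in> unit_disc \<Longrightarrow> Re (1 + z * K z) \<ge> 0"
  shows "cmod ((deriv ^^ n) K 0 / fact n) \<le> 2"
proof -
  define k where "k = (deriv ^^ n) K 0 / fact n"
  define m where "m = Suc n"
  define P where "P = (\<lambda>z. 1 + z * K z)"
  have P: "P holomorphic_on unit_disc" unfolding P_def using K by (intro holomorphic_intros)
  have bound: "cmod k * r ^ m \<le> 2" if r: "0 < r" "r < 1" for r :: real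
  proof -
    define c where "c = (\<lambda>x. of_real r * cis (2 * pi * x))"
    have cr: "cmod (c x) = r" "c x \<noteq> 0" for x using r by (auto simp: c_def norm_mult)
    have sub: "cball 0 r \<subseteq> unit_disc" "ball 0 r \<subseteq> unit_disc" using r by auto
    have cauchy: "((\<lambda>x. F (c x) / c x ^ Suc j * (2 * of_real pi * \<i> * c x)) has_integral 2 * of_real pi * \<i> * ((deriv ^^ j) F 0 / fact j)) {0..1}"
      if F: "F holomorphic_on unit_disc" for F j
    proof -
      have "((\<lambda>u. F u / (u-0) ^ (Suc j)) has_contour_integral ((2 * pi * \<i>) / (fact j) * (deriv ^^ j) F 0)) (circlepath 0 r)"
        by (rule Cauchy_has_contour_integral_higher_derivative_circlepath)
           (use F sub r in \<open>auto intro: holomorphic_on_subset holomorphic_on_imp_continuous_on\<close>)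
      from circle_integral[OF this] show ?thesis by (simp add: c_def mult_ac)
    qed
    have scale: "((\<lambda>x. f x) has_integral I) {0..1}"
      if "((\<lambda>x. (2 * of_real pi * \<i>) * f x) has_integral (2 * of_real pi * \<i>) * I) {0..1}" for f :: "real \<Rightarrow> complex" and I
      using has_integral_mult_right[OF that, of "1 / (2 * of_real pi * \<i>)"] by simp
    have I1: "((\<lambda>x. P (c x) / c x ^ m) has_integral k) {0..1}"
    proof (rule scale)
      have "((\<lambda>x. K (c x) / c x ^ Suc n * (2 * of_real pi * \<i> * c x) + 1 / c x ^ Suc m * (2 * of_real pi * \<i> * c x))
          has_integral 2 * of_real pi * \<i> * ((deriv ^^ n) K 0 / fact n) + 2 * of_real pi * \<i> * ((deriv ^^ m) (\<lambda>_. 1) 0 / fact m)) {0..1}"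
        by (intro has_integral_add cauchy K cauchy[of "\<lambda>_. 1"] holomorphic_on_const)
      then have "((\<lambda>x. K (c x) / c x ^ Suc n * (2 * of_real pi * \<i> * c x) + 1 / c x ^ Suc m * (2 * of_real pi * \<i> * c x))
          has_integral (2 * of_real pi * \<i>) * k) {0..1}" by (simp add: k_def m_def)
      moreover have "K w / w ^ Suc n * (2 * of_real pi * \<i> * w) + 1 / w ^ Suc m * (2 * of_real pi * \<i> * w)
           = (2 * of_real pi * \<i>) * (P w / w ^ m)" if "w \<noteq> 0" for w
        using that by (simp add: P_def m_def field_simps)
      ultimately show "((\<lambda>x. (2 * of_real pi * \<i>) * (P (c x) / c x ^ m)) has_integral (2 * of_real pi * \<i>) * k) {0..1}"
        using cr(2) by simp
    qed
    have I0: "((\<lambda>x. P (c x)) has_integral 1) {0..1}"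
    proof (rule scale)
      have "((\<lambda>x. P (c x) / c x ^ Suc 0 * (2 * of_real pi * \<i> * c x)) has_integral 2 * of_real pi * \<i> * (P 0)) {0..1}"
        using cauchy[OF P, of 0] by simp
      moreover have "P 0 = 1" by (simp add: P_def)
      moreover have "P w / w ^ Suc 0 * (2 * of_real pi * \<i> * w) = (2 * of_real pi * \<i>) * P w" if "w \<noteq> 0" for w
        using that by simp
      ultimately show "((\<lambda>x. (2 * of_real pi * \<i>) * P (c x)) has_integral (2 * of_real pi * \<i>) * 1) {0..1}"
        using cr(2) by (simp add: mult_ac)
    qed
    have I2: "((\<lambda>x. P (c x) * c x ^ m) has_integral 0) {0..1}"
    proof (rule scale)
      have "((\<lambda>x. (P (c x) * c x ^ m) / c x ^ Suc 0 * (2 * of_real pi * \<i> * c x)) has_integral 2 * of_real pi * \<i> * (P 0 * 0 ^ m)) {0..1}"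
        using cauchy[of "\<lambda>w. P w * w ^ m" 0] P by (simp add: holomorphic_on_mult holomorphic_on_power holomorphic_on_ident)
      moreover have "(P w * w ^ m) / w ^ Suc 0 * (2 * of_real pi * \<i> * w) = (2 * of_real pi * \<i>) * (P w * w ^ m)" if "w \<noteq> 0" for w
        using that by simp
      ultimately show "((\<lambda>x. (2 * of_real pi * \<i>) * (P (c x) * c x ^ m)) has_integral (2 * of_real pi * \<i>) * 0) {0..1}"
        using cr(2) by (simp add: m_def mult_ac)
    qed
    have I3: "((\<lambda>x. cnj (P (c x)) * cnj (c x) ^ m) has_integral 0) {0..1}"
      using has_integral_linear[OF I2 bounded_linear_cnj] by (simp add: o_def)
    have inv: "P (c x) / c x ^ m * of_real (r ^ (2 * m)) = P (c x) * cnj (c x) ^ m" for x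
    proof -
      have "c x * cnj (c x) = of_real (r ^ 2)" using complex_norm_square[of "c x"] cr(1)[of x] by simp
      then have "of_real (r ^ (2 * m)) = c x ^ m * cnj (c x) ^ m"
        by (simp add: power_mult_distrib[symmetric] power_mult)
      then show ?thesis using cr(2)[of x] by simp
    qed
    have "((\<lambda>x. P (c x) / c x ^ m * of_real (r ^ (2 * m)) + cnj (P (c x)) * cnj (c x) ^ m) has_integral k * of_real (r ^ (2 * m)) + 0) {0..1}"
      by (intro has_integral_add has_integral_mult_left I1 I3)
    moreover have "P w * cnj w ^ m + cnj (P w) * cnj w ^ m = of_real (2 * Re (P w)) * cnj w ^ m" for w
      by (simp only: distrib_right[symmetric] complex_add_cnj)
    ultimately have I4: "((\<lambda>x. of_real (2 * Re (P (c x))) * cnj (c x) ^ m) has_integral k * of_real (r ^ (2 * m))) {0..1}"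
      unfolding inv by simp
    have I5: "((\<lambda>x. 2 * Re (P (c x)) * r ^ m) has_integral 2 * 1 * r ^ m) {0..1}"
      using has_integral_mult_left[OF has_integral_mult_right[OF has_integral_linear[OF I0 bounded_linear_Re], of 2], of "r ^ m"]
      by (simp add: o_def)
    have "cmod (k * of_real (r ^ (2 * m))) \<le> 2 * 1 * r ^ m"
    proof -
      have "cmod (integral {0..1} (\<lambda>x. of_real (2 * Re (P (c x))) * cnj (c x) ^ m)) \<le> integral {0..1} (\<lambda>x. 2 * Re (P (c x)) * r ^ m)"
      proof (rule integral_norm_bound_integral)
        fix x
        have "Re (P (c x)) \<ge> 0" using pos[of "c x"] cr(1)[of x] r by (simp add: P_def)
        then show "cmod (of_real (2 * Re (P (c x))) * cnj (c x) ^ m) \<le> 2 * Re (P (c x)) * r ^ m"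
          by (simp add: norm_mult norm_power cr(1))
      qed (use I4 I5 in \<open>auto simp: integrable_on_def\<close>)
      then show ?thesis unfolding integral_unique[OF I4] integral_unique[OF I5] .
    qed
    then have "(cmod k * r ^ m) * r ^ m \<le> 2 * r ^ m"
      using r by (simp add: norm_mult norm_power power_mult power2_eq_square power_mult_distrib mult_ac)
    then show ?thesis using r by simp
  qed
  have "((\<lambda>r. cmod k * r ^ m) \<longlongrightarrow> cmod k * 1 ^ m) (at_left 1)"
    by (intro tendsto_intros)
  moreover have "eventually (\<lambda>r. cmod k * r ^ m \<le> 2) (at_left (1::real))"
    using eventually_at_left_field[of _ "1::real"] bound by (metis (mono_tags, lifting) zero_less_one)
  ultimately have "cmod k * 1 ^ m \<le> 2" by (intro tendsto_upperbound) auto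
  then show ?thesis by (simp add: k_def)
qed

lemma sum_triangular: "(\<Sum>j\<le>n. (real j + 1) * (real j + 2) / 2) = (real n + 1) * (real n + 2) * (real n + 3) / 6"
  by (induction n) (simp_all add: field_simps)

lemma higher_deriv_mult_ident:
  assumes "k holomorphic_on unit_disc"
  shows "(deriv ^^ n) (\<lambda>z. \<alpha> * z * k z) 0 = \<alpha> * (of_nat n * (deriv ^^ (n - 1)) k 0)"
proof -
  have lin: "(\<lambda>z. z * k z) holomorphic_on unit_disc" using assms by (intro holomorphic_intros)
  have "(deriv ^^ n) (\<lambda>z. z * k z) 0
      = (\<Sum>i = 0..n. of_nat (n choose i) * (deriv ^^ i) (\<lambda>w. w) 0 * (deriv ^^ (n - i)) k 0)"
    using assms by (intro higher_deriv_mult[of _ unit_disc]) auto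
  also have "\<dots> = (\<Sum>i = 0..n. if i = 1 then of_nat n * (deriv ^^ (n - 1)) k 0 else 0)"
    by (intro sum.cong) auto
  also have "\<dots> = of_nat n * (deriv ^^ (n - 1)) k 0" by (cases n) (auto simp: sum.delta)
  finally have 1: "(deriv ^^ n) (\<lambda>z. z * k z) 0 = of_nat n * (deriv ^^ (n - 1)) k 0" .
  have "(deriv ^^ n) (\<lambda>z. \<alpha> * (z * k z)) 0 = \<alpha> * (deriv ^^ n) (\<lambda>z. z * k z) 0"
    by (rule higher_deriv_cmult[OF lin]) auto
  then show ?thesis using 1 by (simp add: mult.assoc)
qed

lemma M_pair_log:
  assumes M: "M_pair \<alpha> h g"
  obtains l where "l holomorphic_on unit_disc" "\<And>z. z \<in> unit_disc \<Longrightarrow> deriv (deriv h) z = l z * deriv h z"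
    "\<And>z. z \<in> unit_disc \<Longrightarrow> Re (z * l z) > - 3 / 2"
proof (rule that[of "\<lambda>z. deriv (deriv h) z / deriv h z"])
  have h: "h holomorphic_on unit_disc" "\<And>z. z \<in> unit_disc \<Longrightarrow> deriv h z \<noteq> 0"
    using M unfolding M_pair_def by auto
  show "(\<lambda>z. deriv (deriv h) z / deriv h z) holomorphic_on unit_disc"
    using h by (intro holomorphic_on_divide holomorphic_deriv) auto
  fix z assume z: "z \<in> unit_disc"
  show "deriv (deriv h) z = deriv (deriv h) z / deriv h z * deriv h z" using h(2)[OF z] by simp
  have "Re (1 + z * deriv (deriv h) z / deriv h z) > - 1 / 2" using M z unfolding M_pair_def by blast
  then show "Re (z * (deriv (deriv h) z / deriv h z)) > - 3 / 2" by simp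
qed

text \<open>
  Comparing coefficients in h'' = l h' gives (n + 1) c (n + 1) = \<Sum> e i c (n - i), and Caratheodory's bound for
  1 + (2/3) z l gives |e i| \<le> 3. The majorant solves this recursion with equality; it consists of the
  coefficients of (1 - z)^(-3).
\<close>
lemma M_pair_deriv_coeff_bound:
  assumes M: "M_pair \<alpha> h g"
  shows "cmod ((deriv ^^ n) (deriv h) 0 / fact n) \<le> (real n + 1) * (real n + 2) / 2"
proof -
  define c where "c = (\<lambda>n. (deriv ^^ n) (deriv h) 0 / fact n)"
  have h: "h holomorphic_on unit_disc" "deriv h 0 = 1" using M unfolding M_pair_def by auto
  have h1: "deriv h holomorphic_on unit_disc" using h(1) by (rule holomorphic_deriv) auto
  obtain l where l: "l holomorphic_on unit_disc" "\<And>z. z \<in> unit_disc \<Longrightarrow> deriv (deriv h) z = l z * deriv h z"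
    "\<And>z. z \<in> unit_disc \<Longrightarrow> Re (z * l z) > - 3 / 2" using M_pair_log[OF M] by blast
  define e where "e = (\<lambda>n. (deriv ^^ n) l 0 / fact n)"
  have Re_aff: "Re (of_real p + of_real q * w) = p + q * Re w" for p q w by simp
  have e3: "cmod (e n) \<le> 3" for n
  proof -
    have "cmod ((deriv ^^ n) (\<lambda>z. 2 / 3 * l z) 0 / fact n) \<le> 2"
    proof (rule Caratheodory_coeff_bound)
      show "(\<lambda>z. 2 / 3 * l z) holomorphic_on unit_disc" using l(1) by (intro holomorphic_intros)
      fix z assume "z \<in> unit_disc"
      have "1 + z * (2 / 3 * l z) = of_real 1 + of_real (2 / 3) * (z * l z)" by simp
      then have "Re (1 + z * (2 / 3 * l z)) = 1 + 2 / 3 * Re (z * l z)"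
        unfolding Re_aff[symmetric] by (simp only:)
      then show "Re (1 + z * (2 / 3 * l z)) \<ge> 0" using l(3)[OF \<open>z \<in> unit_disc\<close>] by linarith
    qed
    moreover have "(deriv ^^ n) (\<lambda>z. 2 / 3 * l z) 0 = 2 / 3 * (deriv ^^ n) l 0"
      by (rule higher_deriv_cmult[OF l(1)]) auto
    ultimately have "cmod (2 / 3 * e n) \<le> 2" by (simp only: e_def times_divide_eq_right)
    then show ?thesis by (simp add: norm_mult norm_divide)
  qed
  have rec: "of_nat (Suc n) * c (Suc n) = (\<Sum>i\<le>n. e i * c (n - i))" for n
  proof -
    have "(deriv ^^ Suc n) (deriv h) 0 = (deriv ^^ n) (deriv (deriv h)) 0" by (simp add: funpow_swap1)
    also have "\<dots> = (deriv ^^ n) (\<lambda>z. l z * deriv h z) 0"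
      by (rule higher_deriv_transform_within_open[of _ unit_disc])
         (use l h1 in \<open>auto intro!: holomorphic_intros holomorphic_deriv\<close>)
    also have "\<dots> = (\<Sum>i = 0..n. of_nat (n choose i) * (deriv ^^ i) l 0 * (deriv ^^ (n - i)) (deriv h) 0)"
      by (rule higher_deriv_mult[OF l(1) h1]) auto
    also have "\<dots> = (\<Sum>i\<le>n. fact n * (e i * c (n - i)))"
      unfolding atLeast0AtMost
    proof (rule sum.cong)
      fix i assume "i \<in> {..n}"
      then have "of_nat (n choose i) = (fact n / (fact i * fact (n - i)) :: complex)"
        by (simp add: binomial_fact)
      then show "of_nat (n choose i) * (deriv ^^ i) l 0 * (deriv ^^ (n - i)) (deriv h) 0 = fact n * (e i * c (n - i))"
        by (simp add: e_def c_def)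
    qed simp
    also have "\<dots> = fact n * (\<Sum>i\<le>n. e i * c (n - i))" by (simp add: sum_distrib_left)
    finally have D: "(deriv ^^ Suc n) (deriv h) 0 = fact n * (\<Sum>i\<le>n. e i * c (n - i))" .
    have "of_nat (Suc n) * c (Suc n) = (deriv ^^ Suc n) (deriv h) 0 / fact n"
      unfolding c_def fact_Suc[of n] of_nat_mult by (simp del: of_nat_Suc funpow.simps)
    then show ?thesis unfolding D by simp
  qed
  have "cmod (c n) \<le> (real n + 1) * (real n + 2) / 2"
  proof (induction n rule: less_induct)
    case (less n)
    show ?case
    proof (cases n)
      case 0
      then show ?thesis by (simp add: c_def h(2))
    next
      case (Suc m)
      have "real (Suc m) * cmod (c (Suc m)) = cmod (\<Sum>i\<le>m. e i * c (m - i))"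
        using arg_cong[OF rec[of m], of cmod] by (simp only: norm_mult norm_of_nat)
      also have "\<dots> \<le> (\<Sum>i\<le>m. cmod (e i * c (m - i)))" by (rule norm_sum)
      also have "\<dots> \<le> (\<Sum>i\<le>m. 3 * ((real (m - i) + 1) * (real (m - i) + 2) / 2))"
      proof (rule sum_mono)
        fix i assume "i \<in> {..m}"
        then have "cmod (c (m - i)) \<le> (real (m - i) + 1) * (real (m - i) + 2) / 2"
            by (intro less.IH) (use Suc in auto)
        then show "cmod (e i * c (m - i)) \<le> 3 * ((real (m - i) + 1) * (real (m - i) + 2) / 2)"
          unfolding norm_mult by (intro mult_mono e3) auto
      qed
      also have "\<dots> = 3 * (\<Sum>i\<le>m. (real (m - i) + 1) * (real (m - i) + 2) / 2)" by (simp only: sum_distrib_left)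
      also have "(\<Sum>i\<le>m. (real (m - i) + 1) * (real (m - i) + 2) / 2) = (\<Sum>i\<le>m. (real i + 1) * (real i + 2) / 2)"
        by (rule sum.reindex_bij_witness[of _ "\<lambda>i. m - i" "\<lambda>i. m - i"]) auto
      also have "\<dots> = (real m + 1) * (real m + 2) * (real m + 3) / 6" by (rule sum_triangular)
      finally have "real (Suc m) * cmod (c (Suc m)) \<le> real (Suc m) * ((real m + 2) * (real m + 3) / 2)"
        by (simp add: field_simps)
      then have "cmod (c (Suc m)) \<le> (real m + 2) * (real m + 3) / 2" by (simp only: mult_le_cancel_left_pos of_nat_0_less_iff zero_less_Suc)
      then show ?thesis using Suc by (simp add: algebra_simps)
    qed
  qed
  then show ?thesis by (simp add: c_def)
qed

text \<open>
  The coefficients come from those of h' by integrating h' and \<alpha> z h'.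
\<close>
lemma M_pair_coeffs:
  assumes M: "M_pair \<alpha> h g" and a: "has_power_series h a" and b: "has_power_series g b"
  shows "b 1 = deriv g 0" "deriv g 0 = 0" "a 0 = 0" "b 0 = 0"
    "n \<ge> 1 \<Longrightarrow> cmod (a n) \<le> (real n + 1) / 2" "n \<ge> 1 \<Longrightarrow> cmod (b n) \<le> (real n - 1) / 2 * cmod \<alpha>"
proof -
  have hg: "h holomorphic_on unit_disc" "g holomorphic_on unit_disc" "h 0 = 0" "g 0 = 0"
    and g': "\<And>z. z \<in> unit_disc \<Longrightarrow> deriv g z = \<alpha> * z * deriv h z" using M unfolding M_pair_def by auto
  have h1: "deriv h holomorphic_on unit_disc" using hg(1) by (rule holomorphic_deriv) auto
  note ca = power_series_coeff[OF a] and cb = power_series_coeff[OF b]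
  show "a 0 = 0" "b 0 = 0" using ca[of 0] cb[of 0] hg by auto
  show b1: "b 1 = deriv g 0" using cb[of 1] by simp
  show g0: "deriv g 0 = 0" using g'[of 0] by simp
  have ac: "a (Suc m) = (deriv ^^ m) (deriv h) 0 / fact m / of_nat (Suc m)" for m
    unfolding ca[of "Suc m"] by (simp add: funpow_swap1)
  show an: "cmod (a n) \<le> (real n + 1) / 2" if n1: "n \<ge> 1" for n
  proof -
    obtain m where m: "n = Suc m" using n1 by (cases n) auto
    have "cmod (a n) = cmod ((deriv ^^ m) (deriv h) 0 / fact m) / real (Suc m)"
      unfolding m ac by (simp only: norm_divide norm_of_nat)
    also have "\<dots> \<le> ((real m + 1) * (real m + 2) / 2) / real (Suc m)"
      by (rule divide_right_mono[OF M_pair_deriv_coeff_bound[OF M]]) simp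
    also have "\<dots> = (real n + 1) / 2" by (simp add: m field_simps)
    finally show ?thesis .
  qed
  show "cmod (b n) \<le> (real n - 1) / 2 * cmod \<alpha>" if n1: "n \<ge> 1"
  proof (cases "n = 1")
    case True then show ?thesis using b1 g0 by simp
  next
    case False
    then obtain m where m: "n = Suc (Suc m)" using n1 by (metis One_nat_def Suc_le_D not0_implies_Suc)
    have "(deriv ^^ n) g 0 = (deriv ^^ Suc m) (deriv g) 0" unfolding m by (simp add: funpow_swap1)
    also have "\<dots> = (deriv ^^ Suc m) (\<lambda>z. \<alpha> * z * deriv h z) 0"
      by (rule higher_deriv_transform_within_open[of _ unit_disc])
         (use g' h1 hg in \<open>auto intro!: holomorphic_intros holomorphic_deriv\<close>)
    also have "\<dots> = \<alpha> * (of_nat (Suc m) * (deriv ^^ m) (deriv h) 0)"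
      using higher_deriv_mult_ident[OF h1, of "Suc m" \<alpha>] by simp
    finally have D: "(deriv ^^ n) g 0 = \<alpha> * (of_nat (Suc m) * (deriv ^^ m) (deriv h) 0)" .
    have cancel: "A * (s * X) / (t * (s * F)) = A * (X / F) / t" if "s \<noteq> 0" for A s X t F :: complex
      using that by simp
    have "fact n = (of_nat n * (of_nat (Suc m) * fact m) :: complex)" unfolding m fact_Suc by (simp only: of_nat_mult)
    then have "b n = \<alpha> * ((deriv ^^ m) (deriv h) 0 / fact m) / of_nat n"
      unfolding cb[of n] D using cancel[of "of_nat (Suc m)"] by (simp only: of_nat_neq_0 not_False_eq_True)
    then have "cmod (b n) = cmod \<alpha> * cmod ((deriv ^^ m) (deriv h) 0 / fact m) / real n"
      by (simp only: norm_divide norm_mult norm_of_nat)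
    also have "\<dots> \<le> cmod \<alpha> * ((real m + 1) * (real m + 2) / 2) / real n"
      by (intro divide_right_mono mult_left_mono M_pair_deriv_coeff_bound[OF M]) auto
    also have "\<dots> = (real n - 1) / 2 * cmod \<alpha>" by (simp add: m field_simps)
    finally show ?thesis .
  qed
qed

text \<open>
  The Wirtinger derivatives of f determine h' and g', so any two normalised decompositions satisfy the same
  differential conditions.
\<close>
lemma class_M_decomposition:
  assumes f: "f \<in> class_M \<alpha>" and hg: "harmonic_decomposition f h g"
  shows "M_pair \<alpha> h g"
proof -
  obtain h0 g0 where M: "M_pair \<alpha> h0 g0" and f0: "\<And>z. z \<in> unit_disc \<Longrightarrow> f z = h0 z + cnj (g0 z)"
    using class_M_imp_M_pair[OF f] by blast
  have hol0: "open unit_disc" "h0 holomorphic_on unit_disc" "g0 holomorphic_on unit_disc"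
    using M unfolding M_pair_def by auto
  have hol: "open unit_disc" "h holomorphic_on unit_disc" "g holomorphic_on unit_disc"
    and z0: "h 0 = 0" "g 0 = 0"
    and f1: "\<And>z. z \<in> unit_disc \<Longrightarrow> f z = h z + cnj (g z)"
    using hg unfolding harmonic_decomposition_def by auto
  have d: "deriv h z = deriv h0 z" "deriv g z = deriv g0 z" if "z \<in> unit_disc" for z
    using wirtinger_add_cnj[OF hol f1 that] wirtinger_add_cnj[OF hol0 f0 that]
    by (simp, metis complex_cnj_cancel_iff)
  have dd: "deriv (deriv h) z = deriv (deriv h0) z" if "z \<in> unit_disc" for z
    by (rule complex_derivative_transform_within_open[of _ unit_disc])
       (use hol hol0 that d in \<open>auto intro: holomorphic_deriv\<close>)
  show ?thesis using M hol z0 d dd unfolding M_pair_def by auto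
qed

section \<open>Extremal functions and the growth bound\<close>

text \<open>
  The primitive of (1 - w)^(-3) vanishing at 0; correspondingly the derivative of \<open>G_ext\<close> is w (1 - w)^(-3).
\<close>
definition H_ext :: "'a \<Rightarrow> 'a::field" where "H_ext w = (w - w\<^sup>2 / 2) / (1 - w)\<^sup>2"
definition G_ext :: "'a \<Rightarrow> 'a::field" where "G_ext w = (w\<^sup>2 / 2) / (1 - w)\<^sup>2"

lemma sums_H_ext_G_ext:
  fixes z :: "'a::{real_normed_field,banach}"
  assumes "norm z < 1"
  shows "(\<lambda>n. (if n = 0 then 0 else (of_nat n + 1) / 2) * z ^ n) sums H_ext z"
    "(\<lambda>n. (if n = 0 then 0 else (of_nat n - 1) / 2) * z ^ n) sums G_ext z"
proof -
  have z1: "1 - z \<noteq> 0" using assms by auto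
  have A: "(\<lambda>n. of_nat (Suc n) * z ^ n) sums (1 / (1 - z)\<^sup>2)" by (rule geometric_deriv_sums[OF assms])
  have B: "(\<lambda>n. z ^ n) sums (1 / (1 - z))" by (rule geometric_sums[OF assms])
  have C: "(\<lambda>n. if n = 0 then (1::'a) else 0) sums 1" using sums_single[of 0 "\<lambda>_. 1::'a"] by simp
  have "(\<lambda>n. 1 / 2 * (of_nat (Suc n) * z ^ n) - 1 / 2 * (if n = 0 then 1 else 0)) sums (1 / 2 * (1 / (1 - z)\<^sup>2) - 1 / 2 * 1)"
    by (intro sums_diff sums_mult A C)
  moreover have "1 / 2 * (1 / (1 - z)\<^sup>2) - 1 / 2 * 1 = H_ext z"
  proof -
    have "1 / 2 * (1 / v\<^sup>2) - 1 / 2 * 1 = ((1 - v) - (1 - v)\<^sup>2 / 2) / v\<^sup>2" if "v \<noteq> 0" for v :: 'a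
      using that by (simp add: field_simps power2_eq_square)
    from this[OF z1] show ?thesis by (simp add: H_ext_def)
  qed
  moreover have "1 / 2 * (of_nat (Suc n) * z ^ n) - 1 / 2 * (if n = 0 then 1 else 0) = (if n = 0 then 0 else (of_nat n + 1) / 2) * z ^ n" for n
    by (simp add: field_simps)
  ultimately show "(\<lambda>n. (if n = 0 then 0 else (of_nat n + 1) / 2) * z ^ n) sums H_ext z" by simp
  have "(\<lambda>n. 1 / 2 * (of_nat (Suc n) * z ^ n) - z ^ n + 1 / 2 * (if n = 0 then 1 else 0)) sums (1 / 2 * (1 / (1 - z)\<^sup>2) - 1 / (1 - z) + 1 / 2 * 1)"
    by (intro sums_diff sums_add sums_mult A B C)
  moreover have "1 / 2 * (1 / (1 - z)\<^sup>2) - 1 / (1 - z) + 1 / 2 * 1 = G_ext z"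
  proof -
    have "1 / 2 * (1 / v\<^sup>2) - 1 / v + 1 / 2 * 1 = ((1 - v)\<^sup>2 / 2) / v\<^sup>2" if "v \<noteq> 0" for v :: 'a
      using that by (simp add: field_simps power2_eq_square)
    from this[OF z1] show ?thesis by (simp add: G_ext_def)
  qed
  moreover have "1 / 2 * (of_nat (Suc n) * z ^ n) - z ^ n + 1 / 2 * (if n = 0 then 1 else 0) = (if n = 0 then 0 else (of_nat n - 1) / 2) * z ^ n" for n
    by (simp add: field_simps)
  ultimately show "(\<lambda>n. (if n = 0 then 0 else (of_nat n - 1) / 2) * z ^ n) sums G_ext z" by simp
qed

lemma DERIV_H_ext_G_ext:
  fixes w :: complex
  assumes "1 - w \<noteq> 0"
  shows "(H_ext has_field_derivative 1 / (1 - w) ^ 3) (at w)" "(G_ext has_field_derivative w / (1 - w) ^ 3) (at w)"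
  unfolding H_ext_def[abs_def] G_ext_def[abs_def] using assms
  by (auto intro!: derivative_eq_intros simp: divide_simps power2_eq_square power3_eq_cube) (simp_all add: algebra_simps)

text \<open>
  Rotated extremal functions. The factors are such that the relation between the derivatives keeps the same
  parameter \<alpha> for every \<eta>.
\<close>
definition h_ext :: "complex \<Rightarrow> complex \<Rightarrow> complex" where "h_ext \<eta> z = cnj \<eta> * H_ext (\<eta> * z)"
definition g_ext :: "complex \<Rightarrow> complex \<Rightarrow> complex \<Rightarrow> complex" where "g_ext \<alpha> \<eta> z = \<alpha> * (cnj \<eta>)\<^sup>2 * G_ext (\<eta> * z)"

lemma M_pair_ext:
  assumes \<eta>: "cmod \<eta> = 1"
  shows "M_pair \<alpha> (h_ext \<eta>) (g_ext \<alpha> \<eta>)"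
proof -
  have \<eta>\<eta>: "\<eta> * cnj \<eta> = 1" using complex_norm_square[of \<eta>] \<eta> by simp
  have nz: "1 - \<eta> * z \<noteq> 0" if "z \<in> unit_disc" for z
  proof
    assume "1 - \<eta> * z = 0"
    then have "cmod (\<eta> * z) = 1" by (simp add: eq_diff_eq[symmetric])
    then show False using that \<eta> by (simp add: norm_mult)
  qed
  have lin: "((\<lambda>z. \<eta> * z) has_field_derivative \<eta>) (at z)" for z
    by (auto intro!: derivative_eq_intros)
  have dh: "(h_ext \<eta> has_field_derivative 1 / (1 - \<eta> * z) ^ 3) (at z)" if z: "z \<in> unit_disc" for z
    unfolding h_ext_def[abs_def]
    by (rule DERIV_cong[OF DERIV_cmult[OF DERIV_chain2[OF DERIV_H_ext_G_ext(1)[OF nz[OF z]] lin]]])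
       (use \<eta>\<eta> in \<open>simp add: mult.commute\<close>)
  have dg: "(g_ext \<alpha> \<eta> has_field_derivative \<alpha> * z / (1 - \<eta> * z) ^ 3) (at z)" if z: "z \<in> unit_disc" for z
    unfolding g_ext_def[abs_def]
  proof (rule DERIV_cong[OF DERIV_cmult[OF DERIV_chain2[OF DERIV_H_ext_G_ext(2)[OF nz[OF z]] lin]]])
    have "\<alpha> * (cnj \<eta>)\<^sup>2 * (\<eta> * z / (1 - \<eta> * z) ^ 3 * \<eta>) = \<alpha> * z / (1 - \<eta> * z) ^ 3 * (\<eta> * cnj \<eta>)\<^sup>2"
      by (simp add: power2_eq_square)
    then show "\<alpha> * (cnj \<eta>)\<^sup>2 * (\<eta> * z / (1 - \<eta> * z) ^ 3 * \<eta>) = \<alpha> * z / (1 - \<eta> * z) ^ 3" by (simp add: \<eta>\<eta>)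
  qed
  have dh': "deriv (h_ext \<eta>) z = 1 / (1 - \<eta> * z) ^ 3" and dg': "deriv (g_ext \<alpha> \<eta>) z = \<alpha> * z / (1 - \<eta> * z) ^ 3"
    if "z \<in> unit_disc" for z using dh[OF that] dg[OF that] by (auto intro: DERIV_imp_deriv)
  have ddh: "deriv (deriv (h_ext \<eta>)) z = 3 * \<eta> / (1 - \<eta> * z) ^ 4" if z: "z \<in> unit_disc" for z
  proof (rule DERIV_imp_deriv)
    have "((\<lambda>z. 1 / (1 - \<eta> * z) ^ 3) has_field_derivative 3 * \<eta> / (1 - \<eta> * z) ^ 4) (at z)"
    proof -
      have "((\<lambda>z. (1 - \<eta> * z) ^ 3) has_field_derivative - \<eta> * (3 * (1 - \<eta> * z)\<^sup>2)) (at z)"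
        by (auto intro!: derivative_eq_intros)
      moreover have "(1 - \<eta> * z) ^ 3 \<noteq> 0" using nz[OF z] by simp
      ultimately have d: "((\<lambda>z. inverse ((1 - \<eta> * z) ^ 3)) has_field_derivative
          - ((- \<eta> * (3 * (1 - \<eta> * z)\<^sup>2)) * inverse (((1 - \<eta> * z) ^ 3) ^ Suc (Suc 0)))) (at z)"
        by (rule DERIV_inverse_fun)
      have "- ((- \<eta> * (3 * v\<^sup>2)) * inverse ((v ^ 3) ^ Suc (Suc 0))) = 3 * \<eta> / v ^ 4" if "v \<noteq> 0" for v
        using that by (simp add: field_simps eval_nat_numeral)
      from DERIV_cong[OF d this[OF nz[OF z]]] show ?thesis by (simp only: inverse_eq_divide)
    qed
    then show "(deriv (h_ext \<eta>) has_field_derivative 3 * \<eta> / (1 - \<eta> * z) ^ 4) (at z)"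
      by (rule has_field_derivative_transform_within_open[of _ _ _ unit_disc]) (use z dh' in auto)
  qed
  have re: "Re (1 + z * deriv (deriv (h_ext \<eta>)) z / deriv (h_ext \<eta>) z) > - 1 / 2" if z: "z \<in> unit_disc" for z
  proof -
    have "z * deriv (deriv (h_ext \<eta>)) z / deriv (h_ext \<eta>) z = of_real 3 * (\<eta> * z / (1 - \<eta> * z))"
    proof -
      have "z * (3 * \<eta> / v ^ 4) / (1 / v ^ 3) = of_real 3 * (\<eta> * z / v)" if "v \<noteq> 0" for v
        using that by (simp add: field_simps eval_nat_numeral)
      then show ?thesis unfolding dh'[OF z] ddh[OF z] using nz[OF z] by blast
    qed
    moreover have "Re (1 + of_real 3 * w) = 1 + 3 * Re w" for w by simp
    ultimately have "Re (1 + z * deriv (deriv (h_ext \<eta>)) z / deriv (h_ext \<eta>) z) = 1 + 3 * Re (\<eta> * z / (1 - \<eta> * z))"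
      by (simp only:)
    moreover have "Re (\<eta> * z / (1 - \<eta> * z)) > - 1 / 2"
      by (rule Re_div_one_minus) (use z \<eta> in \<open>simp add: norm_mult\<close>)
    ultimately show ?thesis by linarith
  qed
  have "h_ext \<eta> holomorphic_on unit_disc" "g_ext \<alpha> \<eta> holomorphic_on unit_disc"
    unfolding holomorphic_on_open[OF open_ball] using dh dg by blast+
  then show ?thesis unfolding M_pair_def
    using dh' dg' nz re by (auto simp: h_ext_def g_ext_def H_ext_def G_ext_def)
qed

lemma holomorphic_imp_has_power_series:
  assumes "f holomorphic_on unit_disc" shows "has_power_series f (\<lambda>n. (deriv ^^ n) f 0 / fact n)"
  unfolding has_power_series_def using holomorphic_power_series[OF assms] by simp

lemma norm_le_majorant_series:
  fixes a :: "nat \<Rightarrow> complex" and m :: "nat \<Rightarrow> real"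
  assumes "(\<lambda>n. a n * z ^ n) sums w" "\<And>n. cmod (a n) \<le> K * m n" "(\<lambda>n. m n * cmod z ^ n) sums W"
  shows "cmod w \<le> K * W"
proof -
  have s: "(\<lambda>n. K * (m n * cmod z ^ n)) sums (K * W)" by (rule sums_mult[OF assms(3)])
  have "cmod (\<Sum>n. a n * z ^ n) \<le> (\<Sum>n. K * (m n * cmod z ^ n))"
  proof (rule norm_suminf_le)
    show "cmod (a n * z ^ n) \<le> K * (m n * cmod z ^ n)" for n
      using mult_right_mono[OF assms(2)[of n], of "cmod z ^ n"] by (simp add: norm_mult norm_power mult.assoc)
    show "summable (\<lambda>n. K * (m n * cmod z ^ n))" using s by (rule sums_summable)
  qed
  then show ?thesis using assms(1) s by (simp add: sums_iff)
qed

lemma growth_identity: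
  fixes r k :: real
  shows "H_ext r + k * G_ext r = r / (1 - r)\<^sup>2 * (1 - 1 / 2 * (1 - k) * r)"
proof -
  have "(r - r\<^sup>2 / 2) / d + k * ((r\<^sup>2 / 2) / d) = r / d * (1 - 1 / 2 * (1 - k) * r)" for d
    by (cases "d = 0") (simp_all add: field_simps power2_eq_square)
  then show ?thesis unfolding H_ext_def G_ext_def .
qed

lemma M_pair_growth:
  assumes M: "M_pair \<alpha> h g" and z: "z \<in> unit_disc"
  shows "cmod (h z + cnj (g z)) \<le> cmod z / (1 - cmod z)\<^sup>2 * (1 - 1 / 2 * (1 - cmod \<alpha>) * cmod z)"
proof -
  have hol: "h holomorphic_on unit_disc" "g holomorphic_on unit_disc" using M unfolding M_pair_def by auto
  define a where "a = (\<lambda>n. (deriv ^^ n) h 0 / fact n)"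
  define b where "b = (\<lambda>n. (deriv ^^ n) g 0 / fact n)"
  have ab: "has_power_series h a" "has_power_series g b" unfolding a_def b_def using hol by (auto intro: holomorphic_imp_has_power_series)
  note C = M_pair_coeffs[OF M ab]
  have r: "norm (cmod z) < 1" using z by simp
  have "cmod (h z) \<le> 1 * H_ext (cmod z)"
  proof (rule norm_le_majorant_series[OF _ _ sums_H_ext_G_ext(1)[OF r]])
    show "(\<lambda>n. a n * z ^ n) sums h z" using ab(1) z unfolding has_power_series_def by blast
    show "cmod (a n) \<le> 1 * (if n = 0 then 0 else (of_nat n + 1) / 2)" for n
      using C(3) C(5)[of n] by auto
  qed
  moreover have "cmod (g z) \<le> cmod \<alpha> * G_ext (cmod z)"
  proof (rule norm_le_majorant_series[OF _ _ sums_H_ext_G_ext(2)[OF r]])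
    show "(\<lambda>n. b n * z ^ n) sums g z" using ab(2) z unfolding has_power_series_def by blast
    show "cmod (b n) \<le> cmod \<alpha> * (if n = 0 then 0 else (of_nat n - 1) / 2)" for n
      using C(4) C(6)[of n] by (auto simp: mult.commute)
  qed
  moreover have "cmod (h z + cnj (g z)) \<le> cmod (h z) + cmod (g z)"
    using norm_triangle_ineq[of "h z" "cnj (g z)"] by simp
  ultimately show ?thesis unfolding growth_identity[symmetric] by linarith
qed

text \<open>
  For \<eta> with \<eta>^3 cnj \<alpha> = |\<alpha>| both summands of f have the same argument at cnj \<eta> r.
\<close>
lemma growth_sharp:
  assumes r: "0 < r" "r < 1"
  shows "\<exists>f\<in>class_M \<alpha>. \<exists>z. cmod z = r \<and>
           cmod (f z) = cmod z / (1 - cmod z)\<^sup>2 * (1 - 1 / 2 * (1 - cmod \<alpha>) * cmod z)"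
proof -
  define \<eta> where "\<eta> = cis (Arg \<alpha> / 3)"
  have \<eta>: "cmod \<eta> = 1" by (simp add: \<eta>_def)
  have \<eta>\<eta>: "\<eta> * cnj \<eta> = 1" using complex_norm_square[of \<eta>] \<eta> by simp
  have "\<eta> ^ 3 = cis (Arg \<alpha>)" using Complex.DeMoivre[of "Arg \<alpha> / 3" 3] by (simp add: \<eta>_def)
  moreover have "cnj \<alpha> * cis (Arg \<alpha>) = of_real (cmod \<alpha>)"
  proof -
    have "\<alpha> = of_real (cmod \<alpha>) * cis (Arg \<alpha>)" by (cases "\<alpha> = 0") (simp_all add: Arg_eq cis_conv_exp)
    then have "cnj \<alpha> = of_real (cmod \<alpha>) * cis (- Arg \<alpha>)" by (metis cis_cnj complex_cnj_complex_of_real complex_cnj_mult)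
    then show ?thesis by (simp add: cis_mult)
  qed
  ultimately have key: "cnj \<alpha> * \<eta> ^ 3 = of_real (cmod \<alpha>)" by simp
  define f where "f = (\<lambda>z. h_ext \<eta> z + cnj (g_ext \<alpha> \<eta> z))"
  have fM: "f \<in> class_M \<alpha>" by (rule M_pair_imp_class_M(1)[OF M_pair_ext[OF \<eta>]]) (simp add: f_def)
  define z where "z = of_real r * cnj \<eta>"
  have \<eta>z: "\<eta> * z = of_real r" using \<eta>\<eta> by (simp add: z_def)
  have cz: "cmod z = r" using r \<eta> by (simp add: z_def norm_mult)
  have real: "H_ext (of_real r) = (of_real (H_ext r) :: complex)" "G_ext (of_real r) = (of_real (G_ext r) :: complex)"
    by (simp_all add: H_ext_def G_ext_def)
  have "f z = cnj \<eta> * of_real (H_ext r) + cnj \<alpha> * \<eta>\<^sup>2 * of_real (G_ext r)"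
    by (simp add: f_def h_ext_def g_ext_def \<eta>z real)
  also have "cnj \<alpha> * \<eta>\<^sup>2 = cnj \<eta> * (cnj \<alpha> * \<eta> ^ 3)"
  proof -
    have "cnj \<eta> * (cnj \<alpha> * \<eta> ^ 3) = cnj \<alpha> * \<eta>\<^sup>2 * (\<eta> * cnj \<eta>)" by (simp add: power2_eq_square power3_eq_cube)
    then show ?thesis unfolding \<eta>\<eta> by (simp only: mult_1_right)
  qed
  finally have "f z = cnj \<eta> * of_real (H_ext r + cmod \<alpha> * G_ext r)" unfolding key by (simp add: algebra_simps)
  then have "cmod (f z) = \<bar>H_ext r + cmod \<alpha> * G_ext r\<bar>" using \<eta> by (simp only: norm_mult complex_mod_cnj norm_of_real mult_1)
  moreover have "H_ext r + cmod \<alpha> * G_ext r \<ge> 0"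
  proof -
    have "r\<^sup>2 / 2 \<le> r" using r mult_left_le[of r r] by (simp add: power2_eq_square)
    then show ?thesis by (simp add: H_ext_def G_ext_def)
  qed
  ultimately have "cmod (f z) = cmod z / (1 - cmod z)\<^sup>2 * (1 - 1 / 2 * (1 - cmod \<alpha>) * cmod z)"
    unfolding cz growth_identity[symmetric] by simp
  then show ?thesis using fM cz by blast
qed

lemma coeffs_sharp:
  assumes n: "n \<ge> 2"
  shows "\<exists>f\<in>class_M \<alpha>. \<exists>h g a. harmonic_decomposition f h g \<and> has_power_series h a \<and> cmod (a n) = (real n + 1) / 2"
    "\<exists>f\<in>class_M \<alpha>. \<exists>h g b. harmonic_decomposition f h g \<and> has_power_series g b \<and> cmod (b n) = (real n - 1) / 2 * cmod \<alpha>"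
proof -
  define f where "f = (\<lambda>z. h_ext 1 z + cnj (g_ext \<alpha> 1 z))"
  have f: "f \<in> class_M \<alpha>" "harmonic_decomposition f (h_ext 1) (g_ext \<alpha> 1)"
    using M_pair_imp_class_M[OF M_pair_ext[of 1 \<alpha>], of f] by (auto simp: f_def)
  have "has_power_series (h_ext 1) (\<lambda>n. if n = 0 then 0 else (of_nat n + 1) / 2)"
    unfolding has_power_series_def h_ext_def using sums_H_ext_G_ext(1)[where 'a=complex] by simp
  moreover have "cmod (if n = 0 then 0 else (of_nat n + 1) / 2) = (real n + 1) / 2"
  proof -
    have eq: "(of_nat n + 1) / 2 = (of_real ((real n + 1) / 2) :: complex)" by simp
    have "cmod ((of_nat n + 1) / 2) = \<bar>(real n + 1) / 2\<bar>" unfolding eq by (rule norm_of_real)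
    then show ?thesis using n by simp
  qed
  ultimately show "\<exists>f\<in>class_M \<alpha>. \<exists>h g a. harmonic_decomposition f h g \<and> has_power_series h a \<and> cmod (a n) = (real n + 1) / 2"
    using f by blast
  have "(\<lambda>n. \<alpha> * (if n = 0 then 0 else (of_nat n - 1) / 2) * z ^ n) sums (\<alpha> * G_ext z)" if "cmod z < 1" for z
    using sums_mult[OF sums_H_ext_G_ext(2)[OF that], of \<alpha>] by (simp only: mult.assoc)
  then have "has_power_series (g_ext \<alpha> 1) (\<lambda>n. \<alpha> * (if n = 0 then 0 else (of_nat n - 1) / 2))"
    unfolding has_power_series_def g_ext_def by simp
  moreover have "cmod (\<alpha> * (if n = 0 then 0 else (of_nat n - 1) / 2)) = (real n - 1) / 2 * cmod \<alpha>"
  proof -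
    have eq: "(of_nat n - 1) / 2 = (of_real ((real n - 1) / 2) :: complex)" by simp
    have "cmod ((of_nat n - 1) / 2) = \<bar>(real n - 1) / 2\<bar>" unfolding eq by (rule norm_of_real)
    then show ?thesis using n by (simp add: norm_mult)
  qed
  ultimately show "\<exists>f\<in>class_M \<alpha>. \<exists>h g b. harmonic_decomposition f h g \<and> has_power_series g b \<and> cmod (b n) = (real n - 1) / 2 * cmod \<alpha>"
    using f by blast
qed

section \<open>The area formula in the complex plane\<close>

text \<open>
  The isometry that carries the change of variables formula from real^2 to the complex plane.
\<close>
definition to_vec :: "complex \<Rightarrow> real ^ 2" where "to_vec z = (\<chi> i. if i = 1 then Re z else Im z)"
definition of_vec :: "real ^ 2 \<Rightarrow> complex" where "of_vec v = Complex (v $ 1) (v $ 2)"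

lemma vec_inverses [simp]: "of_vec (to_vec z) = z" "to_vec (of_vec v) = v"
  by (auto simp: to_vec_def of_vec_def complex_eq_iff vec_eq_iff forall_2)

lemma bounded_linear_vec: "bounded_linear to_vec" "bounded_linear of_vec"
proof -
  have "linear to_vec" by (rule linearI) (auto simp: to_vec_def vec_eq_iff)
  then show "bounded_linear to_vec" by (rule linear_conv_bounded_linear[THEN iffD1])
  have "linear of_vec" by (rule linearI) (auto simp: of_vec_def complex_eq_iff)
  then show "bounded_linear of_vec" by (rule linear_conv_bounded_linear[THEN iffD1])
qed

lemma continuous_vec: "continuous_on S to_vec" "continuous_on T of_vec"
  using bounded_linear_vec linear_continuous_on by blast+

lemma measurable_vec [measurable]: "to_vec \<in> borel_measurable borel" "of_vec \<in> borel_measurable borel"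
  using continuous_vec borel_measurable_continuous_onI by blast+

lemma lborel_vec: "distr lborel borel to_vec = lborel"
proof (rule lborel_eqI[symmetric])
  fix l u :: "real ^ 2" assume le: "\<And>b. b \<in> Basis \<Longrightarrow> l \<bullet> b \<le> u \<bullet> b"
  have le': "l $ i \<le> u $ i" for i using le[of "axis i 1"] by (simp add: axis_in_Basis_iff inner_axis)
  have "to_vec -` box l u = box (of_vec l) (of_vec u)"
    by (auto simp: mem_box_cart to_vec_def of_vec_def forall_2 mem_box Basis_complex_def)
  moreover have "emeasure (distr lborel borel to_vec) (box l u) = emeasure lborel (to_vec -` box l u \<inter> space lborel)"
    by (rule emeasure_distr) auto
  ultimately have "emeasure (distr lborel borel to_vec) (box l u) = emeasure lborel (box (of_vec l) (of_vec u))" by simp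
  also have "\<dots> = (\<Prod>b\<in>Basis. (of_vec u - of_vec l) \<bullet> b)"
    by (rule emeasure_lborel_box) (use le' in \<open>auto simp: Basis_complex_def of_vec_def\<close>)
  also have "(\<Prod>b\<in>Basis. (of_vec u - of_vec l) \<bullet> b) = (u $ 1 - l $ 1) * (u $ 2 - l $ 2)"
    by (simp add: Basis_complex_def of_vec_def)
  also have "\<dots> = (\<Prod>b\<in>Basis. (u - l) \<bullet> b)"
  proof -
    have Bas: "(Basis :: (real ^ 2) set) = (\<lambda>i. axis i 1) ` UNIV" by (auto simp: Basis_vec_def)
    have inj: "inj (\<lambda>i::2. axis i (1::real))" by (auto simp: inj_on_def axis_eq_axis)
    have "(\<Prod>b\<in>Basis. (u - l) \<bullet> b) = (\<Prod>i\<in>UNIV. (u - l) \<bullet> axis i 1)"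
      unfolding Bas prod.reindex[OF inj] o_def ..
    then show ?thesis by (simp add: UNIV_2 inner_axis)
  qed
  finally show "emeasure (distr lborel borel to_vec) (box l u) = (\<Prod>b\<in>Basis. (u - l) \<bullet> b)" .
qed simp

lemma integral_vec:
  fixes F :: "complex \<Rightarrow> real"
  assumes "set_integrable lborel S F"
  shows "set_integrable lborel (of_vec -` S) (\<lambda>x. F (of_vec x))"
    "(LINT x:of_vec -` S|lborel. F (of_vec x)) = (LINT z:S|lborel. F z)"
proof -
  have [measurable]: "(\<lambda>z. indicator S z *\<^sub>R F z) \<in> borel_measurable borel"
    using assms unfolding set_integrable_def by (auto dest: borel_measurable_integrable)
  define G where "G = (\<lambda>x. indicator (of_vec -` S) x *\<^sub>R F (of_vec x))"
  have G: "G = (\<lambda>x. (\<lambda>z. indicator S z *\<^sub>R F z) (of_vec x))" by (auto simp: G_def indicator_def)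
  have [measurable]: "G \<in> borel_measurable borel" unfolding G by measurable
  have GJ: "G (to_vec z) = indicator S z *\<^sub>R F z" for z by (simp add: G)
  have "integrable (distr lborel borel to_vec) G" 
    by (subst integrable_distr_eq) (use assms in \<open>auto simp: GJ set_integrable_def\<close>)
  then show "set_integrable lborel (of_vec -` S) (\<lambda>x. F (of_vec x))"
    unfolding set_integrable_def lborel_vec G_def .
  have "integral\<^sup>L (distr lborel borel to_vec) G = integral\<^sup>L lborel (\<lambda>z. G (to_vec z))"
    by (rule integral_distr) auto
  then show "(LINT x:of_vec -` S|lborel. F (of_vec x)) = (LINT z:S|lborel. F z)"
    unfolding set_lebesgue_integral_def lborel_vec GJ by (simp only: G_def)
qed

lemma area_formula:
  fixes f :: "complex \<Rightarrow> complex"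
  assumes S: "open S" and inj: "inj_on f S"
    and der: "\<And>x. x \<in> S \<Longrightarrow> (f has_derivative rlin (p x) (q x)) (at x)"
    and int: "set_integrable lborel S (\<lambda>x. \<bar>Im (cnj (p x) * q x)\<bar>)"
  shows "open (f ` S)" "emeasure lborel (f ` S) = ennreal (LINT x:S|lborel. \<bar>Im (cnj (p x) * q x)\<bar>)"
proof -
  have "continuous_on S f"
    using der has_derivative_continuous continuous_at_imp_continuous_on by blast
  then show op: "open (f ` S)" using S inj by (intro invariance_of_domain)
  define S' where "S' = of_vec -` S"
  define F where "F = (\<lambda>v. to_vec (f (of_vec v)))"
  define D where "D = (\<lambda>v w. to_vec (rlin (p (of_vec v)) (q (of_vec v)) (of_vec w)))"
  have "open S'" unfolding S'_def using S continuous_vec(2) by (intro open_vimage)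
  then have S'l: "S' \<in> sets lebesgue" by simp
  have injF: "inj_on F S'"
  proof (rule inj_onI)
    fix x y assume "x \<in> S'" "y \<in> S'" "F x = F y"
    then have "of_vec x = of_vec y" using inj unfolding F_def S'_def inj_on_def by (metis vec_inverses(1) vimageD)
    then show "x = y" by (metis vec_inverses(2))
  qed
  have derF: "(F has_derivative D v) (at v within S')" if "v \<in> S'" for v
  proof -
    have 1: "(of_vec has_derivative of_vec) (at v)"
      by (rule bounded_linear_imp_has_derivative[OF bounded_linear_vec(2)])
    have 2: "(f has_derivative rlin (p (of_vec v)) (q (of_vec v))) (at (of_vec v))"
      using der that by (simp add: S'_def)
    from bounded_linear.has_derivative[OF bounded_linear_vec(1) diff_chain_at[OF 1 2]]
    have "(F has_derivative D v) (at v)" unfolding F_def D_def by (simp add: o_def)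
    then show ?thesis by (rule has_derivative_at_withinI)
  qed
  have det: "det (matrix (D v)) = Im (cnj (p (of_vec v)) * q (of_vec v))" for v
  proof -
    have "of_vec (axis 1 1) = 1" "of_vec (axis 2 1) = \<i>"
      by (simp_all add: of_vec_def axis_def complex_eq_iff)
    then show ?thesis
      by (simp add: det_2 matrix_def D_def to_vec_def rlin_def algebra_simps)
  qed
  note iv = integral_vec[OF int]
  note si = set_borel_integral_eq_integral[OF iv(1)]
  have "(\<lambda>x. \<bar>det (matrix (D x))\<bar>) integrable_on S'" unfolding det S'_def by (rule si(1))
  then have meas: "F ` S' \<in> lmeasurable" "measure lebesgue (F ` S') = integral S' (\<lambda>x. \<bar>det (matrix (D x))\<bar>)"
    using measurable_differentiable_image_eq[OF S'l derF injF] measure_differentiable_image_eq[OF S'l derF injF] by blast+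
  have "integral S' (\<lambda>x. \<bar>det (matrix (D x))\<bar>) = (LINT x:S|lborel. \<bar>Im (cnj (p x) * q x)\<bar>)"
    unfolding det S'_def using si(2) iv(2) by simp
  then have m: "measure lebesgue (F ` S') = (LINT x:S|lborel. \<bar>Im (cnj (p x) * q x)\<bar>)" using meas by simp
  have FS: "F ` S' = of_vec -` (f ` S)"
  proof -
    have "S' = to_vec ` S"
    proof (intro equalityI subsetI)
      fix v assume "v \<in> S'"
      then have "of_vec v \<in> S" by (simp add: S'_def)
      then show "v \<in> to_vec ` S" by (rule rev_image_eqI) simp
    qed (auto simp: S'_def)
    then have "F ` S' = to_vec ` (f ` S)" by (simp add: F_def image_image)
    also have "\<dots> = of_vec -` (f ` S)"
    proof (intro equalityI subsetI)
      fix v assume "v \<in> of_vec -` (f ` S)"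
      then have "of_vec v \<in> f ` S" by simp
      then show "v \<in> to_vec ` (f ` S)" by (rule rev_image_eqI) simp
    qed auto
    finally show ?thesis .
  qed
  have oF: "open (F ` S')" unfolding FS using op continuous_vec(2) by (intro open_vimage)
  have "emeasure lborel (F ` S') = emeasure (distr lborel borel to_vec) (F ` S')" by (simp only: lborel_vec)
  also have "\<dots> = emeasure lborel (to_vec -` (F ` S') \<inter> space lborel)"
    using oF by (intro emeasure_distr) auto
  also have "to_vec -` (F ` S') \<inter> space lborel = f ` S" unfolding FS by auto
  finally have "emeasure lborel (f ` S) = emeasure lborel (F ` S')" by simp
  also have "\<dots> = emeasure lebesgue (F ` S')" using oF by (simp add: emeasure_completion)
  also have "\<dots> = ennreal (measure lebesgue (F ` S'))" by (rule emeasure_eq_measure2[OF meas(1)])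
  finally show "emeasure lborel (f ` S) = ennreal (LINT x:S|lborel. \<bar>Im (cnj (p x) * q x)\<bar>)" by (simp only: m)
qed

lemma set_integrable_ball:
  fixes F :: "complex \<Rightarrow> 'b::{banach, second_countable_topology}"
  assumes "continuous_on (cball 0 \<rho>) F"
  shows "set_integrable lborel (ball 0 \<rho>) F"
proof -
  have "set_integrable lborel (cball 0 \<rho>) F"
    unfolding set_integrable_def by (rule borel_integrable_compact) (use assms in auto)
  then show ?thesis by (rule set_integrable_subset) auto
qed

text \<open>
  The area formula for multiplication by cnj \<eta>, which has Jacobian 1, applied to boxes.
\<close>
lemma lborel_rotation:
  fixes \<eta> :: complex
  assumes \<eta>: "cmod \<eta> = 1"
  shows "distr lborel borel (\<lambda>z. \<eta> * z) = lborel"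
proof (rule lborel_eqI[symmetric])
  fix l u :: complex assume le: "\<And>b. b \<in> Basis \<Longrightarrow> l \<bullet> b \<le> u \<bullet> b"
  have \<eta>\<eta>: "\<eta> * cnj \<eta> = 1" using complex_norm_square[of \<eta>] \<eta> by simp
  have pre: "(\<lambda>z. \<eta> * z) -` box l u = (\<lambda>z. cnj \<eta> * z) ` box l u"
  proof -
    have "\<eta> * (cnj \<eta> * z) = z" "cnj \<eta> * (\<eta> * z) = z" for z using \<eta>\<eta> by (metis mult.assoc mult.commute mult_1)+
    note inv = this
    show ?thesis
    proof (intro equalityI subsetI)
      fix z assume "z \<in> (\<lambda>z. \<eta> * z) -` box l u"
      then have "\<eta> * z \<in> box l u" by simp
      then show "z \<in> (\<lambda>z. cnj \<eta> * z) ` box l u" by (rule rev_image_eqI) (simp only: inv)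
    next
      fix z assume "z \<in> (\<lambda>z. cnj \<eta> * z) ` box l u"
      then obtain w where "w \<in> box l u" "z = cnj \<eta> * w" by blast
      then show "z \<in> (\<lambda>z. \<eta> * z) -` box l u" by (simp only: inv vimage_eq)
    qed
  qed
  have "emeasure (distr lborel borel (\<lambda>z. \<eta> * z)) (box l u) = emeasure lborel ((\<lambda>z. \<eta> * z) -` box l u \<inter> space lborel)"
    by (rule emeasure_distr) auto
  also have "\<dots> = emeasure lborel ((\<lambda>z. cnj \<eta> * z) ` box l u)" unfolding pre by simp
  also have "\<dots> = ennreal (LINT x:box l u|lborel. \<bar>Im (cnj (cnj \<eta>) * (cnj \<eta> * \<i>))\<bar>)"
  proof (rule area_formula(2))
    show "inj_on (\<lambda>z. cnj \<eta> * z) (box l u)" using \<eta> by (auto simp: inj_on_def)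
    have "rlin (cnj \<eta>) (cnj \<eta> * \<i>) = (\<lambda>v. cnj \<eta> * v)" by (auto simp: rlin_def complex_eq_iff algebra_simps)
    then show "((\<lambda>z. cnj \<eta> * z) has_derivative rlin (cnj \<eta>) (cnj \<eta> * \<i>)) (at x)" for x
      by (auto intro!: derivative_eq_intros)
    show "set_integrable lborel (box l u) (\<lambda>x. \<bar>Im (cnj (cnj \<eta>) * (cnj \<eta> * \<i>))\<bar>)"
      unfolding set_integrable_def
      by (intro integrable_scaleR_left integrable_real_indicator) (auto simp: emeasure_lborel_box_finite[unfolded infinity_ennreal_def])
  qed auto
  also have "cnj (cnj \<eta>) * (cnj \<eta> * \<i>) = \<i>" using \<eta>\<eta> by (simp add: mult.assoc[symmetric])
  also have "ennreal (LINT x:box l u|lborel. \<bar>Im \<i>\<bar>) = emeasure lborel (box l u)"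
    using emeasure_eq_ennreal_measure[of lborel "box l u"] emeasure_lborel_box_finite[of l u]
    by (simp add: set_lebesgue_integral_def)
  also have "\<dots> = (\<Prod>b\<in>Basis. (u - l) \<bullet> b)" using le by (rule emeasure_lborel_box)
  finally show "emeasure (distr lborel borel (\<lambda>z. \<eta> * z)) (box l u) = (\<Prod>b\<in>Basis. (u - l) \<bullet> b)" .
qed simp

section \<open>Weighted integrals over discs\<close>

lemma measure_disc: "\<rho> \<ge> 0 \<Longrightarrow> emeasure lborel (ball (0::complex) \<rho>) = ennreal (pi * \<rho>\<^sup>2)"
  by (simp add: emeasure_ball unit_ball_vol_2)

lemma has_derivative_norm_mult:
  "((\<lambda>z. of_real (cmod z) * z) has_derivative
     rlin (of_real (cmod x) + of_real (Re x / cmod x) * x) (of_real (cmod x) * \<i> + of_real (Im x / cmod x) * x)) (at x)"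
proof (cases "x = 0")
  case True
  have "((\<lambda>z::complex. cmod z) \<longlongrightarrow> 0) (at 0)" by (rule tendsto_norm_zero[OF tendsto_ident_at])
  then have "((\<lambda>y::complex. cmod (of_real (cmod y) * y - of_real (cmod 0) * 0 - 0) / cmod (y - 0)) \<longlongrightarrow> 0) (at 0)"
    by (rule Lim_transform_eventually) (auto simp: eventually_at norm_mult intro!: exI[of _ 1])
  moreover have "rlin 0 0 = (\<lambda>v. 0)" by (auto simp: rlin_def)
  ultimately show ?thesis using True by (simp add: has_derivative_iff_norm)
next
  case False
  have n: "(cmod has_derivative (\<lambda>v. v \<bullet> sgn x)) (at x)" by (rule has_derivative_norm[OF False])
  have "((\<lambda>z. of_real (cmod z) :: complex) has_derivative (\<lambda>v. of_real (v \<bullet> sgn x))) (at x)"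
    by (rule bounded_linear.has_derivative[OF bounded_linear_of_real n])
  from has_derivative_mult[OF this has_derivative_ident]
  have "((\<lambda>z. of_real (cmod z) * z) has_derivative (\<lambda>v. of_real (cmod x) * v + of_real (v \<bullet> sgn x) * x)) (at x)" .
  moreover have "(\<lambda>v. of_real (cmod x) * v + of_real (v \<bullet> sgn x) * x) =
      rlin (of_real (cmod x) + of_real (Re x / cmod x) * x) (of_real (cmod x) * \<i> + of_real (Im x / cmod x) * x)"
  proof
    fix v
    have "v \<bullet> sgn x = Re v * (Re x / cmod x) + Im v * (Im x / cmod x)"
      by (simp add: inner_complex_def sgn_eq)
    moreover have "rlin (of_real s + of_real a * x) (of_real s * \<i> + of_real b * x) v
        = of_real s * v + of_real (Re v * a + Im v * b) * x" for s a b
      by (simp add: rlin_def complex_eq_iff algebra_simps)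
    ultimately show "of_real (cmod x) * v + of_real (v \<bullet> sgn x) * x =
      rlin (of_real (cmod x) + of_real (Re x / cmod x) * x) (of_real (cmod x) * \<i> + of_real (Im x / cmod x) * x) v"
      by (simp only:)
  qed
  ultimately show ?thesis by simp
qed

text \<open>
  The map |z| z sends the disc of radius \<rho> injectively onto the disc of radius \<rho>^2 and has Jacobian 2 |z|^2.
\<close>
lemma integral_disc_norm_squared:
  assumes \<rho>: "\<rho> > 0"
  shows "(LINT z:ball 0 \<rho>|lborel. (cmod z)\<^sup>2) = pi * \<rho> ^ 4 / 2"
proof -
  define p where "p = (\<lambda>x. of_real (cmod x) + of_real (Re x / cmod x) * x)"
  define q where "q = (\<lambda>x. of_real (cmod x) * \<i> + of_real (Im x / cmod x) * x)"
  have J: "\<bar>Im (cnj (p x) * q x)\<bar> = 2 * (cmod x)\<^sup>2" for x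
  proof (cases "x = 0")
    case False
    define s where "s = cmod x"
    have s: "s \<noteq> 0" "s\<^sup>2 = (Re x)\<^sup>2 + (Im x)\<^sup>2" using False by (auto simp: s_def cmod_power2)
    have "Im (cnj (p x) * q x) = s\<^sup>2 + (Re x)\<^sup>2 + (Im x)\<^sup>2"
      using s(1) unfolding p_def q_def s_def[symmetric] by (simp add: field_simps power2_eq_square)
    then show ?thesis using s(2) by (simp add: s_def)
  qed (simp add: p_def)
  have inj: "inj_on (\<lambda>z. of_real (cmod z) * z) (ball 0 \<rho>)"
  proof (rule inj_onI)
    fix x y :: complex assume e: "of_real (cmod x) * x = of_real (cmod y) * y"
    then have "(cmod x)\<^sup>2 = (cmod y)\<^sup>2" by (metis norm_mult norm_of_real abs_norm_cancel power2_eq_square)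
    then have "cmod x = cmod y" by (simp add: power2_eq_iff_nonneg)
    then show "x = y" using e by (cases "cmod x = 0") auto
  qed
  have im: "(\<lambda>z. of_real (cmod z) * z) ` ball 0 \<rho> = ball (0::complex) (\<rho>\<^sup>2)"
  proof (intro equalityI subsetI)
    fix w assume "w \<in> (\<lambda>z. of_real (cmod z) * z) ` ball 0 \<rho>"
    then obtain z where "cmod z < \<rho>" "w = of_real (cmod z) * z" by auto
    then show "w \<in> ball 0 (\<rho>\<^sup>2)" by (simp add: norm_mult power2_eq_square mult_strict_mono')
  next
    fix w :: complex assume "w \<in> ball 0 (\<rho>\<^sup>2)"
    then have w: "cmod w < \<rho>\<^sup>2" by simp
    define z where "z = of_real (1 / sqrt (cmod w)) * w"
    have cz: "cmod z = sqrt (cmod w)"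
      by (cases "w = 0") (simp_all add: z_def norm_mult norm_divide real_div_sqrt)
    have "w = of_real (cmod z) * z" unfolding cz by (cases "w = 0") (simp_all add: z_def)
    moreover have "cmod z < \<rho>" unfolding cz using w \<rho> real_sqrt_less_mono[OF w] by simp
    ultimately show "w \<in> (\<lambda>z. of_real (cmod z) * z) ` ball 0 \<rho>" by auto
  qed
  have int: "set_integrable lborel (ball (0::complex) \<rho>) (\<lambda>x. 2 * (cmod x)\<^sup>2)"
    by (rule set_integrable_ball) (intro continuous_intros)
  have "emeasure lborel ((\<lambda>z. of_real (cmod z) * z) ` ball (0::complex) \<rho>) = ennreal (LINT x:ball 0 \<rho>|lborel. \<bar>Im (cnj (p x) * q x)\<bar>)"
  proof (rule area_formula(2)[OF open_ball inj])
    show "((\<lambda>z. of_real (cmod z) * z) has_derivative rlin (p x) (q x)) (at x)" for x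
      unfolding p_def q_def by (rule has_derivative_norm_mult)
    show "set_integrable lborel (ball 0 \<rho>) (\<lambda>x. \<bar>Im (cnj (p x) * q x)\<bar>)" unfolding J by (rule int)
  qed
  then have "ennreal (pi * (\<rho>\<^sup>2)\<^sup>2) = ennreal (LINT x:ball (0::complex) \<rho>|lborel. 2 * (cmod x)\<^sup>2)"
    unfolding im J measure_disc[OF zero_le_power2] .
  moreover have "(LINT x:ball (0::complex) \<rho>|lborel. 2 * (cmod x)\<^sup>2) \<ge> 0"
    unfolding set_lebesgue_integral_def by (intro integral_nonneg_AE) auto
  ultimately have "pi * (\<rho>\<^sup>2)\<^sup>2 = (LINT x:ball (0::complex) \<rho>|lborel. 2 * (cmod x)\<^sup>2)" by (simp add: ennreal_inj)
  also have "\<dots> = 2 * (LINT x:ball (0::complex) \<rho>|lborel. (cmod x)\<^sup>2)" by simp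
  finally show ?thesis by (simp add: power_mult[symmetric])
qed

lemma integral_disc_rotation:
  fixes F :: "complex \<Rightarrow> complex"
  assumes F: "set_integrable lborel (ball 0 \<rho>) F" and \<eta>: "cmod \<eta> = 1"
  shows "(LINT z:ball 0 \<rho>|lborel. F (\<eta> * z)) = (LINT z:ball 0 \<rho>|lborel. F z)"
proof -
  define G where "G = (\<lambda>z. indicator (ball 0 \<rho>) z *\<^sub>R F z)"
  have [measurable]: "G \<in> borel_measurable borel"
    using F unfolding set_integrable_def G_def by (auto dest: borel_measurable_integrable)
  have "integral\<^sup>L lborel G = integral\<^sup>L (distr lborel borel (\<lambda>z. \<eta> * z)) G" by (simp only: lborel_rotation[OF \<eta>])
  also have "\<dots> = integral\<^sup>L lborel (\<lambda>z. G (\<eta> * z))" by (rule integral_distr) auto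
  also have "(\<lambda>z. G (\<eta> * z)) = (\<lambda>z. indicator (ball 0 \<rho>) z *\<^sub>R F (\<eta> * z))"
    by (auto simp: G_def indicator_def norm_mult \<eta>)
  finally show ?thesis unfolding set_lebesgue_integral_def G_def by simp
qed

text \<open>
  The rotation by \<pi> / j fixes the weight and changes the sign of z^j.
\<close>
lemma integral_disc_weighted_monomial:
  fixes w :: "complex \<Rightarrow> real"
  assumes w: "continuous_on (cball 0 \<rho>) w" "\<And>z \<eta>. cmod \<eta> = 1 \<Longrightarrow> w (\<eta> * z) = w z" and j: "j \<ge> 1"
  shows "(LINT z:ball 0 \<rho>|lborel. of_real (w z) * z ^ j) = 0"
proof -
  define \<eta> where "\<eta> = cis (pi / real j)"
  have \<eta>: "cmod \<eta> = 1" by (simp add: \<eta>_def)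
  have \<eta>j: "\<eta> ^ j = -1" using j by (simp add: \<eta>_def Complex.DeMoivre)
  have int: "set_integrable lborel (ball 0 \<rho>) (\<lambda>z. of_real (w z) * z ^ j)"
    by (rule set_integrable_ball) (intro continuous_intros w)
  have "(LINT z:ball 0 \<rho>|lborel. of_real (w z) * z ^ j) = (LINT z:ball 0 \<rho>|lborel. of_real (w (\<eta> * z)) * (\<eta> * z) ^ j)"
    by (rule integral_disc_rotation[OF int \<eta>, symmetric])
  also have "\<dots> = (LINT z:ball 0 \<rho>|lborel. - (of_real (w z) * z ^ j))"
    by (simp add: w(2)[OF \<eta>] power_mult_distrib \<eta>j)
  also have "\<dots> = - (LINT z:ball 0 \<rho>|lborel. of_real (w z) * z ^ j)"
    by (simp add: set_lebesgue_integral_def)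
  finally show ?thesis by simp
qed

lemma integral_disc_weighted_holomorphic:
  fixes w :: "complex \<Rightarrow> real"
  assumes w: "continuous_on (cball 0 \<rho>) w" "\<And>z \<eta>. cmod \<eta> = 1 \<Longrightarrow> w (\<eta> * z) = w z"
    and k: "k holomorphic_on unit_disc" "k 0 = 0" and \<rho>: "0 < \<rho>" "\<rho> < 1"
  shows "(LINT z:ball 0 \<rho>|lborel. of_real (w z) * k z) = 0"
proof -
  define c where "c = (\<lambda>n. (deriv ^^ n) k 0 / fact n)"
  have ser: "(\<lambda>n. c n * z ^ n) sums k z" if "z \<in> unit_disc" for z
    using holomorphic_imp_has_power_series[OF k(1)] that unfolding has_power_series_def c_def by blast
  have c0: "c 0 = 0" using k(2) by (simp add: c_def)
  have "summable (\<lambda>n. c n * (of_real ((1 + \<rho>) / 2)) ^ n)"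
    using ser[of "of_real ((1 + \<rho>) / 2)"] \<rho> by (simp add: sums_iff del: of_real_divide of_real_add)
  then have abs: "summable (\<lambda>n. cmod (c n) * \<rho> ^ n)"
    using powser_insidea[of c "of_real ((1 + \<rho>) / 2)" "of_real \<rho>"] \<rho>
    by (simp add: norm_mult norm_power del: of_real_divide of_real_add)
  obtain W where W: "\<And>z. z \<in> cball 0 \<rho> \<Longrightarrow> \<bar>w z\<bar> \<le> W" "W \<ge> 0"
  proof -
    have "compact (w ` cball 0 \<rho>)" by (rule compact_continuous_image[OF w(1)]) simp
    then have "bounded (w ` cball 0 \<rho>)" by (rule compact_imp_bounded)
    then obtain W where "\<forall>x\<in>w ` cball 0 \<rho>. norm x \<le> W" unfolding bounded_iff by blast
    then show thesis using that[of "max W 0"] by (auto simp: le_max_iff_disj)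
  qed
  define t where "t = (\<lambda>n z. indicator (ball (0::complex) \<rho>) z *\<^sub>R (of_real (w z) * (c n * z ^ n)))"
  have int: "integrable lborel (t n)" for n
  proof -
    have "set_integrable lborel (ball 0 \<rho>) (\<lambda>z. of_real (w z) * (c n * z ^ n))"
      by (rule set_integrable_ball) (intro continuous_intros w)
    then show ?thesis by (simp add: set_integrable_def t_def)
  qed
  have bd: "norm (t n z) \<le> indicator (ball 0 \<rho>) z * (W * (cmod (c n) * \<rho> ^ n))" for n z
  proof (cases "z \<in> ball 0 \<rho>")
    case True
    then have "\<bar>w z\<bar> * (cmod (c n) * cmod z ^ n) \<le> W * (cmod (c n) * \<rho> ^ n)"
      using W by (intro mult_mono mult_nonneg_nonneg power_mono) auto
    then show ?thesis using True by (simp add: t_def norm_mult norm_power)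
  qed (simp add: t_def)
  have bd': "norm (t n z) \<le> W * (cmod (c n) * \<rho> ^ n)" for n z
  proof -
    have "0 \<le> W * (cmod (c n) * \<rho> ^ n)" using W(2) \<rho> by simp
    then show ?thesis using bd[of n z] by (cases "z \<in> ball 0 \<rho>") (simp_all add: indicator_def)
  qed
  have sumW: "summable (\<lambda>n. W * (cmod (c n) * \<rho> ^ n))" by (rule summable_mult[OF abs])
  have I0: "integral\<^sup>L lborel (t n) = 0" for n
  proof (cases "n = 0")
    case True then show ?thesis by (simp add: t_def c0)
  next
    case False
    have "t n = (\<lambda>z. c n * (indicator (ball 0 \<rho>) z *\<^sub>R (of_real (w z) * z ^ n)))" by (auto simp: t_def indicator_def)
    then have "integral\<^sup>L lborel (t n) = c n * (LINT z:ball 0 \<rho>|lborel. of_real (w z) * z ^ n)"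
      by (simp only: set_lebesgue_integral_def integral_mult_right_zero)
    then show ?thesis using integral_disc_weighted_monomial[OF w, of n] False by simp
  qed
  have "integral\<^sup>L lborel (\<lambda>z. \<Sum>n. t n z) = (\<Sum>n. integral\<^sup>L lborel (t n))"
  proof (rule integral_suminf[OF int])
    show "AE z in lborel. summable (\<lambda>n. norm (t n z))"
    proof (rule AE_I2)
      fix z
      show "summable (\<lambda>n. norm (t n z))"
        by (rule summable_comparison_test'[OF sumW, of 0])
           (simp add: bd')
    qed
    show "summable (\<lambda>n. LINT z|lborel. norm (t n z))"
    proof (rule summable_comparison_test'[OF summable_mult[OF sumW, of "measure lborel (ball (0::complex) \<rho>)"], of 0])
      fix n
      have bi: "integrable lborel (\<lambda>z. indicator (ball (0::complex) \<rho>) z * (W * (cmod (c n) * \<rho> ^ n)))"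
        by (intro integrable_mult_left integrable_real_indicator) (auto simp: measure_disc \<rho> less_imp_le)
      have "(LINT z|lborel. norm (t n z)) \<le> (LINT z|lborel. indicator (ball (0::complex) \<rho>) z * (W * (cmod (c n) * \<rho> ^ n)))"
        by (intro integral_mono integrable_norm int bi bd)
      also have "\<dots> = measure lborel (ball (0::complex) \<rho>) * (W * (cmod (c n) * \<rho> ^ n))" by simp
      finally show "norm (LINT z|lborel. norm (t n z)) \<le> measure lborel (ball (0::complex) \<rho>) * (W * (cmod (c n) * \<rho> ^ n))"
        by simp
    qed
  qed
  moreover have "(\<Sum>n. t n z) = indicator (ball 0 \<rho>) z *\<^sub>R (of_real (w z) * k z)" for z
  proof (cases "z \<in> ball 0 \<rho>")
    case True
    then have "z \<in> unit_disc" using \<rho> by simp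
    from sums_mult[OF ser[OF this], of "of_real (w z)"] have "(\<lambda>n. t n z) sums (of_real (w z) * k z)"
      using True by (simp add: t_def)
    then show ?thesis using True by (simp add: sums_iff)
  qed (simp add: t_def)
  ultimately show ?thesis by (simp add: I0 set_lebesgue_integral_def)
qed

section \<open>The area of the image\<close>

text \<open>
  With k = h' - 1 and the radial weight w = 1 - |\<alpha> z|^2 the Jacobian is w (1 + 2 Re k + |k|^2). The term with
  Re k integrates to zero because k vanishes at 0.
\<close>
lemma M_pair_area_subdisc:
  assumes M: "M_pair \<alpha> h g" and \<alpha>: "cmod \<alpha> \<le> 1"
    and f: "\<And>z. z \<in> unit_disc \<Longrightarrow> f z = h z + cnj (g z)" and \<rho>: "0 < \<rho>" "\<rho> < 1"
  shows "emeasure lborel (f ` ball 0 \<rho>) = ennreal (pi * \<rho>\<^sup>2 - (cmod \<alpha>)\<^sup>2 * (pi * \<rho> ^ 4 / 2)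
      + (LINT z:ball 0 \<rho>|lborel. (1 - (cmod \<alpha>)\<^sup>2 * (cmod z)\<^sup>2) * (cmod (deriv h z - 1))\<^sup>2))"
proof -
  define w where "w = (\<lambda>z. 1 - (cmod \<alpha>)\<^sup>2 * (cmod z)\<^sup>2)"
  define k where "k = (\<lambda>z. deriv h z - 1)"
  have hol: "open unit_disc" "h holomorphic_on unit_disc" "g holomorphic_on unit_disc"
    and h0: "deriv h 0 = 1" and g': "\<And>z. z \<in> unit_disc \<Longrightarrow> deriv g z = \<alpha> * z * deriv h z"
    using M unfolding M_pair_def by auto
  have khol: "k holomorphic_on unit_disc" unfolding k_def using hol by (intro holomorphic_intros holomorphic_deriv)
  have sub: "ball 0 \<rho> \<subseteq> unit_disc" "cball 0 \<rho> \<subseteq> unit_disc" using \<rho> by auto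
  have ck: "continuous_on (cball 0 \<rho>) k"
    using khol sub(2) holomorphic_on_imp_continuous_on continuous_on_subset by blast
  have cw: "continuous_on A w" for A unfolding w_def by (intro continuous_intros)
  define p where "p = (\<lambda>z. deriv h z + cnj (deriv g z))"
  define q where "q = (\<lambda>z. \<i> * (deriv h z - cnj (deriv g z)))"
  have J: "\<bar>Im (cnj (p z) * q z)\<bar> = w z + (2 * Re (of_real (w z) * k z) + w z * (cmod (k z))\<^sup>2)" if z: "z \<in> unit_disc" for z
  proof -
    have "Im (cnj (p z) * q z) = (cmod (deriv h z))\<^sup>2 - (cmod (deriv g z))\<^sup>2"
      using jacobian_identity[of "deriv h z" "deriv g z" 1] by (simp add: p_def q_def)
    moreover from this have "Im (cnj (p z) * q z) > 0" using M_pair_sense_preserving[OF M \<alpha> z] by simp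
    moreover have "(cmod (deriv g z))\<^sup>2 = (cmod \<alpha>)\<^sup>2 * (cmod z)\<^sup>2 * (cmod (deriv h z))\<^sup>2"
      using g'[OF z] by (simp add: norm_mult power_mult_distrib)
    ultimately have "\<bar>Im (cnj (p z) * q z)\<bar> = w z * (cmod (deriv h z))\<^sup>2"
      by (simp add: w_def algebra_simps)
    also have "(cmod (deriv h z))\<^sup>2 = 1 + 2 * Re (k z) + (cmod (k z))\<^sup>2"
      unfolding cmod_power2 k_def by (simp add: power2_eq_square algebra_simps)
    finally show ?thesis by (simp add: algebra_simps)
  qed
  have i1: "set_integrable lborel (ball 0 \<rho>) w" by (rule set_integrable_ball[OF cw])
  have i2: "set_integrable lborel (ball 0 \<rho>) (\<lambda>z. of_real (w z) * k z)"
    by (rule set_integrable_ball) (intro continuous_intros cw ck)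
  have i3: "set_integrable lborel (ball 0 \<rho>) (\<lambda>z. 2 * Re (of_real (w z) * k z))"
    by (rule set_integrable_ball) (intro continuous_intros cw ck)
  have i4: "set_integrable lborel (ball 0 \<rho>) (\<lambda>z. w z * (cmod (k z))\<^sup>2)"
    by (rule set_integrable_ball) (intro continuous_intros cw ck)
  have iJ: "set_integrable lborel (ball 0 \<rho>) (\<lambda>z. w z + (2 * Re (of_real (w z) * k z) + w z * (cmod (k z))\<^sup>2))"
    by (intro set_integral_add(1) i1 i3 i4)
  have Jind: "indicator (ball 0 \<rho>) z *\<^sub>R \<bar>Im (cnj (p z) * q z)\<bar>
      = indicator (ball 0 \<rho>) z *\<^sub>R (w z + (2 * Re (of_real (w z) * k z) + w z * (cmod (k z))\<^sup>2))" for z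
    using J[of z] sub(1) by (auto simp: indicator_def simp del: of_real_mult)
  have e1: "(LINT z:ball 0 \<rho>|lborel. w z) = pi * \<rho>\<^sup>2 - (cmod \<alpha>)\<^sup>2 * (pi * \<rho> ^ 4 / 2)"
  proof -
    have "(LINT z:ball 0 \<rho>|lborel. w z) = (LINT z:ball (0::complex) \<rho>|lborel. 1) - (LINT z:ball (0::complex) \<rho>|lborel. (cmod \<alpha>)\<^sup>2 * (cmod z)\<^sup>2)"
      unfolding w_def by (rule set_integral_diff(2)) (rule set_integrable_ball; intro continuous_intros)+
    moreover have "(LINT z:ball (0::complex) \<rho>|lborel. 1) = pi * \<rho>\<^sup>2"
      using measure_disc[of \<rho>] \<rho> by (simp add: set_lebesgue_integral_def measure_def)
    ultimately show ?thesis using integral_disc_norm_squared[OF \<rho>(1)] by simp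
  qed
  have e2: "(LINT z:ball 0 \<rho>|lborel. 2 * Re (of_real (w z) * k z)) = 0"
  proof -
    have wr: "w (\<eta> * z) = w z" if "cmod \<eta> = 1" for z \<eta> using that by (simp add: w_def norm_mult)
    have "(LINT z:ball 0 \<rho>|lborel. of_real (w z) * k z) = 0"
      by (rule integral_disc_weighted_holomorphic[OF cw wr khol _ \<rho>]) (simp_all add: k_def h0)
    moreover have "(LINT z|lborel. Re (indicator (ball 0 \<rho>) z *\<^sub>R (of_real (w z) * k z))) = Re (LINT z:ball 0 \<rho>|lborel. of_real (w z) * k z)"
      using i2 unfolding set_integrable_def set_lebesgue_integral_def by (rule integral_Re)
    ultimately have "(LINT z:ball 0 \<rho>|lborel. Re (of_real (w z) * k z)) = 0"
      unfolding set_lebesgue_integral_def by (simp del: Re_complex_of_real times_complex.sel)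
    then show ?thesis by simp
  qed
  have "emeasure lborel (f ` ball 0 \<rho>) = ennreal (LINT z:ball 0 \<rho>|lborel. \<bar>Im (cnj (p z) * q z)\<bar>)"
  proof (rule area_formula(2)[OF open_ball])
    show "inj_on f (ball 0 \<rho>)" using M_pair_inj[OF M \<alpha> f] sub(1) by (rule inj_on_subset)
    show "(f has_derivative rlin (p z) (q z)) (at z)" if "z \<in> ball 0 \<rho>" for z
      unfolding p_def q_def using has_derivative_rlin_add_cnj[OF hol _ f] that sub(1) by blast
    show "set_integrable lborel (ball 0 \<rho>) (\<lambda>z. \<bar>Im (cnj (p z) * q z)\<bar>)"
      using iJ unfolding set_integrable_def Jind .
  qed
  also have "(LINT z:ball 0 \<rho>|lborel. \<bar>Im (cnj (p z) * q z)\<bar>)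
      = (LINT z:ball 0 \<rho>|lborel. w z + (2 * Re (of_real (w z) * k z) + w z * (cmod (k z))\<^sup>2))"
    unfolding set_lebesgue_integral_def Jind ..
  also have "\<dots> = (LINT z:ball 0 \<rho>|lborel. w z) + ((LINT z:ball 0 \<rho>|lborel. 2 * Re (of_real (w z) * k z))
      + (LINT z:ball 0 \<rho>|lborel. w z * (cmod (k z))\<^sup>2))"
    by (simp only: set_integral_add(2)[OF i1 set_integral_add(1)[OF i3 i4]] set_integral_add(2)[OF i3 i4])
  finally show ?thesis unfolding e1 e2 by (simp add: w_def k_def)
qed

lemma weight_pos:
  assumes "cmod \<alpha> \<le> 1" "z \<in> unit_disc" shows "1 - (cmod \<alpha>)\<^sup>2 * (cmod z)\<^sup>2 > 0"
proof -
  have "(cmod \<alpha>)\<^sup>2 \<le> 1" using assms(1) by (simp add: power_le_one)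
  then have "(cmod \<alpha>)\<^sup>2 * (cmod z)\<^sup>2 \<le> 1 * (cmod z)\<^sup>2" by (intro mult_right_mono) auto
  moreover have "(cmod z)\<^sup>2 < 1" using assms(2) by (simp add: abs_square_less_1)
  ultimately show ?thesis by simp
qed

lemma area_limit:
  fixes a \<delta> :: real
  assumes "(\<rho> \<longlongrightarrow> 1) F"
  shows "((\<lambda>x. pi * (\<rho> x)\<^sup>2 - a * (pi * \<rho> x ^ 4 / 2) + \<delta>) \<longlongrightarrow> pi * (1 - a / 2) + \<delta>) F"
proof -
  have "((\<lambda>x. pi * (\<rho> x)\<^sup>2 - a * (pi * \<rho> x ^ 4 / 2) + \<delta>) \<longlongrightarrow> pi * 1\<^sup>2 - a * (pi * 1 ^ 4 / 2) + \<delta>) F"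
    by (intro tendsto_intros assms) auto
  then show ?thesis by (simp add: algebra_simps)
qed

text \<open>
  The areas of the images of smaller discs, in the limit \<rho> \<rightarrow> 1; \<delta> is the contribution of h' - 1.
\<close>
lemma M_pair_area_ge:
  assumes M: "M_pair \<alpha> h g" and \<alpha>: "cmod \<alpha> \<le> 1"
    and f: "\<And>z. z \<in> unit_disc \<Longrightarrow> f z = h z + cnj (g z)"
    and \<rho>0: "0 < \<rho>0" "\<rho>0 < 1"
    and \<delta>: "\<And>\<rho>. \<rho>0 \<le> \<rho> \<Longrightarrow> \<rho> < 1 \<Longrightarrow>
      (LINT z:ball 0 \<rho>|lborel. (1 - (cmod \<alpha>)\<^sup>2 * (cmod z)\<^sup>2) * (cmod (deriv h z - 1))\<^sup>2) \<ge> \<delta>"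
  shows "emeasure lebesgue (f ` unit_disc) \<ge> ennreal (pi * (1 - (cmod \<alpha>)\<^sup>2 / 2) + \<delta>)"
proof -
  have hol: "open unit_disc" "h holomorphic_on unit_disc" "g holomorphic_on unit_disc"
    using M unfolding M_pair_def by auto
  have cont: "continuous_on unit_disc f" by (rule continuous_on_add_cnj[OF hol f])
  have op: "open (f ` unit_disc)" by (rule invariance_of_domain[OF cont hol(1) M_pair_inj[OF M \<alpha> f]])
  define A where "A = (\<lambda>\<rho>. pi * \<rho>\<^sup>2 - (cmod \<alpha>)\<^sup>2 * (pi * \<rho> ^ 4 / 2) + \<delta>)"
  have "ennreal (A \<rho>) \<le> emeasure lborel (f ` unit_disc)" if r: "\<rho>0 \<le> \<rho>" "\<rho> < 1" for \<rho>
  proof -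
    have "0 < \<rho>" using \<rho>0(1) r(1) by linarith
    from M_pair_area_subdisc[OF M \<alpha> f this r(2)]
    have eq: "emeasure lborel (f ` ball 0 \<rho>) = ennreal (pi * \<rho>\<^sup>2 - (cmod \<alpha>)\<^sup>2 * (pi * \<rho> ^ 4 / 2)
      + (LINT z:ball 0 \<rho>|lborel. (1 - (cmod \<alpha>)\<^sup>2 * (cmod z)\<^sup>2) * (cmod (deriv h z - 1))\<^sup>2))" by blast
    have "ennreal (A \<rho>) \<le> emeasure lborel (f ` ball 0 \<rho>)"
      unfolding eq A_def by (intro ennreal_leI add_left_mono \<delta>[OF r])
    also have "\<dots> \<le> emeasure lborel (f ` unit_disc)"
      using op r by (intro emeasure_mono image_mono) auto
    finally show ?thesis .
  qed
  then have "eventually (\<lambda>\<rho>. ennreal (A \<rho>) \<le> emeasure lborel (f ` unit_disc)) (at_left 1)"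
    using eventually_at_left_real[OF \<rho>0(2)] by (auto elim!: eventually_mono)
  moreover have "((\<lambda>\<rho>. ennreal (A \<rho>)) \<longlongrightarrow> ennreal (pi * (1 - (cmod \<alpha>)\<^sup>2 / 2) + \<delta>)) (at_left 1)"
    unfolding A_def by (intro tendsto_ennrealI area_limit tendsto_ident_at)
  ultimately have "ennreal (pi * (1 - (cmod \<alpha>)\<^sup>2 / 2) + \<delta>) \<le> emeasure lborel (f ` unit_disc)"
    by (intro tendsto_upperbound) auto
  then show ?thesis using op by (simp add: emeasure_completion)
qed

lemma M_pair_area_min:
  assumes M: "M_pair \<alpha> h g" and \<alpha>: "cmod \<alpha> \<le> 1"
    and f: "\<And>z. z \<in> unit_disc \<Longrightarrow> f z = h z + cnj (g z)"
  shows "emeasure lebesgue (f ` unit_disc) \<ge> ennreal (pi * (1 - (cmod \<alpha>)\<^sup>2 / 2))"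
proof -
  have nonneg: "(LINT z:ball 0 \<rho>|lborel. (1 - (cmod \<alpha>)\<^sup>2 * (cmod z)\<^sup>2) * (cmod (deriv h z - 1))\<^sup>2) \<ge> 0"
    if "\<rho> < 1" for \<rho>
    unfolding set_lebesgue_integral_def
  proof (rule integral_nonneg_AE[OF AE_I2])
    fix z
    show "0 \<le> indicator (ball 0 \<rho>) z *\<^sub>R ((1 - (cmod \<alpha>)\<^sup>2 * (cmod z)\<^sup>2) * (cmod (deriv h z - 1))\<^sup>2)"
      using weight_pos[OF \<alpha>, of z] that by (cases "z \<in> ball 0 \<rho>") auto
  qed
  show ?thesis using M_pair_area_ge[OF M \<alpha> f, of "1/2" 0] nonneg by simp
qed

text \<open>
  Near z0 the integrand containing h' - 1 is bounded below by a positive constant.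
\<close>
lemma M_pair_area_gt:
  assumes M: "M_pair \<alpha> h g" and \<alpha>: "cmod \<alpha> \<le> 1"
    and f: "\<And>z. z \<in> unit_disc \<Longrightarrow> f z = h z + cnj (g z)"
    and z0: "z0 \<in> unit_disc" "deriv h z0 \<noteq> 1"
  shows "emeasure lebesgue (f ` unit_disc) > ennreal (pi * (1 - (cmod \<alpha>)\<^sup>2 / 2))"
proof -
  have hol: "open unit_disc" "h holomorphic_on unit_disc" using M unfolding M_pair_def by auto
  define \<phi> where "\<phi> = (\<lambda>z. (1 - (cmod \<alpha>)\<^sup>2 * (cmod z)\<^sup>2) * (cmod (deriv h z - 1))\<^sup>2)"
  have c\<phi>: "continuous_on unit_disc \<phi>"
    unfolding \<phi>_def
    by (intro continuous_intros holomorphic_on_imp_continuous_on holomorphic_deriv hol)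
  have pos: "\<phi> z \<ge> 0" if "z \<in> unit_disc" for z using weight_pos[OF \<alpha> that] by (simp add: \<phi>_def)
  have \<phi>0: "\<phi> z0 > 0" using weight_pos[OF \<alpha> z0(1)] z0(2) by (simp add: \<phi>_def)
  obtain \<rho>0 where \<rho>0: "cmod z0 < \<rho>0" "\<rho>0 < 1" using z0(1) dense[of "cmod z0" 1] by auto
  have "isCont \<phi> z0" using c\<phi> hol(1) z0(1) continuous_on_eq_continuous_at by blast
  then obtain e1 where e1: "e1 > 0" "\<And>z. dist z z0 < e1 \<Longrightarrow> dist (\<phi> z) (\<phi> z0) < \<phi> z0 / 2"
    using \<phi>0 half_gt_zero[OF \<phi>0] unfolding continuous_at_eps_delta by blast
  define e where "e = min e1 (\<rho>0 - cmod z0)"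
  have e: "e > 0" using e1 \<rho>0 by (simp add: e_def)
  have \<phi>e: "\<phi> z \<ge> \<phi> z0 / 2" if "z \<in> ball z0 e" for z
  proof -
    have "dist z z0 < e1" using that by (simp add: e_def dist_commute)
    from e1(2)[OF this] have "\<bar>\<phi> z - \<phi> z0\<bar> < \<phi> z0 / 2" unfolding dist_real_def .
    then show ?thesis by linarith
  qed
  have sub: "ball z0 e \<subseteq> ball 0 \<rho>0"
  proof
    fix z assume "z \<in> ball z0 e"
    then have "cmod (z - z0) < \<rho>0 - cmod z0" by (simp add: e_def dist_norm norm_minus_commute)
    then show "z \<in> ball 0 \<rho>0" using norm_triangle_ineq[of "z - z0" z0] by simp
  qed
  define \<delta> where "\<delta> = \<phi> z0 / 2 * measure lborel (ball z0 e)"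
  have \<delta>: "\<delta> > 0" using \<phi>0 e by (simp add: \<delta>_def)
  have "emeasure lebesgue (f ` unit_disc) \<ge> ennreal (pi * (1 - (cmod \<alpha>)\<^sup>2 / 2) + \<delta>)"
  proof (rule M_pair_area_ge[OF M \<alpha> f _ \<rho>0(2)])
    show "0 < \<rho>0" using \<rho>0(1) norm_ge_zero[of z0] by linarith
    fix \<rho> assume r: "\<rho>0 \<le> \<rho>" "\<rho> < 1"
    have i: "set_integrable lborel (ball 0 \<rho>) \<phi>"
      by (rule set_integrable_ball[OF continuous_on_subset[OF c\<phi>]]) (use r in auto)
    have "\<delta> = (LINT z|lborel. indicator (ball z0 e) z * (\<phi> z0 / 2))" by (simp add: \<delta>_def)
    also have "\<dots> \<le> (LINT z|lborel. indicator (ball 0 \<rho>) z *\<^sub>R \<phi> z)"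
    proof (rule integral_mono)
      show "integrable lborel (\<lambda>z. indicator (ball z0 e) z * (\<phi> z0 / 2))"
        by (intro integrable_mult_left integrable_real_indicator) (auto simp: emeasure_ball e less_imp_le)
      show "integrable lborel (\<lambda>z. indicator (ball 0 \<rho>) z *\<^sub>R \<phi> z)" using i by (simp add: set_integrable_def)
      fix z
      show "indicator (ball z0 e) z * (\<phi> z0 / 2) \<le> indicator (ball 0 \<rho>) z *\<^sub>R \<phi> z"
      proof (cases "z \<in> ball z0 e")
        case True
        then have "z \<in> ball 0 \<rho>" using sub r by auto
        then show ?thesis using True \<phi>e by simp
      next
        case False
        then show ?thesis using pos[of z] r by (cases "z \<in> ball 0 \<rho>") auto
      qed
    qed
    finally show "\<delta> \<le> (LINT z:ball 0 \<rho>|lborel. (1 - (cmod \<alpha>)\<^sup>2 * (cmod z)\<^sup>2) * (cmod (deriv h z - 1))\<^sup>2)"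
      by (simp add: set_lebesgue_integral_def \<phi>_def)
  qed
  moreover have "ennreal (pi * (1 - (cmod \<alpha>)\<^sup>2 / 2)) < ennreal (pi * (1 - (cmod \<alpha>)\<^sup>2 / 2) + \<delta>)"
  proof -
    have "(cmod \<alpha>)\<^sup>2 \<le> 1" using \<alpha> by (simp add: power_le_one)
    then have "pi * (1 - (cmod \<alpha>)\<^sup>2 / 2) \<ge> 0" by simp
    then show ?thesis using \<delta> by (intro ennreal_lessI) auto
  qed
  ultimately show ?thesis by (rule less_le_trans[rotated])
qed

lemma M_pair_g_extremal: "M_pair \<alpha> (\<lambda>z. z) (\<lambda>z. \<alpha> * z\<^sup>2 / 2)"
proof -
  have 1: "((\<lambda>z. \<alpha> * z\<^sup>2 / 2) has_field_derivative \<alpha> * z) (at z)" for z :: complex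
    by (auto intro!: derivative_eq_intros)
  have "deriv (\<lambda>z. z) = (\<lambda>z::complex. 1)" by (auto simp: fun_eq_iff)
  then show ?thesis unfolding M_pair_def using DERIV_imp_deriv[OF 1]
    by (auto intro!: holomorphic_intros)
qed

lemma g_extremal_decomp: "g_extremal \<alpha> z = z + cnj (\<alpha> * z\<^sup>2 / 2)"
  by (simp add: g_extremal_def)

lemma area_g_extremal:
  assumes \<alpha>: "cmod \<alpha> \<le> 1" and f: "\<And>z. z \<in> unit_disc \<Longrightarrow> f z = g_extremal \<alpha> z"
  shows "emeasure lebesgue (f ` unit_disc) = ennreal (pi * (1 - (cmod \<alpha>)\<^sup>2 / 2))"
proof -
  have f': "f z = z + cnj (\<alpha> * z\<^sup>2 / 2)" if "z \<in> unit_disc" for z using f[OF that] g_extremal_decomp by metis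
  note M = M_pair_g_extremal[of \<alpha>]
  have hol: "open unit_disc" "(\<lambda>z. z) holomorphic_on unit_disc" "(\<lambda>z. \<alpha> * z\<^sup>2 / 2) holomorphic_on unit_disc"
    by (auto intro!: holomorphic_intros)
  have cont: "continuous_on unit_disc f" by (rule continuous_on_add_cnj[OF hol f'])
  have inj: "inj_on f unit_disc" by (rule M_pair_inj[OF M \<alpha> f'])
  have op: "open (f ` unit_disc)" by (rule invariance_of_domain[OF cont hol(1) inj])
  define \<rho> where "\<rho> = (\<lambda>n. 1 - 1 / (real n + 2))"
  have \<rho>: "0 < \<rho> n" "\<rho> n < 1" for n using disc_exhaustion(1,2) by (simp_all add: \<rho>_def)
  have dd: "deriv (\<lambda>z. z) = (\<lambda>z::complex. 1)" by (auto simp: fun_eq_iff)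
  have A: "emeasure lborel (f ` ball 0 (\<rho> n)) = ennreal (pi * (\<rho> n)\<^sup>2 - (cmod \<alpha>)\<^sup>2 * (pi * \<rho> n ^ 4 / 2) + 0)" for n
    using M_pair_area_subdisc[OF M \<alpha> f' \<rho>] unfolding dd by (simp add: set_lebesgue_integral_def)
  have sub: "ball 0 (\<rho> n) \<subseteq> unit_disc" for n using \<rho>[of n] by auto
  have lim: "(\<lambda>n. emeasure lborel (f ` ball 0 (\<rho> n))) \<longlonglongrightarrow> emeasure lborel (\<Union>n. f ` ball 0 (\<rho> n))"
  proof (rule Lim_emeasure_incseq)
    have "open (f ` ball 0 (\<rho> n))" for n
      by (rule invariance_of_domain[OF continuous_on_subset[OF cont sub] open_ball inj_on_subset[OF inj sub]])
    then show "range (\<lambda>n. f ` ball 0 (\<rho> n)) \<subseteq> sets lborel" by auto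
    show "incseq (\<lambda>n. f ` ball 0 (\<rho> n))"
      unfolding incseq_def \<rho>_def by (intro allI impI image_mono subset_ball disc_exhaustion(3))
  qed
  have im: "(\<Union>n. f ` ball 0 (\<rho> n)) = f ` unit_disc"
    unfolding image_UN[symmetric] \<rho>_def disc_exhaustion(4) ..
  have "(\<lambda>n. emeasure lborel (f ` ball 0 (\<rho> n))) \<longlonglongrightarrow> ennreal (pi * (1 - (cmod \<alpha>)\<^sup>2 / 2) + 0)"
    unfolding A
  proof (rule tendsto_ennrealI)
    have "\<rho> \<longlonglongrightarrow> 1" unfolding \<rho>_def by (rule disc_exhaustion(5))
    then show "(\<lambda>n. pi * (\<rho> n)\<^sup>2 - (cmod \<alpha>)\<^sup>2 * (pi * \<rho> n ^ 4 / 2) + 0) \<longlonglongrightarrow> pi * (1 - (cmod \<alpha>)\<^sup>2 / 2) + 0"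
      by (rule area_limit)
  qed
  from LIMSEQ_unique[OF lim[unfolded im] this]
  have "emeasure lborel (f ` unit_disc) = ennreal (pi * (1 - (cmod \<alpha>)\<^sup>2 / 2))" by simp
  then show ?thesis using op by (simp add: emeasure_completion)
qed

lemma M_pair_trivial_imp_g_extremal:
  assumes M: "M_pair \<alpha> h g" and h': "\<And>z. z \<in> unit_disc \<Longrightarrow> deriv h z = 1" and z: "z \<in> unit_disc"
  shows "h z + cnj (g z) = g_extremal \<alpha> z"
proof -
  have hg: "h holomorphic_on unit_disc" "g holomorphic_on unit_disc" "h 0 = 0" "g 0 = 0"
    and g': "\<And>z. z \<in> unit_disc \<Longrightarrow> deriv g z = \<alpha> * z * deriv h z" using M unfolding M_pair_def by auto
  have const: "F z = F 0" if F: "\<And>x. x \<in> unit_disc \<Longrightarrow> (F has_field_derivative 0) (at x)" for F :: "complex \<Rightarrow> complex"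
  proof -
    have "\<exists>c. \<forall>x\<in>unit_disc. F x = c"
      by (rule has_field_derivative_zero_constant[OF convex_ball]) (rule has_field_derivative_at_within[OF F])
    then show ?thesis using z by auto
  qed
  have "((\<lambda>x. h x - x) has_field_derivative 0) (at x)" if "x \<in> unit_disc" for x
    using holomorphic_derivI[OF hg(1) open_ball that] h'[OF that] by (auto intro!: derivative_eq_intros)
  from const[OF this] have "h z = z" using hg by simp
  moreover have "((\<lambda>x. g x - \<alpha> * x\<^sup>2 / 2) has_field_derivative 0) (at x)" if "x \<in> unit_disc" for x
    using holomorphic_derivI[OF hg(2) open_ball that] h'[OF that] g'[OF that] by (auto intro!: derivative_eq_intros)
  from const[OF this] have "g z = \<alpha> * z\<^sup>2 / 2" using hg by simp
  ultimately show ?thesis by (simp only: g_extremal_decomp)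
qed

theorem theorem3p1:
  fixes \<alpha> :: complex
  assumes "cmod \<alpha> \<le> 1"
  shows
    "class_M \<alpha> \<subseteq> class_CH0 \<and>
     (\<forall>f\<in>class_M \<alpha>. \<forall>h g a b.
        harmonic_decomposition f h g \<and> has_power_series h a \<and> has_power_series g b \<longrightarrow>
        b 1 = deriv g 0 \<and> deriv g 0 = 0 \<and>
        (\<forall>n\<ge>2. cmod (a n) \<le> (real n + 1) / 2 \<and> cmod (b n) \<le> (real n - 1) / 2 * cmod \<alpha>)) \<and>
     (\<forall>n\<ge>2.
        (\<exists>f\<in>class_M \<alpha>. \<exists>h g a. harmonic_decomposition f h g \<and> has_power_series h a \<and>
            cmod (a n) = (real n + 1) / 2) \<and>
        (\<exists>f\<in>class_M \<alpha>. \<exists>h g b. harmonic_decomposition f h g \<and> has_power_series g b \<and>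
            cmod (b n) = (real n - 1) / 2 * cmod \<alpha>)) \<and>
     (\<forall>f\<in>class_M \<alpha>. \<forall>z\<in>unit_disc.
        cmod (f z) \<le> cmod z / (1 - cmod z)\<^sup>2 * (1 - 1 / 2 * (1 - cmod \<alpha>) * cmod z)) \<and>
     (\<forall>r::real. 0 < r \<and> r < 1 \<longrightarrow>
        (\<exists>f\<in>class_M \<alpha>. \<exists>z. cmod z = r \<and>
           cmod (f z) = cmod z / (1 - cmod z)\<^sup>2 * (1 - 1 / 2 * (1 - cmod \<alpha>) * cmod z))) \<and>
     (\<forall>f\<in>class_M \<alpha>. emeasure lebesgue (f ` unit_disc) \<ge> ennreal (pi * (1 - (cmod \<alpha>)\<^sup>2 / 2))) \<and>
     g_extremal \<alpha> \<in> class_M \<alpha> \<and>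
     (\<forall>f\<in>class_M \<alpha>. emeasure lebesgue (f ` unit_disc) = ennreal (pi * (1 - (cmod \<alpha>)\<^sup>2 / 2)) \<longleftrightarrow>
        (\<forall>z\<in>unit_disc. f z = g_extremal \<alpha> z))"
proof (intro conjI ballI allI impI iffI)
  show "class_M \<alpha> \<subseteq> class_CH0" by (rule class_M_subset_class_CH0[OF assms])
next
  fix f h g a b
  assume f: "f \<in> class_M \<alpha>" and d: "harmonic_decomposition f h g \<and> has_power_series h a \<and> has_power_series g b"
  have M: "M_pair \<alpha> h g" using class_M_decomposition[OF f] d by blast
  note C = M_pair_coeffs[OF M conjunct1[OF conjunct2[OF d]] conjunct2[OF conjunct2[OF d]]]
  show "b 1 = deriv g 0" "deriv g 0 = 0" by (fact C(1), fact C(2))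
  fix n :: nat assume "2 \<le> n"
  then show "cmod (a n) \<le> (real n + 1) / 2" "cmod (b n) \<le> (real n - 1) / 2 * cmod \<alpha>"
    using C(5)[of n] C(6)[of n] by simp_all
next
  fix n :: nat assume n: "2 \<le> n"
  show "\<exists>f\<in>class_M \<alpha>. \<exists>h g a. harmonic_decomposition f h g \<and> has_power_series h a \<and> cmod (a n) = (real n + 1) / 2"
    by (rule coeffs_sharp(1)[OF n])
  show "\<exists>f\<in>class_M \<alpha>. \<exists>h g b. harmonic_decomposition f h g \<and> has_power_series g b \<and>
            cmod (b n) = (real n - 1) / 2 * cmod \<alpha>"
    by (rule coeffs_sharp(2)[OF n])
next
  fix f z assume f: "f \<in> class_M \<alpha>" and z: "z \<in> unit_disc"
  obtain h g where hg: "M_pair \<alpha> h g" "\<And>z. z \<in> unit_disc \<Longrightarrow> f z = h z + cnj (g z)"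
    using class_M_imp_M_pair[OF f] by blast
  show "cmod (f z) \<le> cmod z / (1 - cmod z)\<^sup>2 * (1 - 1 / 2 * (1 - cmod \<alpha>) * cmod z)"
    using M_pair_growth[OF hg(1) z] hg(2)[OF z] by simp
next
  fix r :: real assume "0 < r \<and> r < 1"
  then show "\<exists>f\<in>class_M \<alpha>. \<exists>z. cmod z = r \<and>
           cmod (f z) = cmod z / (1 - cmod z)\<^sup>2 * (1 - 1 / 2 * (1 - cmod \<alpha>) * cmod z)"
    using growth_sharp[of r \<alpha>] by blast
next
  fix f assume f: "f \<in> class_M \<alpha>"
  obtain h g where hg: "M_pair \<alpha> h g" "\<And>z. z \<in> unit_disc \<Longrightarrow> f z = h z + cnj (g z)"
    using class_M_imp_M_pair[OF f] by blast
  show "emeasure lebesgue (f ` unit_disc) \<ge> ennreal (pi * (1 - (cmod \<alpha>)\<^sup>2 / 2))"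
    by (rule M_pair_area_min[OF hg(1) assms hg(2)])
next
  show "g_extremal \<alpha> \<in> class_M \<alpha>"
    by (rule M_pair_imp_class_M(1)[OF M_pair_g_extremal g_extremal_decomp])
next
  fix f z assume f: "f \<in> class_M \<alpha>" and z: "z \<in> unit_disc"
    and eq: "emeasure lebesgue (f ` unit_disc) = ennreal (pi * (1 - (cmod \<alpha>)\<^sup>2 / 2))"
  obtain h g where hg: "M_pair \<alpha> h g" "\<And>z. z \<in> unit_disc \<Longrightarrow> f z = h z + cnj (g z)"
    using class_M_imp_M_pair[OF f] by blast
  have "deriv h x = 1" if "x \<in> unit_disc" for x
    using M_pair_area_gt[OF hg(1) assms hg(2) that] eq by auto
  then show "f z = g_extremal \<alpha> z" using M_pair_trivial_imp_g_extremal[OF hg(1) _ z] hg(2)[OF z] by simp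
next
  fix f assume "\<forall>z\<in>unit_disc. f z = g_extremal \<alpha> z"
  then show "emeasure lebesgue (f ` unit_disc) = ennreal (pi * (1 - (cmod \<alpha>)\<^sup>2 / 2))"
    using area_g_extremal[OF assms, of f] by blast
qed

end
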